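(* Let $\alpha,\beta,\gamma\in\mathbb{C}^\ast$, $x\in\mathbb{C}\setminus((-\infty,-1]\cup[1,\infty))$, $\Re\beta>0$, $\Re(\beta+\gamma)<0$, $\Re(\alpha+\gamma)>-1$. Put $$G:=G(x,t):=\frac{2-x^2-t^2}{2\sqrt{(1-x^2)(1-t^2)}}.$$ Then $$\mathsf{P}_\gamma^{(\alpha,\beta)}(2x^2-1)=\frac{2^{2\beta}\sin(\pi(\beta+\gamma))\Gamma(\alpha+2\gamma+2)\Gamma(\beta+\gamma+1)\Gamma(\alpha+\beta+\gamma+1)}{\sin(\pi\gamma)\Gamma(\gamma+1)\Gamma(\alpha+\gamma+1)\Gamma(\alpha+2\beta+2\gamma+1)\,x^{2\beta}(1-x^2)^{\frac12\alpha}}\int_{x}^{1}\mathsf{P}_\gamma^{(\alpha,\beta)}(2t^2-1)\,t\,(1-t^2)^{\frac12(\alpha-2)}(G^2-1)^{\beta-\frac12}C_{\alpha+2\gamma+1}^\beta(G)\,dt .$$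
   Context: $\mathbb{C}^\ast=\mathbb{C}\setminus\{0\}$. Let $\mathbf{F}(a,b;c;z)=\sum_{n\ge0}\frac{(a)_n(b)_n}{\Gamma(c+n)}\frac{z^n}{n!}$ (continued analytically to $\mathbb{C}\setminus[1,\infty)$) be the regularized Gauss hypergeometric function. Jacobi function of the first kind in the trigonometric context: $\mathsf{P}_\gamma^{(\alpha,\beta)}(x)=\frac{\Gamma(\alpha+\gamma+1)}{\Gamma(\gamma+1)}\mathbf{F}\big(-\gamma,\alpha+\beta+\gamma+1;\alpha+1;\frac{1-x}{2}\big)$. Gegenbauer function of the first kind, $z\in\mathbb{C}\setminus(-\infty,-1]$: $C_\lambda^\alpha(z)=\frac{\sqrt\pi\,\Gamma(2\alpha+\lambda)}{2^{2\alpha-1}\Gamma(\alpha)\Gamma(\lambda+1)}\mathbf{F}\big(-\lambda,2\alpha+\lambda;\alpha+\frac12;\frac{1-z}{2}\big)$. Convention: the basic range is $x\in(0,1)$ real (all powers and roots of positive numbers positive; $G\ge1$ for $x\le t<1$); for complex $x$ both sides are understood by analytic continuation from that range. Parameters are assumed such that all Gamma factors and functions are defined and $\sin(\pi\gamma)\ne0$. *)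

theory Defs
  imports "HOL-Complex_Analysis.Complex_Analysis"
begin

definition hyp2F1_reg_series :: "complex \<Rightarrow> complex \<Rightarrow> complex \<Rightarrow> complex \<Rightarrow> complex" where
  "hyp2F1_reg_series a b c z =
     (\<Sum>n. pochhammer a n * pochhammer b n * rGamma (c + of_nat n) * z ^ n / fact n)"

text \<open>
  The plane cut along the ray from 1 to infinity is connected, so the choice below is
  determined on it. Values on the cut are arbitrary and never used.
\<close>
definition hyp2F1_reg :: "complex \<Rightarrow> complex \<Rightarrow> complex \<Rightarrow> complex \<Rightarrow> complex" where
  "hyp2F1_reg a b c =
     (SOME f. f holomorphic_on - (of_real ` {1..}) \<and>
              (\<forall>z\<in>ball 0 1. f z = hyp2F1_reg_series a b c z))"

definition jacobi_P :: "complex \<Rightarrow> complex \<Rightarrow> complex \<Rightarrow> complex \<Rightarrow> complex" where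
  "jacobi_P \<gamma> \<alpha> \<beta> z =
     Gamma (\<alpha> + \<gamma> + 1) / Gamma (\<gamma> + 1) *
     hyp2F1_reg (- \<gamma>) (\<alpha> + \<beta> + \<gamma> + 1) (\<alpha> + 1) ((1 - z) / 2)"

definition gegenbauer_C :: "complex \<Rightarrow> complex \<Rightarrow> complex \<Rightarrow> complex" where
  "gegenbauer_C \<nu> \<alpha> z =
     of_real (sqrt pi) * Gamma (2 * \<alpha> + \<nu>) /
       (2 powr (2 * \<alpha> - 1) * Gamma \<alpha> * Gamma (\<nu> + 1)) *
     hyp2F1_reg (- \<nu>) (2 * \<alpha> + \<nu>) (\<alpha> + 1 / 2) ((1 - z) / 2)"

text \<open>
  The square root of the product is split into a product of principal square roots. This changes
  nothing for real arguments in (0,1), but for complex arguments the product of the two factors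
  may cross the negative real axis although neither factor does.
\<close>
definition G_arg :: "complex \<Rightarrow> complex \<Rightarrow> complex" where
  "G_arg x t = (2 - x\<^sup>2 - t\<^sup>2) / (2 * (csqrt (1 - x\<^sup>2) * csqrt (1 - t\<^sup>2)))"

definition jacobi_integrand :: "complex \<Rightarrow> complex \<Rightarrow> complex \<Rightarrow> complex \<Rightarrow> complex \<Rightarrow> complex" where
  "jacobi_integrand \<alpha> \<beta> \<gamma> x t =
     jacobi_P \<gamma> \<alpha> \<beta> (2 * t\<^sup>2 - 1) * t * (1 - t\<^sup>2) powr ((\<alpha> - 2) / 2) *
     ((G_arg x t)\<^sup>2 - 1) powr (\<beta> - 1 / 2) *
     gegenbauer_C (\<alpha> + 2 * \<gamma> + 1) \<beta> (G_arg x t)"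

text \<open>
  On the open right half-plane cut along the ray from 1 to infinity all branches in the two
  definitions below are principal and are the continuations of the positive branches on (0,1):
  for t strictly between x and 1 on the segment, the squared G minus 1 is the square of a number
  with positive real part.
\<close>
definition jacobi_lhs :: "complex \<Rightarrow> complex \<Rightarrow> complex \<Rightarrow> complex \<Rightarrow> complex" where
  "jacobi_lhs \<alpha> \<beta> \<gamma> x = jacobi_P \<gamma> \<alpha> \<beta> (2 * x\<^sup>2 - 1)"

definition jacobi_rhs :: "complex \<Rightarrow> complex \<Rightarrow> complex \<Rightarrow> complex \<Rightarrow> complex" where
  "jacobi_rhs \<alpha> \<beta> \<gamma> x =
     2 powr (2 * \<beta>) * sin (of_real pi * (\<beta> + \<gamma>)) * Gamma (\<alpha> + 2 * \<gamma> + 2) *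
       Gamma (\<beta> + \<gamma> + 1) * Gamma (\<alpha> + \<beta> + \<gamma> + 1) /
     (sin (of_real pi * \<gamma>) * Gamma (\<gamma> + 1) * Gamma (\<alpha> + \<gamma> + 1) *
       Gamma (\<alpha> + 2 * \<beta> + 2 * \<gamma> + 1) * x powr (2 * \<beta>) * (1 - x\<^sup>2) powr (\<alpha> / 2)) *
     contour_integral (linepath x 1) (jacobi_integrand \<alpha> \<beta> \<gamma> x)"

text \<open>
  The function f is holomorphic on the domain U and continues there the germ of h along a
  subinterval of (0,1). Subintervals are admitted, rather than only (0,1) itself, so that U may
  wind around the branch point 0.
\<close>
definition continues_from :: "real \<Rightarrow> real \<Rightarrow> complex set \<Rightarrow> (complex \<Rightarrow> complex) \<Rightarrow> (complex \<Rightarrow> complex) \<Rightarrow> bool" where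
  "continues_from a b U h f \<longleftrightarrow>
     0 \<le> a \<and> a < b \<and> b \<le> 1 \<and> open U \<and> connected U \<and> of_real ` {a<..<b} \<subseteq> U \<and>
     f holomorphic_on U \<and> (\<forall>r\<in>{a<..<b}. f (of_real r) = h (of_real r))"

end

theory Submission
  imports Defs
begin

text \<open>
  Put \<open>y = 1 - x\<^sup>2\<close> and \<open>u = (1 - t\<^sup>2) / y\<close>. Then \<open>G = (u + 1) / (2 * sqrt u) = cosh \<theta>\<close> with \<open>u = exp (-2 * \<theta>)\<close>,
  so apart from the Jacobi function, which depends on \<open>y * u\<close>, the integrand is a function of \<open>u\<close> alone, and the
  integral is a multiplicative convolution. By Laplace's integral for the Gegenbauer function, the kernel is a
  power of \<open>u\<close> times an Euler integral, and its moments are products of two Beta functions (it is a composition of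
  two fractional integrals of order \<open>\<beta>\<close>). Integrating the power series of the Jacobi function term by term hence
  turns the hypergeometric coefficients with parameters \<open>- \<gamma>\<close> and \<open>\<alpha> + \<beta> + \<gamma> + 1\<close> into those with parameters
  \<open>\<alpha> + \<gamma> + 1\<close> and \<open>- \<beta> - \<gamma>\<close>, and Euler's transformation leads back to the former at the cost of the factor
  \<open>(1 - y) powr \<beta> = x powr (2 * \<beta>)\<close>. This settles \<open>0 < x < 1\<close>; for complex \<open>x\<close> both sides are holomorphic.
\<close>

section \<open>Integrals depending holomorphically on a parameter\<close>

text \<open>The three inequalities say that \<open>\<beta>\<close>,
  \<open>- \<beta> - \<gamma>\<close> and \<open>\<alpha> + \<gamma> + 1\<close> have positive real
  part, which makes both Beta functions in the moments converge. Their sum is the lower parameter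
  \<open>\<alpha> + 1\<close> of the Jacobi function. This coincidence closes the circle:
  subtracting \<open>\<alpha> + \<gamma> + 1\<close> or \<open>- \<beta> - \<gamma>\<close> from it
  leaves \<open>- \<gamma>\<close> or \<open>\<alpha> + \<beta> + \<gamma> + 1\<close>, so Euler's
  transformation returns to the original function. The quotient of sines comes from the reflection
  formula for \<open>Gamma (- \<gamma>)\<close> and \<open>Gamma (- (\<beta> + \<gamma>))\<close>.
  Laplace's integral and Euler's transformation rest on one uniqueness principle for holomorphic
  solutions at a regular singular point. For complex \<open>x\<close> the obstacle is holomorphy of
  the right-hand side: the integrand is singular at both ends of a segment that moves with
  \<open>x\<close>, and near \<open>t = 1\<close> the Gegenbauer factor can follow different powers,
  or a logarithm, depending on the parameters. Hence the segment is parametrised by a fixed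
  interval, and the majorant is built from an integral instead of a power.\<close>

lemma parametric_integral_derivative:
  fixes f :: "complex \<Rightarrow> 'a \<Rightarrow> complex"
  assumes S: "open S"
    and hol: "\<And>w. w \<in> space M \<Longrightarrow> (\<lambda>z. f z w) holomorphic_on S"
    and meas: "\<And>z. z \<in> S \<Longrightarrow> f z \<in> borel_measurable M"
    and dom: "\<And>z. z \<in> S \<Longrightarrow> \<exists>e>0. \<exists>g. integrable M g \<and> cball z e \<subseteq> S \<and>
                (\<forall>z'\<in>cball z e. \<forall>w\<in>space M. norm (f z' w) \<le> (g w :: real))"
    and z: "z \<in> S"
  shows integrable_parametric_integral: "integrable M (f z)"
    and has_field_derivative_parametric_integral:
      "((\<lambda>z. integral\<^sup>L M (f z)) has_field_derivative
         integral\<^sup>L M (\<lambda>w. deriv (\<lambda>z. f z w) z)) (at z)"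
proof -
  obtain e g where e: "e > 0" "integrable M g" "cball z e \<subseteq> S"
    "\<And>z' w. z' \<in> cball z e \<Longrightarrow> w \<in> space M \<Longrightarrow> norm (f z' w) \<le> g w"
    using dom[OF z] by blast
  have int: "integrable M (f z')" if "z' \<in> cball z e" for z'
    using e that by (intro Bochner_Integration.integrable_bound[OF e(2) meas]) (auto intro!: AE_I2 order_trans[OF e(4)])
  show int0: "integrable M (f z)" using int[of z] e by simp
  \<comment> \<open>Cauchy's estimate on the circle of radius \<open>e/2\<close> about
    \<open>z'\<close>, which stays in \<open>cball z e\<close>, turns the bound on the values into
    one on the derivatives. Thus a majorant of \<open>f\<close> alone suffices.\<close>
  have derb: "norm (deriv (\<lambda>z. f z w) z') \<le> 2 * g w / e" if "z' \<in> cball z (e/2)" "w \<in> space M" for z' w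
  proof -
    have sub: "cball z' (e/2) \<subseteq> cball z e"
    proof
      fix x assume "x \<in> cball z' (e/2)"
      then show "x \<in> cball z e"
        using that dist_triangle[of z x z'] by auto
    qed
    have h: "(\<lambda>z. f z w) holomorphic_on cball z' (e/2)"
      by (rule holomorphic_on_subset[OF hol[OF that(2)]]) (use sub e in auto)
    have "norm ((deriv ^^ 1) (\<lambda>z. f z w) z') \<le> fact 1 * g w / (e/2)^1"
    proof (rule Cauchy_inequality)
      show "(\<lambda>z. f z w) holomorphic_on ball z' (e / 2)"
        by (rule holomorphic_on_subset[OF h]) auto
      show "continuous_on (cball z' (e / 2)) (\<lambda>z. f z w)"
        by (rule holomorphic_on_imp_continuous_on[OF h])
      show "norm (f x w) \<le> g w" if "norm (z' - x) = e/2" for x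
        using sub that \<open>w \<in> space M\<close> by (intro e) (auto simp: dist_norm subset_iff)
    qed (use e in auto)
    then show ?thesis by (simp add: mult.commute)
  qed
  have lip: "norm (f z' w - f z w) \<le> 2 * g w / e * norm (z' - z)" if "z' \<in> cball z (e/2)" "w \<in> space M" for z' w
  proof (rule field_differentiable_bound[where f' = "deriv (\<lambda>z. f z w)"])
    show "convex (cball z (e/2))" by simp
    show "((\<lambda>z. f z w) has_field_derivative deriv (\<lambda>z. f z w) x) (at x within cball z (e / 2))"
      if "x \<in> cball z (e/2)" for x
      using that e \<open>w \<in> space M\<close> hol S
      by (intro has_field_derivative_at_within[OF holomorphic_derivI[of _ S]]) (auto simp: subset_iff)
  qed (use that derb e in auto)
  have dlim: "(\<lambda>n. (f (X n) w - f z w) / (X n - z)) \<longlonglongrightarrow> deriv (\<lambda>z. f z w) z"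
    if "w \<in> space M" "\<And>n. X n \<noteq> z" "X \<longlonglongrightarrow> z" for X w
  proof -
    have "((\<lambda>z. f z w) has_field_derivative deriv (\<lambda>z. f z w) z) (at z)"
      using that hol S z by (intro holomorphic_derivI[of _ S]) auto
    then have "((\<lambda>y. (f y w - f z w) / (y - z)) \<longlongrightarrow> deriv (\<lambda>z. f z w) z) (at z)"
      by (simp add: has_field_derivative_iff)
    then show ?thesis
      using that unfolding tendsto_at_iff_sequentially by (auto simp: o_def)
  qed
  have lim: "(\<lambda>n. integral\<^sup>L M (\<lambda>w. (f (X n) w - f z w) / (X n - z))) \<longlonglongrightarrow> integral\<^sup>L M (\<lambda>w. deriv (\<lambda>z. f z w) z)"
    if X: "\<And>n. X n \<noteq> z" "X \<longlonglongrightarrow> z" "\<And>n. X n \<in> cball z (e/2)" for X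
  proof -
    have m: "(\<lambda>w. (f (X n) w - f z w) / (X n - z)) \<in> borel_measurable M" for n
      using meas[OF z] meas[of "X n"] X(3)[of n] e(3) e(1) by (auto simp: subset_iff)
    have m': "(\<lambda>w. deriv (\<lambda>z. f z w) z) \<in> borel_measurable M"
      by (rule borel_measurable_LIMSEQ_metric[where f = "\<lambda>n w. (f (X n) w - f z w) / (X n - z)", OF m])
         (use dlim[OF _ X(1,2)] in auto)
    have i: "integrable M (\<lambda>w. 2 * g w / e)" using e by auto
    have b: "AE w in M. norm ((f (X n) w - f z w) / (X n - z)) \<le> 2 * g w / e" for n
      using lip[OF X(3)] X(1) by (intro AE_I2) (simp add: norm_divide divide_le_eq)
    have l: "AE w in M. (\<lambda>n. (f (X n) w - f z w) / (X n - z)) \<longlonglongrightarrow> deriv (\<lambda>z. f z w) z"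
      using dlim[OF _ X(1,2)] by (intro AE_I2) auto
    show ?thesis
      by (rule integral_dominated_convergence[OF m' m i l b])
  qed
  show "((\<lambda>z. integral\<^sup>L M (f z)) has_field_derivative integral\<^sup>L M (\<lambda>w. deriv (\<lambda>z. f z w) z)) (at z)"
    unfolding has_field_derivative_iff tendsto_at_iff_sequentially
  proof (intro allI impI)
    fix Y :: "nat \<Rightarrow> complex" assume Y: "\<forall>i. Y i \<in> UNIV - {z}" "Y \<longlonglongrightarrow> z"
    have "eventually (\<lambda>n. Y n \<in> cball z (e/2)) sequentially"
      using Y(2) e by (auto simp: tendsto_iff dist_commute intro: eventually_mono dest!: spec[of _ "e/2"])
    then obtain N where N: "\<And>n. n \<ge> N \<Longrightarrow> Y n \<in> cball z (e/2)"
      by (auto simp: eventually_sequentially)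
    \<comment> \<open>An arbitrary sequence tending to \<open>z\<close> may start outside
      \<open>cball z (e/2)\<close>, where no bound is available; dropping finitely many terms leaves
      the limit unchanged.\<close>
    define Z where "Z n = Y (n + N)" for n
    have Zl: "Z \<longlonglongrightarrow> z" unfolding Z_def using Y(2) by (rule LIMSEQ_ignore_initial_segment)
    have "Z n \<noteq> z" "Z n \<in> cball z (e/2)" for n
      using Y N[of "n + N"] by (auto simp: Z_def)
    from lim[OF this(1) Zl this(2)]
    have "(\<lambda>n. integral\<^sup>L M (\<lambda>w. (f (Z n) w - f z w) / (Z n - z))) \<longlonglongrightarrow> integral\<^sup>L M (\<lambda>w. deriv (\<lambda>z. f z w) z)"
      by blast
    moreover have "integral\<^sup>L M (\<lambda>w. (f (Z n) w - f z w) / (Z n - z)) = (integral\<^sup>L M (f (Z n)) - integral\<^sup>L M (f z)) / (Z n - z)" for n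
    proof -
      have "integrable M (f (Z n))" using N[of "n+N"] e by (intro int) (auto simp: Z_def)
      then show ?thesis using int0 by simp
    qed
    ultimately have "(\<lambda>n. (integral\<^sup>L M (f (Y (n + N))) - integral\<^sup>L M (f z)) / (Y (n + N) - z)) \<longlonglongrightarrow> integral\<^sup>L M (\<lambda>w. deriv (\<lambda>z. f z w) z)"
      by (simp only: Z_def)
    then show "((\<lambda>y. (integral\<^sup>L M (f y) - integral\<^sup>L M (f z)) / (y - z)) \<circ> Y) \<longlonglongrightarrow> integral\<^sup>L M (\<lambda>w. deriv (\<lambda>z. f z w) z)"
      unfolding o_def by (rule LIMSEQ_offset)
  qed
qed

lemma holomorphic_parametric_integral:
  fixes f :: "complex \<Rightarrow> 'a \<Rightarrow> complex"
  assumes "open S"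
    and "\<And>w. w \<in> space M \<Longrightarrow> (\<lambda>z. f z w) holomorphic_on S"
    and "\<And>z. z \<in> S \<Longrightarrow> f z \<in> borel_measurable M"
    and "\<And>z. z \<in> S \<Longrightarrow> \<exists>e>0. \<exists>g. integrable M g \<and> cball z e \<subseteq> S \<and>
                (\<forall>z'\<in>cball z e. \<forall>w\<in>space M. norm (f z' w) \<le> (g w :: real))"
  shows "(\<lambda>z. integral\<^sup>L M (f z)) holomorphic_on S"
  unfolding holomorphic_on_open[OF assms(1)]
  using has_field_derivative_parametric_integral[OF assms] by blast

section \<open>Beta integrals\<close>

text \<open>The end points are excluded so that every weight is continuous on the whole space; the
  conventional value of a power with base \<open>0\<close> never enters.\<close>

abbreviation unit_borel :: "real measure" where
  "unit_borel \<equiv> restrict_space lborel {0<..<1}"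

lemma space_unit_borel [simp]: "space unit_borel = {0<..<1}"
  by (simp add: space_restrict_space)

lemma measurable_unit_borel:
  fixes f :: "real \<Rightarrow> 'b :: topological_space"
  assumes "continuous_on {0<..<1} f"
  shows "f \<in> borel_measurable unit_borel"
proof -
  have "f \<in> borel_measurable (restrict_space borel {0<..<1})"
    by (rule borel_measurable_continuous_on_restrict[OF assms])
  moreover have "sets unit_borel = sets (restrict_space borel {0<..<1})"
    by (intro sets_restrict_space_cong sets_lborel)
  ultimately show ?thesis unfolding measurable_cong_sets[OF \<open>sets unit_borel = _\<close> refl] by blast
qed

text \<open>The argument of \<open>z\<close> is at most \<open>pi\<close> in absolute value, so the
  imaginary part of the exponent costs only a constant factor. Majorants therefore involve the real
  parts of the parameters alone.\<close>

lemma norm_powr_complex_le: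
  fixes z p :: complex
  shows "norm (z powr p) \<le> norm z powr Re p * exp (pi * \<bar>Im p\<bar>)"
proof (cases "z = 0")
  case False
  have "norm (z powr p) = exp (Re p * ln (norm z) - Im p * Im (Ln z))"
    using False by (simp add: powr_def)
  also have "\<dots> = norm z powr Re p * exp (- (Im p * Im (Ln z)))"
    using False by (simp add: powr_def exp_diff exp_minus divide_simps)
  also have "- (Im p * Im (Ln z)) \<le> \<bar>Im p\<bar> * \<bar>Im (Ln z)\<bar>"
    by (metis abs_ge_minus_self abs_mult)
  also have "\<dots> \<le> \<bar>Im p\<bar> * pi"
    using False mpi_less_Im_Ln[of z] Im_Ln_le_pi[of z] by (intro mult_left_mono) auto
  finally show ?thesis by (simp add: mult.commute[of pi] mult_left_mono)
qed simp

lemma norm_of_real_powr: "t > 0 \<Longrightarrow> norm (complex_of_real t powr p) = t powr Re p"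
  by (simp add: norm_powr_real_powr)

definition beta_weight :: "complex \<Rightarrow> complex \<Rightarrow> real \<Rightarrow> complex" where
  "beta_weight a b t = of_real t powr (a - 1) * of_real (1 - t) powr (b - 1)"

lemma norm_beta_weight:
  "t \<in> {0<..<1} \<Longrightarrow> norm (beta_weight a b t) = t powr (Re a - 1) * (1 - t) powr (Re b - 1)"
  using norm_of_real_powr[of t] norm_of_real_powr[of "1 - t"] by (simp add: beta_weight_def norm_mult)

lemma continuous_on_beta_weight: "continuous_on {0<..<1} (beta_weight a b)"
  unfolding beta_weight_def
  by (intro continuous_intros) (auto simp: complex_nonpos_Reals_iff)

lemma integrable_real_beta_weight:
  assumes "a > 0" "b > (0::real)"
  shows "integrable unit_borel (\<lambda>t. t powr (a - 1) * (1 - t) powr (b - 1))"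
    and "integral\<^sup>L unit_borel (\<lambda>t. t powr (a - 1) * (1 - t) powr (b - 1)) = Beta a b"
proof -
  let ?f = "\<lambda>t. t powr (a - 1) * (1 - t) powr (b - 1)"
  have "set_integrable lborel {0..1} ?f" using integrable_Beta[OF assms] .
  then have i: "set_integrable lborel {0<..<1} ?f" by (rule set_integrable_subset) auto
  then show "integrable unit_borel ?f"
    by (subst integrable_restrict_space) (auto simp: set_integrable_def)
  have "(?f has_integral Beta a b) {0<..<1}"
    using has_integral_Beta_real[OF assms] by (simp add: has_integral_Icc_iff_Ioo)
  then have "Beta a b = integral {0<..<1} ?f" by (simp add: integral_unique)
  also have "\<dots> = integral\<^sup>L unit_borel ?f"
    by (subst set_borel_integral_eq_integral(2)[OF i, symmetric])
       (subst integral_restrict_space, auto simp: set_lebesgue_integral_def)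
  finally show "integral\<^sup>L unit_borel ?f = Beta a b" ..
qed

lemma integrable_beta_weight_mult:
  fixes h :: "real \<Rightarrow> complex"
  assumes "Re a > 0" "Re b > 0" and h: "h \<in> borel_measurable unit_borel"
    and B: "\<And>t. t \<in> {0<..<1} \<Longrightarrow> norm (h t) \<le> B"
  shows "integrable unit_borel (\<lambda>t. beta_weight a b t * h t)"
proof (rule Bochner_Integration.integrable_bound)
  show "integrable unit_borel (\<lambda>t. (t powr (Re a - 1) * (1 - t) powr (Re b - 1)) * B)"
    using assms by (intro integrable_mult_left integrable_real_beta_weight)
  show "(\<lambda>t. beta_weight a b t * h t) \<in> borel_measurable unit_borel"
    by (intro borel_measurable_times h measurable_unit_borel continuous_on_beta_weight)
  show "AE t in unit_borel. norm (beta_weight a b t * h t)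
          \<le> norm (t powr (Re a - 1) * (1 - t) powr (Re b - 1) * B)"
  proof (rule AE_I2)
    fix t assume t: "t \<in> space unit_borel"
    then have "norm (h t) \<le> \<bar>B\<bar>" using B[of t] by auto
    then show "norm (beta_weight a b t * h t) \<le> norm (t powr (Re a - 1) * (1 - t) powr (Re b - 1) * B)"
      using t by (auto simp: norm_mult norm_beta_weight abs_mult intro!: mult_left_mono)
  qed
qed

lemma integrable_beta_weight:
  assumes "Re a > 0" "Re b > 0"
  shows "integrable unit_borel (beta_weight a b)"
  using integrable_beta_weight_mult[OF assms, of "\<lambda>_. 1" 1] by simp

lemma unit_borel_reflect_integral:
  "integral\<^sup>L unit_borel (\<lambda>t. f (1 - t)) = (integral\<^sup>L unit_borel f :: 'a :: {banach, second_countable_topology})"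
proof -
  have "integral\<^sup>L unit_borel f = integral\<^sup>L lborel (\<lambda>t. indicator {0<..<1} t *\<^sub>R f t)"
    by (simp add: integral_restrict_space)
  also have "\<dots> = integral\<^sup>L lborel (\<lambda>t. indicator {0<..<1} (1 - t) *\<^sub>R f (1 - t))"
    by (subst lborel_integral_real_affine[where c="-1" and t=1]) auto
  also have "\<dots> = integral\<^sup>L lborel (\<lambda>t. indicator {0<..<1} t *\<^sub>R f (1 - t))"
    by (intro Bochner_Integration.integral_cong) (auto simp: indicator_def)
  finally show ?thesis by (simp add: integral_restrict_space)
qed

lemma beta_integral_holomorphic:
  assumes "Re b > 0"
  shows "(\<lambda>a. integral\<^sup>L unit_borel (beta_weight a b)) holomorphic_on {a. Re a > 0}"
proof (rule holomorphic_parametric_integral)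
  show "open {a. 0 < Re a}" by (rule open_halfspace_Re_gt)
  show "(\<lambda>a. beta_weight a b t) holomorphic_on {a. 0 < Re a}" if "t \<in> space unit_borel" for t
    using that unfolding beta_weight_def by (intro holomorphic_intros) auto
  show "beta_weight a b \<in> borel_measurable unit_borel" for a
    by (intro measurable_unit_borel continuous_on_beta_weight)
  fix a :: complex assume a: "a \<in> {a. 0 < Re a}"
  \<comment> \<open>On this ball the real part stays at least \<open>e > 0\<close>. Since
    \<open>t < 1\<close>, the smallest exponent gives the largest power, so exponent
    \<open>e - 1\<close> dominates.\<close>
  define e where "e = Re a / 2"
  have sub: "Re a' \<ge> e" if "a' \<in> cball a e" for a'
    using that abs_Re_le_cmod[of "a - a'"] a by (auto simp: dist_norm e_def)
  show "\<exists>e>0. \<exists>g. integrable unit_borel g \<and> cball a e \<subseteq> {a. 0 < Re a} \<and>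
                (\<forall>a'\<in>cball a e. \<forall>t\<in>space unit_borel. norm (beta_weight a' b t) \<le> g t)"
  proof (intro exI conjI ballI)
    show "e > 0" using a by (simp add: e_def)
    then show "integrable unit_borel (\<lambda>t. t powr (e - 1) * (1 - t) powr (Re b - 1))"
      using assms by (intro integrable_real_beta_weight)
    show "cball a e \<subseteq> {a. 0 < Re a}" using sub \<open>e > 0\<close> by force
    fix a' t assume "a' \<in> cball a e" "t \<in> space unit_borel"
    then show "norm (beta_weight a' b t) \<le> t powr (e - 1) * (1 - t) powr (Re b - 1)"
      using sub[of a'] by (auto simp: norm_beta_weight intro!: mult_right_mono powr_mono')
  qed
qed

lemma Beta_holomorphic:
  assumes "Re b > 0"
  shows "(\<lambda>a. Beta a b) holomorphic_on {a. Re a > 0}"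
  unfolding Beta_altdef using assms
  by (intro holomorphic_intros) (auto elim!: nonpos_Ints_cases)

text \<open>Identity theorem, with the midpoint of the interval as accumulation point. It serves for
  the passage to complex Beta parameters as well as for the continuation in
  \<open>x\<close>.\<close>

lemma holomorphic_eq_from_real_interval:
  assumes f: "f holomorphic_on U" and g: "g holomorphic_on U" and U: "open U" "connected U"
    and ab: "a < b" "of_real ` {a<..<b} \<subseteq> U"
    and eq: "\<And>r. r \<in> {a<..<b} \<Longrightarrow> f (of_real r) = g (of_real r)" and z: "z \<in> U"
  shows "f z = g z"
proof -
  have "(a + b) / 2 islimpt {a<..<b}"
    using ab by (intro open_imp_islimpt) auto
  then have "of_real ((a + b) / 2) islimpt (of_real ` {a<..<b} :: complex set)"
    using islimpt_isCont_image[of "(a + b) / 2" "{a<..<b}" "complex_of_real"]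
    by (simp only: of_real_eq_iff) (simp add: eventually_at_filter)
  moreover have "(\<lambda>z. f z - g z) holomorphic_on U" using f g by (intro holomorphic_intros)
  moreover have "of_real ((a + b) / 2) \<in> U" using ab(1) by (intro subsetD[OF ab(2)] imageI) auto
  moreover have "f w - g w = 0" if "w \<in> of_real ` {a<..<b}" for w
    using that eq by auto
  ultimately have "f z - g z = 0"
    using analytic_continuation[of "\<lambda>z. f z - g z" U "of_real ` {a<..<b}" "of_real ((a + b) / 2)" z]
      U ab(2) z by blast
  then show ?thesis by simp
qed

text \<open>The real formula is continued in one parameter at a time over the right half-plane. The
  reflection of \<open>t\<close> to \<open>1 - t\<close> swaps the parameters, so holomorphy in the
  first one is enough.\<close>

lemma integral_beta_weight:
  assumes a: "Re a > 0" and b: "Re b > 0"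
  shows "integral\<^sup>L unit_borel (beta_weight a b) = Beta a b"
proof -
  have real: "integral\<^sup>L unit_borel (beta_weight (of_real r) (of_real s)) = Beta (of_real r) (of_real s)"
    if "r > 0" "s > 0" for r s :: real
  proof -
    have "integral\<^sup>L unit_borel (beta_weight (of_real r) (of_real s)) =
          integral\<^sup>L unit_borel (\<lambda>t. complex_of_real (t powr (r - 1) * (1 - t) powr (s - 1)))"
      by (intro Bochner_Integration.integral_cong refl)
         (auto simp: beta_weight_def powr_of_real[symmetric])
    also have "\<dots> = of_real (Beta r s)"
      by (simp only: integral_complex_of_real integrable_real_beta_weight that)
    finally show ?thesis by (simp add: Beta_complex_of_real)
  qed
  have half: "integral\<^sup>L unit_borel (beta_weight a (of_real s)) = Beta a (of_real s)" if "Re a > 0" "s > 0" for a s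
    by (rule holomorphic_eq_from_real_interval[where f = "\<lambda>a. integral\<^sup>L unit_borel (beta_weight a (of_real s))"
           and U = "{a. Re a > 0}" and a = 1 and b = 2])
       (use that in \<open>auto intro!: beta_integral_holomorphic Beta_holomorphic real convex_connected
          simp: open_halfspace_Re_gt convex_halfspace_Re_gt\<close>)
  have sym: "integral\<^sup>L unit_borel (beta_weight a b) = integral\<^sup>L unit_borel (beta_weight b a)" for a b
  proof -
    have "integral\<^sup>L unit_borel (beta_weight a b) = integral\<^sup>L unit_borel (\<lambda>t. beta_weight a b (1 - t))"
      by (rule unit_borel_reflect_integral[symmetric])
    also have "(\<lambda>t. beta_weight a b (1 - t)) = beta_weight b a"
      by (auto simp: beta_weight_def mult.commute)
    finally show ?thesis .
  qed
  have "integral\<^sup>L unit_borel (beta_weight b a) = Beta b a"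
  proof (rule holomorphic_eq_from_real_interval[where f = "\<lambda>b. integral\<^sup>L unit_borel (beta_weight b a)"
           and U = "{a. Re a > 0}" and a = 1 and b = 2])
    show "integral\<^sup>L unit_borel (beta_weight (of_real r) a) = Beta (of_real r) a" if "r \<in> {1<..<2}" for r
      using half[OF a, of r] that by (simp add: sym[of "of_real r" a] Beta_commute)
  qed (use a b in \<open>auto intro!: beta_integral_holomorphic Beta_holomorphic convex_connected
          simp: open_halfspace_Re_gt convex_halfspace_Re_gt\<close>)
  then show ?thesis by (simp add: sym[of a b] Beta_commute)
qed

section \<open>The hypergeometric function\<close>

text \<open>At the regular singular point \<open>0\<close> the indicial polynomial is \<open>k * (Z' * (k - 1) + P 0)\<close>; it must not
  vanish at the order \<open>k > 0\<close> of a zero of a solution.\<close>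
lemma holomorphic_ode_unique:
  fixes f :: "complex \<Rightarrow> complex"
  assumes f: "f holomorphic_on S" and S: "open S" "connected S" "0 \<in> S"
    and f0: "f 0 = 0"
    and Z: "Z 0 = 0" "(Z has_field_derivative Z') (at 0)" 
    and P: "isCont P 0" and Q: "isCont Q 0"
    and ind: "\<And>k::nat. k > 0 \<Longrightarrow> Z' * of_nat (k - 1) + P 0 \<noteq> 0"
    and ode: "\<And>z. z \<in> S \<Longrightarrow> Z z * deriv (deriv f) z + P z * deriv f z + Q z * f z = 0"
    and z: "z \<in> S"
  shows "f z = 0"
proof (rule ccontr)
  assume "f z \<noteq> 0"
  with f0 z S have "\<not> f constant_on S" by (metis constant_on_def)
  from holomorphic_factor_zero_nonconstant[OF f S f0 this]
  obtain g r n where n: "0 < n" "0 < r" "ball 0 r \<subseteq> S" and g: "g holomorphic_on ball 0 r"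
    and fg: "\<And>w. w \<in> ball 0 r \<Longrightarrow> f w = (w - 0) ^ n * g w" and g0: "\<And>w. w \<in> ball 0 r \<Longrightarrow> g w \<noteq> 0"
    by metis
  obtain m where m: "n = Suc m" using n by (cases n) auto
  have gd: "(g has_field_derivative deriv g w) (at w)" if "w \<in> ball 0 r" for w
    using that g by (intro holomorphic_derivI[of _ "ball 0 r"]) auto
  have gdd: "(deriv g has_field_derivative deriv (deriv g) w) (at w)" if "w \<in> ball 0 r" for w
    using that g by (intro holomorphic_derivI[of _ "ball 0 r"] holomorphic_deriv) auto
  have f1: "deriv f w = of_nat n * w ^ m * g w + w ^ n * deriv g w" if w: "w \<in> ball 0 r" for w
  proof (rule DERIV_imp_deriv, rule has_field_derivative_transform_within_open[where S = "ball 0 r"])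
    show "((\<lambda>w. w ^ n * g w) has_field_derivative of_nat n * w ^ m * g w + w ^ n * deriv g w) (at w)"
      by (rule derivative_eq_intros gd w refl | simp add: m algebra_simps)+
  qed (use w fg in auto)
  \<comment> \<open>The extra factor \<open>w\<close> avoids the exponent \<open>m - 1\<close>,
    which is truncated when the zero is simple. It is paid for by \<open>Z\<close>, which vanishes
    at \<open>0\<close>.\<close>
  have f2: "w * deriv (deriv f) w = w ^ m * (of_nat (n * m) * g w + 2 * of_nat n * w * deriv g w + w\<^sup>2 * deriv (deriv g) w)"
    if w: "w \<in> ball 0 r" for w
  proof -
    have "deriv (deriv f) w = of_nat n * (of_nat m * w ^ (m - 1)) * g w + of_nat n * w ^ m * deriv g w +
            (of_nat n * w ^ m * deriv g w + w ^ n * deriv (deriv g) w)"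
    proof (rule DERIV_imp_deriv, rule has_field_derivative_transform_within_open[where S = "ball 0 r"])
      show "((\<lambda>w. of_nat n * w ^ m * g w + w ^ n * deriv g w) has_field_derivative 
         of_nat n * (of_nat m * w ^ (m - 1)) * g w + of_nat n * w ^ m * deriv g w +
            (of_nat n * w ^ m * deriv g w + w ^ n * deriv (deriv g) w)) (at w)"
        by (rule derivative_eq_intros gd gdd w refl | simp add: m algebra_simps)+
    qed (use w f1 in auto)
    then show ?thesis by (cases m) (simp_all add: \<open>n = Suc m\<close> algebra_simps power2_eq_square)
  qed
  \<comment> \<open>This is the equation divided by \<open>w ^ m\<close>. Because of the quotient
    \<open>Z w / w\<close> its limit at \<open>0\<close>, not its value there, yields the indicial
    polynomial times \<open>g 0\<close>.\<close>
  define H where "H w = Z w / w * (of_nat (n * m) * g w + 2 * of_nat n * w * deriv g w + w\<^sup>2 * deriv (deriv g) w) +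
      P w * (of_nat n * g w + w * deriv g w) + Q w * (w * g w)" for w
  have H: "H w = 0" if w: "w \<in> ball 0 r" "w \<noteq> 0" for w
  proof -
    have "w ^ m * H w = Z w / w * (w * deriv (deriv f) w) + P w * deriv f w + Q w * f w"
      using w by (simp add: H_def f1 f2 fg) (simp add: m algebra_simps)
    also have "\<dots> = 0" using ode[of w] w n by auto
    finally show ?thesis using w by simp
  qed
  have "((\<lambda>w. Z w / w) \<longlongrightarrow> Z') (at 0)"
    using Z by (simp add: has_field_derivative_iff)
  moreover have "isCont g 0" "isCont (deriv g) 0" "isCont (deriv (deriv g)) 0"
    using n g by (auto intro!: continuous_on_interior[of "ball 0 r"] holomorphic_on_imp_continuous_on holomorphic_deriv)
  ultimately have "(H \<longlongrightarrow> Z' * (of_nat (n * m) * g 0 + 2 * of_nat n * 0 * deriv g 0 + 0\<^sup>2 * deriv (deriv g) 0) +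
      P 0 * (of_nat n * g 0 + 0 * deriv g 0) + Q 0 * (0 * g 0)) (at 0)"
    unfolding H_def using P Q by (intro tendsto_intros isContD)
  moreover have "(H \<longlongrightarrow> 0) (at 0)"
  proof (rule Lim_transform_within_open[OF tendsto_const])
    show "open (ball 0 r)" by simp
  qed (use H n in auto)
  ultimately have "Z' * (of_nat (n * m) * g 0) + P 0 * (of_nat n * g 0) = 0"
    using LIM_unique by fastforce
  then have "of_nat n * g 0 * (Z' * of_nat m + P 0) = 0" by (simp add: algebra_simps)
  with ind[of n] g0[of 0] n show False by (simp add: m del: of_nat_Suc)
qed

text \<open>As \<open>0 < t < 1\<close>, absolutely summable coefficients dominate the series by a
  multiple of \<open>norm (g t)\<close>. Only integrability of \<open>g\<close> enters, so
  singularities at the end points are harmless.\<close>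

lemma integral_power_series_sums:
  fixes g :: "real \<Rightarrow> complex"
  assumes g: "integrable unit_borel g" and c: "summable (\<lambda>n. norm (c n))"
  shows "(\<lambda>n. c n * integral\<^sup>L unit_borel (\<lambda>t. g t * of_real t ^ n)) sums
           integral\<^sup>L unit_borel (\<lambda>t. g t * (\<Sum>n. c n * of_real t ^ n))"
proof -
  have gm: "g \<in> borel_measurable unit_borel" using g by auto
  have m: "(\<lambda>t. c n * (g t * of_real t ^ n)) \<in> borel_measurable unit_borel" for n
    by (intro borel_measurable_times gm measurable_unit_borel continuous_intros)
  have b: "norm (c n * (g t * of_real t ^ n)) \<le> norm (c n) * norm (g t)" if "t \<in> {0<..<1}" for n t
    using that by (auto simp: norm_mult norm_power intro!: mult_left_mono mult_left_le power_le_one)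
  have i: "integrable unit_borel (\<lambda>t. c n * (g t * of_real t ^ n))" for n
    using b g by (intro Bochner_Integration.integrable_bound[OF _ m, of "\<lambda>t. norm (c n) * norm (g t)"]) (auto intro!: AE_I2)
  have "(\<lambda>n. integral\<^sup>L unit_borel (\<lambda>t. c n * (g t * of_real t ^ n))) sums
        integral\<^sup>L unit_borel (\<lambda>t. \<Sum>n. c n * (g t * of_real t ^ n))"
  proof (rule sums_integral[OF i])
    show "AE t in unit_borel. summable (\<lambda>n. norm (c n * (g t * of_real t ^ n)))"
    proof (rule AE_I2)
      fix t assume "t \<in> space unit_borel"
      then show "summable (\<lambda>n. norm (c n * (g t * of_real t ^ n)))"
        using b by (intro summable_comparison_test'[OF summable_mult2[OF c, of "norm (g t)"]]) auto
    qed
    show "summable (\<lambda>n. \<integral>t. norm (c n * (g t * of_real t ^ n)) \<partial>unit_borel)"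
    proof (rule summable_comparison_test'[OF summable_mult2[OF c]])
      fix n
      have "(\<integral>t. norm (c n * (g t * of_real t ^ n)) \<partial>unit_borel) \<le> (\<integral>t. norm (c n) * norm (g t) \<partial>unit_borel)"
        using b g i by (intro integral_mono_AE AE_I2) auto
      then show "norm (\<integral>t. norm (c n * (g t * of_real t ^ n)) \<partial>unit_borel) \<le> norm (c n) * (\<integral>t. norm (g t) \<partial>unit_borel)"
        by (simp add: integral_nonneg_AE)
    qed
  qed
  moreover have "(\<integral>t. (\<Sum>n. c n * (g t * of_real t ^ n)) \<partial>unit_borel) = (\<integral>t. g t * (\<Sum>n. c n * of_real t ^ n) \<partial>unit_borel)"
  proof (rule Bochner_Integration.integral_cong[OF refl])
    fix t assume t: "t \<in> space unit_borel"
    have "norm (c n * of_real t ^ n) \<le> norm (c n)" for n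
      using t by (auto simp: norm_mult norm_power intro!: mult_left_le power_le_one)
    then have "summable (\<lambda>n. c n * of_real t ^ n)"
      by (intro summable_comparison_test'[OF c]) auto
    then show "(\<Sum>n. c n * (g t * of_real t ^ n)) = g t * (\<Sum>n. c n * of_real t ^ n)"
      by (subst suminf_mult[symmetric]) (auto simp: mult_ac)
  qed
  ultimately show ?thesis by simp
qed

lemma Re_pos_not_nonpos_Int: "Re z > 0 \<Longrightarrow> z \<notin> \<int>\<^sub>\<le>\<^sub>0"
  by (metis nonpos_Ints_Int not_le of_int_le_0_iff Re_complex_of_real nonpos_Ints_cases of_real_of_int_eq)

lemma beta_weight_power:
  assumes "t \<in> {0<..<1}"
  shows "beta_weight a b t * of_real t ^ n = beta_weight (a + of_nat n) b t"
proof -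
  have "complex_of_real t powr (a + of_nat n - 1) = of_real t powr (a - 1) * of_real t powr of_nat n"
    by (subst powr_add[symmetric]) (simp add: algebra_simps)
  also have "complex_of_real t powr of_nat n = of_real t ^ n"
    using assms by (intro powr_nat') auto
  finally show ?thesis by (simp add: beta_weight_def)
qed

lemma integral_beta_weight_power:
  assumes "Re a > 0" "Re b > 0"
  shows "integral\<^sup>L unit_borel (\<lambda>t. beta_weight a b t * of_real t ^ n) = Beta (a + of_nat n) b"
proof -
  have "integral\<^sup>L unit_borel (\<lambda>t. beta_weight a b t * of_real t ^ n) = integral\<^sup>L unit_borel (beta_weight (a + of_nat n) b)"
    by (intro Bochner_Integration.integral_cong refl) (simp add: beta_weight_power)
  also have "\<dots> = Beta (a + of_nat n) b"
    using assms by (intro integral_beta_weight) (auto simp: add_pos_nonneg)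
  finally show ?thesis .
qed

lemma continuous_on_powr_slit:
  fixes f g :: "'a :: topological_space \<Rightarrow> complex"
  assumes "continuous_on S f" "continuous_on S g" "\<And>z. z \<in> S \<Longrightarrow> f z \<notin> \<real>\<^sub>\<le>\<^sub>0"
  shows "continuous_on S (\<lambda>z. f z powr g z)"
proof -
  have "continuous_on S (\<lambda>z. exp (g z * Ln (f z)))"
    using assms by (intro continuous_intros) auto
  then show ?thesis
    by (rule continuous_on_eq) (use assms in \<open>force simp: powr_def\<close>)
qed

text \<open>The singularities at the end points sit in a weight that does not depend on
  \<open>z\<close>. The other factor is continuous up to the end points, hence bounded on
  \<open>cball z e \<times> {0..1}\<close>, and a multiple of the weight is a majorant.\<close>

lemma beta_weight_parametric_derivative:
  fixes h h' :: "complex \<Rightarrow> real \<Rightarrow> complex"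
  assumes ab: "Re a > 0" "Re b > 0" and S: "open S"
    and cont: "continuous_on (S \<times> {0..1}) (\<lambda>(z, t). h z t)"
    and der: "\<And>z t. z \<in> S \<Longrightarrow> t \<in> {0<..<1} \<Longrightarrow> ((\<lambda>z. h z t) has_field_derivative h' z t) (at z)"
    and z: "z \<in> S"
  shows "((\<lambda>z. integral\<^sup>L unit_borel (\<lambda>t. beta_weight a b t * h z t)) has_field_derivative
           integral\<^sup>L unit_borel (\<lambda>t. beta_weight a b t * h' z t)) (at z)"
proof -
  have deriv: "((\<lambda>z. beta_weight a b t * h z t) has_field_derivative beta_weight a b t * h' z t) (at z)"
    if "z \<in> S" "t \<in> space unit_borel" for z t
    using der[OF that(1), of t] that(2) by (auto intro!: DERIV_cmult)
  have "((\<lambda>z. integral\<^sup>L unit_borel (\<lambda>t. beta_weight a b t * h z t)) has_field_derivative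
      integral\<^sup>L unit_borel (\<lambda>t. deriv (\<lambda>z. beta_weight a b t * h z t) z)) (at z)"
  proof (rule has_field_derivative_parametric_integral[OF S _ _ _ z])
    show "(\<lambda>z. beta_weight a b t * h z t) holomorphic_on S" if "t \<in> space unit_borel" for t
      using deriv that by (auto simp: holomorphic_on_open[OF S])
    fix z assume z: "z \<in> S"
    have "continuous_on {0<..<1} (h z)"
      by (rule continuous_on_subset[OF continuous_on_compose2[OF cont continuous_on_Pair[OF continuous_on_const continuous_on_id], unfolded prod.case]])
         (use z in auto)
    then show "(\<lambda>t. beta_weight a b t * h z t) \<in> borel_measurable unit_borel"
      by (intro measurable_unit_borel continuous_on_mult continuous_on_beta_weight)
    obtain e where e: "e > 0" "cball z e \<subseteq> S"
      using open_contains_cball[of S] S z by blast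
    have "compact (cball z e \<times> {0..1::real})" by (intro compact_Times) auto
    then have "bounded ((\<lambda>(z, t). h z t) ` (cball z e \<times> {0..1}))"
      by (intro compact_imp_bounded compact_continuous_image continuous_on_subset[OF cont]) (use e in auto)
    then obtain B where B: "\<And>z' t. z' \<in> cball z e \<Longrightarrow> t \<in> {0..1} \<Longrightarrow> norm (h z' t) \<le> B"
      unfolding bounded_iff by fast
    show "\<exists>e>0. \<exists>g. integrable unit_borel g \<and> cball z e \<subseteq> S \<and>
            (\<forall>z'\<in>cball z e. \<forall>t\<in>space unit_borel. norm (beta_weight a b t * h z' t) \<le> g t)"
    proof (intro exI conjI ballI)
      show "integrable unit_borel (\<lambda>t. norm (beta_weight a b t) * B)"
        using ab by (intro integrable_mult_left integrable_norm integrable_beta_weight)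
      show "norm (beta_weight a b t * h z' t) \<le> norm (beta_weight a b t) * B"
        if "z' \<in> cball z e" "t \<in> space unit_borel" for z' t
        using B[of z' t] that by (auto simp: norm_mult intro!: mult_left_mono)
    qed (use e in auto)
  qed
  also have "integral\<^sup>L unit_borel (\<lambda>t. deriv (\<lambda>z. beta_weight a b t * h z t) z) =
      integral\<^sup>L unit_borel (\<lambda>t. beta_weight a b t * h' z t)"
    by (intro Bochner_Integration.integral_cong refl DERIV_imp_deriv deriv z)
  finally show ?thesis .
qed

section \<open>Continuation of the regularized Gauss series to the cut plane\<close>

abbreviation cut_plane :: "complex set" where
  "cut_plane \<equiv> - (of_real ` {1..})"

lemma of_real_image_atLeast_1_iff: "z \<in> complex_of_real ` {1..} \<longleftrightarrow> 1 - z \<in> \<real>\<^sub>\<le>\<^sub>0"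
proof
  assume "1 - z \<in> \<real>\<^sub>\<le>\<^sub>0"
  then have "z = of_real (Re z)" "Re z \<in> {1..}" by (auto simp: complex_nonpos_Reals_iff complex_eq_iff)
  then show "z \<in> complex_of_real ` {1..}" by (rule image_eqI)
qed (auto simp add: complex_nonpos_Reals_iff)

lemma open_cut_plane [simp]: "open cut_plane"
proof -
  have "cut_plane = (\<lambda>z. 1 - z) -` (- \<real>\<^sub>\<le>\<^sub>0)"
    using of_real_image_atLeast_1_iff by blast
  then show ?thesis by (simp add: open_vimage continuous_intros)
qed

text \<open>The cut plane is star-shaped about \<open>0\<close>. This keeps
  \<open>1 - of_real t * z\<close> off the branch cut in Euler's integral and the scaled arguments
  of the Jacobi function inside their domain.\<close>

lemma cut_plane_mult:
  assumes "z \<in> cut_plane" "0 \<le> t" "t \<le> 1"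
  shows "of_real t * z \<in> cut_plane"
proof (cases "Im z = 0")
  case True
  then have "Re z < 1" using assms(1) by (simp add: of_real_image_atLeast_1_iff complex_nonpos_Reals_iff)
  then have "t * Re z < 1"
    using assms(2,3) by (cases "Re z \<le> 0") (auto intro: le_less_trans[of _ 0] mult_nonneg_nonpos le_less_trans[OF mult_left_le_one_le])
  then show ?thesis by (simp add: of_real_image_atLeast_1_iff complex_nonpos_Reals_iff)
next
  case False
  then show ?thesis
    by (cases "t = 0") (auto simp: of_real_image_atLeast_1_iff complex_nonpos_Reals_iff)
qed

lemma one_minus_mult_slit:
  "z \<in> cut_plane \<Longrightarrow> 0 \<le> t \<Longrightarrow> t \<le> 1 \<Longrightarrow> 1 - of_real t * z \<notin> \<real>\<^sub>\<le>\<^sub>0"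
  using cut_plane_mult[of z t] by (simp add: of_real_image_atLeast_1_iff)

lemma ball_subset_cut_plane: "ball 0 1 \<subseteq> cut_plane"
  by (auto simp: image_iff)

definition hyp2F1_coeff :: "complex \<Rightarrow> complex \<Rightarrow> complex \<Rightarrow> nat \<Rightarrow> complex" where
  "hyp2F1_coeff a b c n = pochhammer a n * pochhammer b n * rGamma (c + of_nat n) / fact n"

text \<open>The characterising property of \<open>hyp2F1_reg\<close>, freed from the choice
  operator. Using \<open>sums\<close> in place of a value of \<open>suminf\<close> makes convergence
  in the unit disc part of the notion.\<close>

definition continues_hyp2F1 :: "(complex \<Rightarrow> complex) \<Rightarrow> complex \<Rightarrow> complex \<Rightarrow> complex \<Rightarrow> bool" where
  "continues_hyp2F1 f a b c \<longleftrightarrow> f holomorphic_on cut_plane \<and>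
     (\<forall>z\<in>ball 0 1. (\<lambda>n. hyp2F1_coeff a b c n * z ^ n) sums f z)"

lemma continues_hyp2F1_commute: "continues_hyp2F1 f a b c \<longleftrightarrow> continues_hyp2F1 f b a c"
  by (simp add: continues_hyp2F1_def hyp2F1_coeff_def mult_ac)

text \<open>Euler's integral: the binomial series is integrated term by term, and the moment
  \<open>Beta (b + of_nat n) (c - b)\<close> supplies \<open>pochhammer b n\<close> and
  \<open>rGamma (c + of_nat n)\<close>. The prefactor cancels the two Gamma values that
  remain.\<close>

lemma euler_integral_continues_hyp2F1:
  assumes b: "Re b > 0" and cb: "Re (c - b) > 0"
  shows "continues_hyp2F1 (\<lambda>z. rGamma b * rGamma (c - b) *
     integral\<^sup>L unit_borel (\<lambda>t. beta_weight b (c - b) t * (1 - of_real t * z) powr (- a))) a b c"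
  unfolding continues_hyp2F1_def
proof (intro conjI ballI)
  define h where "h z t = (1 - of_real t * z) powr (- a)" for z t
  have "((\<lambda>z. integral\<^sup>L unit_borel (\<lambda>t. beta_weight b (c - b) t * h z t)) has_field_derivative
      integral\<^sup>L unit_borel (\<lambda>t. beta_weight b (c - b) t * (a * of_real t * (1 - of_real t * z) powr (- a - 1)))) (at z)"
    if z: "z \<in> cut_plane" for z
  proof (rule beta_weight_parametric_derivative[OF b cb open_cut_plane _ _ z])
    show "continuous_on (cut_plane \<times> {0..1}) (\<lambda>(z, t). h z t)"
      unfolding case_prod_unfold h_def
      by (intro continuous_on_powr_slit continuous_intros one_minus_mult_slit) auto
    show "((\<lambda>z. h z t) has_field_derivative a * of_real t * (1 - of_real t * z) powr (- a - 1)) (at z)"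
      if "z \<in> cut_plane" "t \<in> {0<..<1}" for z t
      unfolding h_def using one_minus_mult_slit[OF that(1), of t] that(2)
      by (auto intro!: derivative_eq_intros)
  qed
  then show "(\<lambda>z. rGamma b * rGamma (c - b) *
     integral\<^sup>L unit_borel (\<lambda>t. beta_weight b (c - b) t * (1 - of_real t * z) powr (- a))) holomorphic_on cut_plane"
    unfolding h_def by (intro holomorphic_on_mult holomorphic_on_const) (auto simp: holomorphic_on_open)
  fix z :: complex assume z: "z \<in> ball 0 1"
  define q where "q n = ((- a) gchoose n) * (- z) ^ n" for n
  have q: "q n = pochhammer a n / fact n * z ^ n" for n
  proof -
    have "q n = ((-1) ^ n * (- 1) ^ n) * (pochhammer a n / fact n * z ^ n)"
      by (simp add: q_def gbinomial_pochhammer power_minus[of z])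
    then show ?thesis by (simp flip: power_mult_distrib)
  qed
  have "summable (\<lambda>n. norm (q n))"
  proof -
    have "ereal (norm z) < conv_radius (\<lambda>n. (- a) gchoose n)"
      using z by (auto simp: conv_radius_gchoose)
    from abs_summable_in_conv_radius[OF this[folded norm_minus_cancel[of z]]]
    show ?thesis by (simp add: q_def)
  qed
  from integral_power_series_sums[OF integrable_beta_weight[OF b cb] this]
  have "(\<lambda>n. rGamma b * rGamma (c - b) * (q n * Beta (b + of_nat n) (c - b))) sums
        (rGamma b * rGamma (c - b) * integral\<^sup>L unit_borel (\<lambda>t. beta_weight b (c - b) t * (\<Sum>n. q n * of_real t ^ n)))"
    by (intro sums_mult) (simp add: integral_beta_weight_power[OF b cb])
  moreover have "rGamma b * rGamma (c - b) * (q n * Beta (b + of_nat n) (c - b)) = hyp2F1_coeff a b c n * z ^ n" for n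
  proof -
    have nz: "b \<notin> \<int>\<^sub>\<le>\<^sub>0" "c - b \<notin> \<int>\<^sub>\<le>\<^sub>0"
      using b cb by (simp_all only: Re_pos_not_nonpos_Int not_False_eq_True)
    then have G: "Gamma (b + of_nat n) = pochhammer b n * Gamma b" "rGamma b * Gamma b = 1"
       "rGamma (c - b) * Gamma (c - b) = 1"
      by (auto simp: pochhammer_Gamma rGamma_inverse_Gamma Gamma_eq_zero_iff)
    have "rGamma b * rGamma (c - b) * (q n * Beta (b + of_nat n) (c - b)) =
        (rGamma b * Gamma b) * (rGamma (c - b) * Gamma (c - b)) * (hyp2F1_coeff a b c n * z ^ n)"
      by (simp add: Beta_altdef q hyp2F1_coeff_def G(1) algebra_simps)
    then show ?thesis by (simp add: G)
  qed
  moreover have "integral\<^sup>L unit_borel (\<lambda>t. beta_weight b (c - b) t * (\<Sum>n. q n * of_real t ^ n)) =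
     integral\<^sup>L unit_borel (\<lambda>t. beta_weight b (c - b) t * (1 - of_real t * z) powr (- a))"
  proof (rule Bochner_Integration.integral_cong[OF refl])
    fix t assume "t \<in> space unit_borel"
    then have "norm (- (of_real t * z)) < 1" using z
      by (auto simp: norm_mult intro: le_less_trans[OF mult_left_le_one_le])
    from gen_binomial_complex[OF this, of "- a"]
    have "(\<lambda>n. q n * of_real t ^ n) sums (1 - of_real t * z) powr (- a)"
      by (simp add: q_def power_mult_distrib power_minus[of z] power_minus[of "_ * _"] mult_ac)
    then show "beta_weight b (c - b) t * (\<Sum>n. q n * of_real t ^ n) = beta_weight b (c - b) t * (1 - of_real t * z) powr (- a)"
      by (simp add: sums_iff)
  qed
  ultimately show "(\<lambda>n. hyp2F1_coeff a b c n * z ^ n) sums (rGamma b * rGamma (c - b) *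
     integral\<^sup>L unit_borel (\<lambda>t. beta_weight b (c - b) t * (1 - of_real t * z) powr (- a)))"
    by simp
qed

lemma has_fps_expansion_imp_sums:
  fixes f :: "complex \<Rightarrow> complex"
  assumes "f holomorphic_on ball 0 r" "f has_fps_expansion F" "z \<in> ball 0 r"
  shows "(\<lambda>n. fps_nth F n * z ^ n) sums f z"
  using holomorphic_power_series[OF assms(1,3)] by (simp add: fps_nth_fps_expansion[OF assms(2)])

lemma has_fps_expansion_0_ball:
  fixes f :: "complex \<Rightarrow> complex"
  assumes "f holomorphic_on ball 0 r" "f has_fps_expansion 0" "z \<in> ball 0 r"
  shows "f z = 0"
  using has_fps_expansion_imp_sums[OF assms] by (simp add: sums_iff)

lemma continues_hyp2F1_fps:
  assumes "continues_hyp2F1 f a b c"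
  shows "f has_fps_expansion Abs_fps (hyp2F1_coeff a b c)"
proof (rule has_fps_expansionI)
  have "eventually (\<lambda>z. z \<in> ball 0 (1::real)) (nhds (0::complex))"
    by (rule eventually_nhds_in_open) auto
  then show "\<forall>\<^sub>F z in nhds 0. (\<lambda>n. fps_nth (Abs_fps (hyp2F1_coeff a b c)) n * z ^ n) sums f z"
    by eventually_elim (use assms in \<open>auto simp: continues_hyp2F1_def\<close>)
qed

text \<open>On coefficients the operator multiplies by \<open>c + of_nat n\<close>, and the
  functional equation of \<open>rGamma\<close> absorbs this factor. No division by \<open>c\<close>
  occurs, so poles of \<open>Gamma\<close> cause no exception.\<close>

lemma continues_hyp2F1_lower:
  assumes "continues_hyp2F1 f a b (c + 1)"
  shows "continues_hyp2F1 (\<lambda>z. z * deriv f z + c * f z) a b c"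
  unfolding continues_hyp2F1_def
proof (intro conjI ballI)
  have f: "f holomorphic_on cut_plane" using assms by (simp add: continues_hyp2F1_def)
  then show hol: "(\<lambda>z. z * deriv f z + c * f z) holomorphic_on cut_plane"
    by (intro holomorphic_intros) auto
  have exp: "(\<lambda>z. z * deriv f z + c * f z) has_fps_expansion
      fps_X * fps_deriv (Abs_fps (hyp2F1_coeff a b (c + 1))) + fps_const c * Abs_fps (hyp2F1_coeff a b (c + 1))"
    by (intro fps_expansion_intros continues_hyp2F1_fps assms)
  have "fps_X * fps_deriv (Abs_fps (hyp2F1_coeff a b (c + 1))) + fps_const c * Abs_fps (hyp2F1_coeff a b (c + 1))
        = Abs_fps (hyp2F1_coeff a b c)"
  proof (rule fps_ext)
    fix n
    have "hyp2F1_coeff a b c n = (c + of_nat n) * hyp2F1_coeff a b (c + 1) n"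
      using rGamma_plus1[of "c + of_nat n"] by (simp add: hyp2F1_coeff_def add_ac)
    then show "fps_nth (fps_X * fps_deriv (Abs_fps (hyp2F1_coeff a b (c + 1))) + fps_const c * Abs_fps (hyp2F1_coeff a b (c + 1))) n
       = fps_nth (Abs_fps (hyp2F1_coeff a b c)) n"
      by (cases n) (simp_all add: algebra_simps)
  qed
  with exp have exp': "(\<lambda>z. z * deriv f z + c * f z) has_fps_expansion Abs_fps (hyp2F1_coeff a b c)"
    by simp
  show "(\<lambda>n. hyp2F1_coeff a b c n * z ^ n) sums (z * deriv f z + c * f z)" if "z \<in> ball 0 1" for z
    using has_fps_expansion_imp_sums[OF holomorphic_on_subset[OF hol ball_subset_cut_plane] exp' that] by simp
qed

text \<open>Euler's integral applies once \<open>c\<close> has been shifted far to the right; lowering \<open>c\<close> again is a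
  first-order differential operator.\<close>
lemma continues_hyp2F1_exists:
  assumes "Re a > 0 \<or> Re b > 0"
  shows "\<exists>f. continues_hyp2F1 f a b c"
proof -
  have ex: "\<exists>f. continues_hyp2F1 f a b c" if b: "Re b > 0" for a b
  proof -
    obtain N :: nat where N: "Re b - Re c < N" using reals_Archimedean2 by blast
    have "\<exists>f. continues_hyp2F1 f a b (c + of_nat (N - k))" if "k \<le> N" for k
      using that
    proof (induction k)
      case 0
      have "Re (c + of_nat N - b) > 0" using N by simp
      from euler_integral_continues_hyp2F1[OF b this] show ?case by auto
    next
      case (Suc k)
      then obtain f where "continues_hyp2F1 f a b (c + of_nat (N - k))" by auto
      moreover have "N - k = Suc (N - Suc k)" using Suc.prems by simp
      ultimately have "continues_hyp2F1 f a b (c + of_nat (N - Suc k) + 1)" by (simp add: add_ac)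
      then show ?case using continues_hyp2F1_lower by blast
    qed
    from this[of N] show ?thesis by simp
  qed
  from assms show ?thesis
    using ex[of a b] ex[of b a] continues_hyp2F1_commute by blast
qed

text \<open>A continuation must exist before anything can be said about the function picked by
  \<open>SOME\<close>. The witness also provides the convergence that equality with
  \<open>hyp2F1_reg_series\<close> does not express.\<close>

lemma hyp2F1_reg_continues:
  assumes "Re a > 0 \<or> Re b > 0"
  shows "continues_hyp2F1 (hyp2F1_reg a b c) a b c"
proof -
  obtain f where f: "continues_hyp2F1 f a b c" using continues_hyp2F1_exists[OF assms] by blast
  then have "f holomorphic_on cut_plane \<and> (\<forall>z\<in>ball 0 1. f z = hyp2F1_reg_series a b c z)"
    by (auto simp: continues_hyp2F1_def hyp2F1_reg_series_def hyp2F1_coeff_def sums_iff)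
  then have "hyp2F1_reg a b c holomorphic_on cut_plane \<and>
     (\<forall>z\<in>ball 0 1. hyp2F1_reg a b c z = hyp2F1_reg_series a b c z)"
    unfolding hyp2F1_reg_def
    by (rule someI[where P = "\<lambda>f. f holomorphic_on cut_plane \<and> (\<forall>z\<in>ball 0 1. f z = hyp2F1_reg_series a b c z)"])
  moreover have "f z = hyp2F1_reg_series a b c z" if "z \<in> ball 0 1" for z
    using f that by (auto simp: continues_hyp2F1_def hyp2F1_reg_series_def hyp2F1_coeff_def sums_iff)
  ultimately show ?thesis using f by (auto simp: continues_hyp2F1_def)
qed

section \<open>The hypergeometric equation and Euler's transformation\<close>

lemma continues_hyp2F1_ode:
  assumes f: "continues_hyp2F1 f a b c" and z: "z \<in> ball 0 1"
  shows "z * (1 - z) * deriv (deriv f) z + (c - (a + b + 1) * z) * deriv f z - a * b * f z = 0"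
proof (rule has_fps_expansion_0_ball[where f = "\<lambda>z. z * (1 - z) * deriv (deriv f) z + (c - (a + b + 1) * z) * deriv f z - a * b * f z"])
  have "f holomorphic_on ball 0 1"
    using f ball_subset_cut_plane by (auto simp: continues_hyp2F1_def intro: holomorphic_on_subset)
  then show "(\<lambda>z. z * (1 - z) * deriv (deriv f) z + (c - (a + b + 1) * z) * deriv f z - a * b * f z) holomorphic_on ball 0 1"
    by (intro holomorphic_intros) auto
  define F where "F = Abs_fps (hyp2F1_coeff a b c)"
  have F: "f has_fps_expansion F" using continues_hyp2F1_fps[OF f] by (simp add: F_def)
  have exp: "(\<lambda>z. z * (1 - z) * deriv (deriv f) z + (c - (a + b + 1) * z) * deriv f z - a * b * f z) has_fps_expansion
     fps_X * (1 - fps_X) * fps_deriv (fps_deriv F) + (fps_const c - fps_const (a + b + 1) * fps_X) * fps_deriv F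
       - fps_const (a * b) * F"
    by (intro fps_expansion_intros F)
  \<comment> \<open>This two-term recurrence is the differential equation read off coefficientwise;
    \<open>rGamma\<close> satisfies it for every \<open>c\<close>.\<close>
  have step: "of_nat (Suc n) * (c + of_nat n) * fps_nth F (Suc n) = (a + of_nat n) * (b + of_nat n) * fps_nth F n" for n
  proof -
    have "rGamma (c + of_nat n) = (c + of_nat n) * rGamma (c + of_nat n + 1)"
      by (simp add: rGamma_plus1)
    then show ?thesis
      by (simp add: F_def hyp2F1_coeff_def pochhammer_Suc add_ac divide_simps del: of_nat_Suc) (simp add: algebra_simps)
  qed
  have "fps_X * (1 - fps_X) * fps_deriv (fps_deriv F) + (fps_const c - fps_const (a + b + 1) * fps_X) * fps_deriv F
       - fps_const (a * b) * F = 0"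
  proof (rule fps_ext)
    fix n
    have "fps_X * (1 - fps_X) * fps_deriv (fps_deriv F) + (fps_const c - fps_const (a + b + 1) * fps_X) * fps_deriv F
       - fps_const (a * b) * F = fps_X * fps_deriv (fps_deriv F) - fps_X * (fps_X * fps_deriv (fps_deriv F)) +
          fps_const c * fps_deriv F - fps_const (a + b + 1) * (fps_X * fps_deriv F) - fps_const (a * b) * F"
      by (simp add: algebra_simps)
    also have "fps_nth \<dots> n = of_nat (Suc n) * (c + of_nat n) * fps_nth F (Suc n) - (a + of_nat n) * (b + of_nat n) * fps_nth F n"
    proof (cases n)
      case (Suc m)
      then show ?thesis by (cases m) (simp_all add: algebra_simps)
    qed simp
    also have "\<dots> = fps_nth 0 n" using step by simp
    finally show "fps_nth (fps_X * (1 - fps_X) * fps_deriv (fps_deriv F) + (fps_const c - fps_const (a + b + 1) * fps_X) * fps_deriv F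
       - fps_const (a * b) * F) n = fps_nth 0 n" .
  qed
  with exp show "(\<lambda>z. z * (1 - z) * deriv (deriv f) z + (c - (a + b + 1) * z) * deriv f z - a * b * f z) has_fps_expansion 0"
    by simp
qed (rule z)

lemma continues_hyp2F1_at_0: "continues_hyp2F1 f a b c \<Longrightarrow> f 0 = rGamma c"
  using fps_nth_fps_expansion[OF continues_hyp2F1_fps, of f a b c 0] by (simp add: hyp2F1_coeff_def)

text \<open>Both sides solve the same equation and equal \<open>rGamma c\<close> at
  \<open>0\<close>. The relevant indicial factor is \<open>k - 1 + c\<close>, which does not vanish
  for \<open>k > 0\<close> since \<open>Re c > 0\<close>; hence the difference is zero.\<close>

lemma euler_transformation:
  assumes f: "continues_hyp2F1 f a b c" and g: "continues_hyp2F1 g (c - a) (c - b) c"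
    and c: "Re c > 0" and z: "z \<in> ball 0 1"
  shows "f z = (1 - z) powr (c - a - b) * g z"
proof -
  define s where "s = c - a - b"
  have fh: "f holomorphic_on ball 0 1" and gh: "g holomorphic_on ball 0 1"
    using f g ball_subset_cut_plane by (auto simp: continues_hyp2F1_def intro: holomorphic_on_subset)
  have d: "(h has_field_derivative deriv h w) (at w)" "(deriv h has_field_derivative deriv (deriv h) w) (at w)"
    if "h holomorphic_on ball 0 1" "w \<in> ball 0 1" for h w
    using that by (auto intro!: holomorphic_derivI[of _ "ball 0 1"] holomorphic_deriv)
  have slit: "1 - w \<notin> \<real>\<^sub>\<le>\<^sub>0" "1 - w \<noteq> 0" if "w \<in> ball 0 1" for w :: complex
    using one_minus_mult_slit[of w 1] ball_subset_cut_plane that by auto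
  define p where "p w = (1 - w) powr s" for w :: complex
  have pd: "(p has_field_derivative - s * p w / (1 - w)) (at w)" if "w \<in> ball 0 1" for w
    unfolding p_def using slit[OF that]
    by (auto intro!: derivative_eq_intros simp: powr_diff)
  define h where "h w = f w - p w * g w" for w
  have h1: "deriv h w = deriv f w - p w * (deriv g w - s * g w / (1 - w))" if "w \<in> ball 0 1" for w
    unfolding h_def
    by (rule DERIV_imp_deriv) (rule derivative_eq_intros pd[OF that] d[OF fh that] d[OF gh that] refl | simp add: algebra_simps)+
  have h2: "deriv (deriv h) w = deriv (deriv f) w - p w * (deriv (deriv g) w - 2 * s * deriv g w / (1 - w)
         + s * (s - 1) * g w / (1 - w)\<^sup>2)" if w: "w \<in> ball 0 1" for w
  proof (rule DERIV_imp_deriv, rule has_field_derivative_transform_within_open[where S = "ball 0 1"])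
    show "((\<lambda>w. deriv f w - p w * (deriv g w - s * g w / (1 - w))) has_field_derivative
       deriv (deriv f) w - p w * (deriv (deriv g) w - 2 * s * deriv g w / (1 - w)
         + s * (s - 1) * g w / (1 - w)\<^sup>2)) (at w)"
      by (rule DERIV_cong, (rule derivative_intros pd[OF w] d(2)[OF fh w] d[OF gh w] slit(2)[OF w])+)
         (use slit(2)[OF w] in \<open>simp add: divide_simps power2_eq_square, simp add: algebra_simps\<close>)
  qed (use w h1 in auto)
  have "h z = 0"
  proof (rule holomorphic_ode_unique[where f = h and S = "ball 0 1" and Z = "\<lambda>z. z * (1 - z)" and Z' = 1
        and P = "\<lambda>z. c - (a + b + 1) * z" and Q = "\<lambda>_. - (a * b)"])
    show "h holomorphic_on ball 0 1"
      unfolding h_def p_def using slit by (intro holomorphic_intros fh gh) auto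
    show "h 0 = 0"
      using continues_hyp2F1_at_0[OF f] continues_hyp2F1_at_0[OF g] by (simp add: h_def p_def)
    show "((\<lambda>z. z * (1 - z)) has_field_derivative 1) (at 0)"
      by (auto intro!: derivative_eq_intros)
    show "1 * of_nat (k - 1) + (c - (a + b + 1) * 0) \<noteq> 0" if "k > 0" for k
      using c by (auto simp: complex_eq_iff)
    fix w :: complex assume w: "w \<in> ball 0 1"
    have F: "w * (1 - w) * deriv (deriv f) w + (c - (a + b + 1) * w) * deriv f w - a * b * f w = 0"
      by (rule continues_hyp2F1_ode[OF f w])
    have G: "w * (1 - w) * deriv (deriv g) w + (c - ((c - a) + (c - b) + 1) * w) * deriv g w - (c - a) * (c - b) * g w = 0"
      by (rule continues_hyp2F1_ode[OF g w])
    define v where "v = 1 - w"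
    have v: "v \<noteq> 0" "w = 1 - v" using slit[OF w] by (auto simp: v_def)
    \<comment> \<open>Conjugation by the power \<open>p\<close> carries the operator with parameters
      \<open>a\<close>, \<open>b\<close> into the one with parameters \<open>c - a\<close>,
      \<open>c - b\<close>. Writing \<open>w = 1 - v\<close> leaves powers of \<open>v\<close> as
      the only denominators.\<close>
    have "w * (1 - w) * deriv (deriv h) w + (c - (a + b + 1) * w) * deriv h w + - (a * b) * h w =
        (w * (1 - w) * deriv (deriv f) w + (c - (a + b + 1) * w) * deriv f w - a * b * f w) -
        p w * (w * (1 - w) * deriv (deriv g) w + (c - ((c - a) + (c - b) + 1) * w) * deriv g w - (c - a) * (c - b) * g w)"
      unfolding h1[OF w] h2[OF w] h_def s_def using v(1)
      unfolding v(2) by (simp add: divide_simps power2_eq_square) (simp add: algebra_simps)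
    then show "w * (1 - w) * deriv (deriv h) w + (c - (a + b + 1) * w) * deriv h w + - (a * b) * h w = 0"
      by (simp only: F G) simp
  qed (use z in \<open>auto intro!: continuous_intros\<close>)
  then show ?thesis by (simp add: h_def p_def s_def)
qed

lemma integrable_beta_weight_continuous:
  fixes h :: "real \<Rightarrow> complex"
  assumes "Re a > 0" "Re b > 0" and h: "continuous_on {0..1} h"
  shows "integrable unit_borel (\<lambda>t. beta_weight a b t * h t)"
proof -
  have "bounded (h ` {0..1})"
    by (intro compact_imp_bounded compact_continuous_image h) auto
  then obtain B where "\<And>t. t \<in> {0..1} \<Longrightarrow> norm (h t) \<le> B"
    unfolding bounded_iff by fast
  moreover have "h \<in> borel_measurable unit_borel"
    by (intro measurable_unit_borel continuous_on_subset[OF h]) auto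
  ultimately show ?thesis using assms by (intro integrable_beta_weight_mult[where B = B]) auto
qed

text \<open>One-sided limits of \<open>F\<close> replace values at the end points, since derivatives
  such as that of \<open>t powr \<beta>\<close> are integrable but possibly unbounded there.\<close>

lemma integral_unit_borel_FTC:
  fixes f F :: "real \<Rightarrow> complex"
  assumes F: "\<And>t. t \<in> {0<..<1} \<Longrightarrow> (F has_vector_derivative f t) (at t)"
    and f: "continuous_on {0<..<1} f" "integrable unit_borel f"
    and lim: "(F \<longlongrightarrow> A) (at_right 0)" "(F \<longlongrightarrow> B) (at_left 1)"
  shows "integral\<^sup>L unit_borel f = B - A"
proof -
  have "(LBINT x=ereal 0..ereal 1. f x) = B - A"
  proof (rule interval_integral_FTC_integrable[where F = F])
    show "isCont f x" if "ereal 0 < ereal x" "ereal x < ereal 1" for x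
      using that f(1) by (auto simp: continuous_on_eq_continuous_at)
    show "set_integrable lborel (einterval (ereal 0) (ereal 1)) f"
      using f(2) by (simp add: integrable_restrict_space set_integrable_def)
    show "((F \<circ> real_of_ereal) \<longlongrightarrow> A) (at_right (ereal 0))" "((F \<circ> real_of_ereal) \<longlongrightarrow> B) (at_left (ereal 1))"
      using lim by (simp_all only: ereal_tendsto_simps1)
  qed (use F in auto)
  then show ?thesis
    by (simp add: interval_lebesgue_integral_def set_lebesgue_integral_def integral_restrict_space)
qed

section \<open>Laplace's integral for the Gegenbauer function\<close>

text \<open>The image of the right half-plane under \<open>- Ln\<close>. Both
  \<open>exp \<theta>\<close> and \<open>exp (- \<theta>)\<close> then have positive real part, so
  all powers taken below are principal.\<close>

definition strip :: "complex set" where "strip = {\<theta>. \<bar>Im \<theta>\<bar> < pi / 2}"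

lemma open_strip: "open strip"
  unfolding strip_def by (intro open_Collect_less continuous_intros)

lemma convex_strip: "convex strip"
proof -
  have "strip = {\<theta>. Im \<theta> > - (pi / 2)} \<inter> {\<theta>. Im \<theta> < pi / 2}" by (auto simp: strip_def)
  then show ?thesis by (metis convex_Int convex_halfspace_Im_gt convex_halfspace_Im_lt)
qed

text \<open>Laplace's \<open>cosh \<theta> + sinh \<theta> * cos \<phi>\<close> with
  \<open>cos \<phi> = 1 - 2 * t\<close>; the weight \<open>beta_weight \<beta> \<beta>\<close>
  corresponds, up to a constant, to the power \<open>2 * \<beta> - 1\<close> of
  \<open>sin \<phi>\<close>.\<close>

definition laplace_base :: "complex \<Rightarrow> real \<Rightarrow> complex" where
  "laplace_base \<theta> t = exp \<theta> * (1 - of_real t) + exp (- \<theta>) * of_real t"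

definition laplace_integral :: "complex \<Rightarrow> complex \<Rightarrow> complex \<Rightarrow> complex" where
  "laplace_integral \<nu> \<beta> \<theta> = integral\<^sup>L unit_borel (\<lambda>t. beta_weight \<beta> \<beta> t * laplace_base \<theta> t powr \<nu>)"

lemma Re_exp_pos: "\<theta> \<in> strip \<Longrightarrow> Re (exp \<theta>) > 0"
  by (auto simp: strip_def Re_exp intro!: mult_pos_pos cos_gt_zero_pi)

lemma Re_laplace_base_pos:
  assumes "\<theta> \<in> strip" "t \<in> {0..1}"
  shows "Re (laplace_base \<theta> t) > 0"
proof -
  have "- \<theta> \<in> strip" using assms(1) by (simp add: strip_def)
  with assms have "Re (exp \<theta>) > 0" "Re (exp (- \<theta>)) > 0" using Re_exp_pos by blast+
  moreover have "Re (laplace_base \<theta> t) = Re (exp \<theta>) * (1 - t) + Re (exp (- \<theta>)) * t"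
    by (simp add: laplace_base_def)
  ultimately show ?thesis using assms(2)
    by (cases "t = 0") (auto intro!: add_nonneg_pos)
qed

lemma laplace_base_slit:
  assumes "\<theta> \<in> strip" "t \<in> {0..1}"
  shows "laplace_base \<theta> t \<notin> \<real>\<^sub>\<le>\<^sub>0" "laplace_base \<theta> t \<noteq> 0"
  using Re_laplace_base_pos[OF assms] by (auto simp: complex_nonpos_Reals_iff)

lemma continuous_on_laplace_base:
  "continuous_on (strip \<times> {0..1}) (\<lambda>(\<theta>, t). laplace_base \<theta> t powr p)"
  unfolding case_prod_unfold
  by (intro continuous_on_powr_slit continuous_on_const laplace_base_slit)
     (auto simp: laplace_base_def intro!: continuous_intros)

lemma laplace_base_has_derivative:
  assumes "\<theta> \<in> strip" "t \<in> {0..1}"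
  shows "((\<lambda>\<theta>. laplace_base \<theta> t powr p) has_field_derivative
           p * laplace_base \<theta> t powr (p - 1) * (exp \<theta> * (1 - of_real t) - exp (- \<theta>) * of_real t)) (at \<theta>)"
proof -
  have "((\<lambda>\<theta>. laplace_base \<theta> t) has_field_derivative (exp \<theta> * (1 - of_real t) - exp (- \<theta>) * of_real t)) (at \<theta>)"
    unfolding laplace_base_def by (auto intro!: derivative_eq_intros)
  then show ?thesis
    using laplace_base_slit[OF assms] by (auto intro!: derivative_eq_intros)
qed

definition laplace_integral' :: "complex \<Rightarrow> complex \<Rightarrow> complex \<Rightarrow> complex" where
  "laplace_integral' \<nu> \<beta> \<theta> = integral\<^sup>L unit_borel (\<lambda>t. beta_weight \<beta> \<beta> t *
     (\<nu> * laplace_base \<theta> t powr (\<nu> - 1) * (exp \<theta> * (1 - of_real t) - exp (- \<theta>) * of_real t)))"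

text \<open>The last summand arises because the derivative of \<open>exp \<theta> * (1 - of_real t)
  - exp (- \<theta>) * of_real t\<close> in \<open>\<theta>\<close> is
  \<open>laplace_base \<theta> t\<close> again.\<close>

definition laplace_integral'' :: "complex \<Rightarrow> complex \<Rightarrow> complex \<Rightarrow> complex" where
  "laplace_integral'' \<nu> \<beta> \<theta> = integral\<^sup>L unit_borel (\<lambda>t. beta_weight \<beta> \<beta> t *
     (\<nu> * ((\<nu> - 1) * laplace_base \<theta> t powr (\<nu> - 2) * (exp \<theta> * (1 - of_real t) - exp (- \<theta>) * of_real t)\<^sup>2
           + laplace_base \<theta> t powr (\<nu> - 1) * laplace_base \<theta> t)))"

context
  fixes \<beta> :: complex assumes \<beta>: "Re \<beta> > 0"
begin

lemma laplace_integral_deriv: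
  assumes "\<theta> \<in> strip"
  shows "(laplace_integral \<nu> \<beta> has_field_derivative laplace_integral' \<nu> \<beta> \<theta>) (at \<theta>)"
  unfolding laplace_integral_def laplace_integral'_def
  using \<beta> \<beta> open_strip continuous_on_laplace_base _ assms
  by (rule beta_weight_parametric_derivative) (auto intro!: laplace_base_has_derivative)

lemma laplace_integral_deriv2:
  assumes "\<theta> \<in> strip"
  shows "(laplace_integral' \<nu> \<beta> has_field_derivative laplace_integral'' \<nu> \<beta> \<theta>) (at \<theta>)"
  unfolding laplace_integral'_def laplace_integral''_def
  using \<beta> \<beta> open_strip _ _ assms
proof (rule beta_weight_parametric_derivative)
  show "continuous_on (strip \<times> {0..1}) (\<lambda>(\<theta>, t). \<nu> * laplace_base \<theta> t powr (\<nu> - 1) * (exp \<theta> * (1 - of_real t) - exp (- \<theta>) * of_real t))"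
    using continuous_on_laplace_base[unfolded case_prod_unfold]
    unfolding case_prod_unfold by (intro continuous_on_mult continuous_on_diff) (auto intro!: continuous_intros)
  fix \<theta> t assume "\<theta> \<in> strip" "t \<in> {0<..<1::real}"
  then have "((\<lambda>\<theta>. laplace_base \<theta> t powr (\<nu> - 1)) has_field_derivative
      (\<nu> - 1) * laplace_base \<theta> t powr (\<nu> - 1 - 1) * (exp \<theta> * (1 - of_real t) - exp (- \<theta>) * of_real t)) (at \<theta>)"
    by (intro laplace_base_has_derivative) auto
  note d = this
  show "((\<lambda>\<theta>. \<nu> * laplace_base \<theta> t powr (\<nu> - 1) * (exp \<theta> * (1 - of_real t) - exp (- \<theta>) * of_real t)) has_field_derivative
     \<nu> * ((\<nu> - 1) * laplace_base \<theta> t powr (\<nu> - 2) * (exp \<theta> * (1 - of_real t) - exp (- \<theta>) * of_real t)\<^sup>2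
           + laplace_base \<theta> t powr (\<nu> - 1) * laplace_base \<theta> t)) (at \<theta>)"
    by (rule derivative_eq_intros d refl)+
       (simp add: laplace_base_def power2_eq_square algebra_simps)
qed

text \<open>In the coordinate \<open>\<theta>\<close> with \<open>G = cosh \<theta>\<close>, Gegenbauer's operator maps the integrand to \<open>2 * \<nu>\<close> times the
  \<open>t\<close>-derivative of \<open>(t * (1 - t)) powr \<beta> * laplace_base \<theta> t powr (\<nu> - 1)\<close>, which vanishes at both end points.\<close>
lemma laplace_integral_ode:
  assumes \<theta>: "\<theta> \<in> strip"
  shows "sinh \<theta> * laplace_integral'' \<nu> \<beta> \<theta> + 2 * \<beta> * cosh \<theta> * laplace_integral' \<nu> \<beta> \<theta>
           - \<nu> * (\<nu> + 2 * \<beta>) * sinh \<theta> * laplace_integral \<nu> \<beta> \<theta> = 0"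
proof -
  define E where "E = laplace_base \<theta>"
  define D where "D t = exp \<theta> * (1 - complex_of_real t) - exp (- \<theta>) * of_real t" for t
  have slit: "E t \<notin> \<real>\<^sub>\<le>\<^sub>0" "E t \<noteq> 0" if "t \<in> {0..1}" for t
    using laplace_base_slit[OF \<theta> that] by (auto simp: E_def)
  have contE: "continuous_on {0..1} (\<lambda>t. E t powr p)" for p
    by (intro continuous_on_powr_slit slit continuous_on_const) (auto simp: E_def laplace_base_def intro!: continuous_intros)
  have contE': "continuous_on {0..1} E"
    by (auto simp: E_def laplace_base_def intro!: continuous_intros)
  have contD: "continuous_on {0..1} D" unfolding D_def by (intro continuous_intros)
  define W where "W t = \<beta> * (1 - 2 * of_real t) * E t powr (\<nu> - 1)
      - 2 * (\<nu> - 1) * sinh \<theta> * (of_real t * (1 - of_real t)) * E t powr (\<nu> - 2)" for t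
  have contW: "continuous_on {0..1} W"
    unfolding W_def by (intro continuous_intros contE)
  have pointwise: "sinh \<theta> * (\<nu> * ((\<nu> - 1) * E t powr (\<nu> - 2) * (D t)\<^sup>2 + E t powr (\<nu> - 1) * E t))
      + 2 * \<beta> * cosh \<theta> * (\<nu> * E t powr (\<nu> - 1) * D t) - \<nu> * (\<nu> + 2 * \<beta>) * sinh \<theta> * E t powr \<nu> = 2 * \<nu> * W t"
    if "t \<in> {0..1}" for t
  proof -
    have p: "E t powr (\<nu> - 1) = E t powr (\<nu> - 2) * E t" "E t powr \<nu> = E t powr (\<nu> - 2) * (E t)\<^sup>2"
      using slit(2)[OF that] by (simp_all add: powr_diff divide_simps power2_eq_square flip: powr_nat')
    \<comment> \<open>\<open>E\<close> and \<open>D\<close> are the sum and the difference of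
      \<open>exp \<theta> * (1 - t)\<close> and \<open>exp (- \<theta>) * t\<close>, whose product
      is \<open>t * (1 - t)\<close>.\<close>
    have D2: "(D t)\<^sup>2 = (E t)\<^sup>2 - 4 * (of_real t * (1 - of_real t))"
    proof -
      have "exp \<theta> * exp (- \<theta>) = 1" by (simp add: exp_minus)
      then show ?thesis unfolding D_def E_def laplace_base_def by algebra
    qed
    \<comment> \<open>The right-hand side is the derivative of \<open>t * (1 - t)\<close>; this is
      how the terms carrying \<open>\<beta>\<close> become the derivative of the weight.\<close>
    have cs: "cosh \<theta> * D t - sinh \<theta> * E t = 1 - 2 * of_real t"
    proof -
      have "exp \<theta> * exp (- \<theta>) = 1" by (simp add: exp_minus)
      moreover have "2 * cosh \<theta> = exp \<theta> + exp (- \<theta>)" "2 * sinh \<theta> = exp \<theta> - exp (- \<theta>)"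
        by (simp_all add: cosh_field_def sinh_field_def)
      ultimately have "2 * (cosh \<theta> * D t - sinh \<theta> * E t) = 2 * (1 - 2 * of_real t)"
        unfolding D_def E_def laplace_base_def by algebra
      then show ?thesis by (metis mult_left_cancel zero_neq_numeral)
    qed
    show ?thesis
      unfolding W_def p using D2 cs by algebra
  qed
  define V where "V t = of_real t powr \<beta> * of_real (1 - t) powr \<beta> * E t powr (\<nu> - 1)" for t
  have "integral\<^sup>L unit_borel (\<lambda>t. beta_weight \<beta> \<beta> t * W t) = 0 - 0"
  proof (rule integral_unit_borel_FTC[where F = V])
    show "continuous_on {0<..<1} (\<lambda>t. beta_weight \<beta> \<beta> t * W t)"
      by (intro continuous_on_mult continuous_on_beta_weight continuous_on_subset[OF contW]) auto
    show "integrable unit_borel (\<lambda>t. beta_weight \<beta> \<beta> t * W t)"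
      by (intro integrable_beta_weight_continuous \<beta> contW)
    have lim0: "((\<lambda>t. complex_of_real t powr \<beta>) \<longlongrightarrow> 0) (at_right 0)"
      by (rule tendsto_powr_complex_0[OF _ tendsto_const \<beta>]) (auto intro!: tendsto_eq_intros)
    have lim1: "((\<lambda>t. complex_of_real (1 - t) powr \<beta>) \<longlongrightarrow> 0) (at_left 1)"
      by (rule tendsto_powr_complex_0[OF _ tendsto_const \<beta>]) (auto intro!: tendsto_eq_intros)
    have cE: "(\<lambda>t. E t powr (\<nu> - 1)) \<midarrow>x\<rightarrow> E x powr (\<nu> - 1)" if "x \<in> {0, 1}" for x
    proof -
      have "isCont E x" unfolding E_def laplace_base_def[abs_def] by (intro continuous_intros)
      moreover have "E x \<notin> \<real>\<^sub>\<le>\<^sub>0" using that by (intro slit) auto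
      ultimately show ?thesis by (intro tendsto_intros isContD) auto
    qed
    have "(V \<longlongrightarrow> 0 * of_real (1 - 0) powr \<beta> * E 0 powr (\<nu> - 1)) (at_right 0)"
      unfolding V_def
      by (intro tendsto_intros lim0 tendsto_mono[OF at_le cE]) auto
    then show "(V \<longlongrightarrow> 0) (at_right 0)" by simp
    have "(V \<longlongrightarrow> of_real 1 powr \<beta> * 0 * E 1 powr (\<nu> - 1)) (at_left 1)"
      unfolding V_def
      by (intro tendsto_intros lim1 tendsto_mono[OF at_le cE]) auto
    then show "(V \<longlongrightarrow> 0) (at_left 1)" by simp
    fix t :: real assume t: "t \<in> {0<..<1}"
    define z where "z = complex_of_real t"
    have z: "z \<notin> \<real>\<^sub>\<le>\<^sub>0" "1 - z \<notin> \<real>\<^sub>\<le>\<^sub>0" "z \<noteq> 0" "1 - z \<noteq> 0"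
      using t by (auto simp: z_def complex_nonpos_Reals_iff)
    \<comment> \<open>\<open>E\<close> is extended to complex \<open>z\<close>, so that the rules
      for complex powers apply; the result is then restricted to the real line.\<close>
    define e where "e z = exp \<theta> * (1 - z) + exp (- \<theta>) * z" for z
    have e: "e z \<notin> \<real>\<^sub>\<le>\<^sub>0" "e z = E t"
      using slit[of t] t by (auto simp: e_def E_def laplace_base_def z_def)
    have ed: "(e has_field_derivative - 2 * sinh \<theta>) (at z)"
      unfolding e_def by (auto intro!: derivative_eq_intros simp: sinh_field_def)
    have "((\<lambda>z. z powr \<beta> * (1 - z) powr \<beta> * e z powr (\<nu> - 1)) has_field_derivative
        (\<beta> * z powr (\<beta> - 1) * 1 * (1 - z) powr \<beta> + \<beta> * (1 - z) powr (\<beta> - 1) * (0 - 1) * z powr \<beta>) * e z powr (\<nu> - 1)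
        + (\<nu> - 1) * e z powr (\<nu> - 1 - 1) * (- 2 * sinh \<theta>) * (z powr \<beta> * (1 - z) powr \<beta>)) (at z)"
      by (rule derivative_eq_intros z e ed refl | simp)+
    also have "(\<beta> * z powr (\<beta> - 1) * 1 * (1 - z) powr \<beta> + \<beta> * (1 - z) powr (\<beta> - 1) * (0 - 1) * z powr \<beta>) * e z powr (\<nu> - 1)
        + (\<nu> - 1) * e z powr (\<nu> - 1 - 1) * (- 2 * sinh \<theta>) * (z powr \<beta> * (1 - z) powr \<beta>) = beta_weight \<beta> \<beta> t * W t"
    proof -
      have "z powr \<beta> = z powr (\<beta> - 1) * z" "(1 - z) powr \<beta> = (1 - z) powr (\<beta> - 1) * (1 - z)"
        using z by (simp_all add: powr_diff)
      moreover have "beta_weight \<beta> \<beta> t = z powr (\<beta> - 1) * (1 - z) powr (\<beta> - 1)"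
        by (simp add: beta_weight_def z_def)
      ultimately show ?thesis
        by (simp add: W_def e z_def[symmetric]) (simp add: algebra_simps)
    qed
    finally have "((\<lambda>z. z powr \<beta> * (1 - z) powr \<beta> * e z powr (\<nu> - 1)) has_field_derivative beta_weight \<beta> \<beta> t * W t) (at z)" .
    from has_vector_derivative_real_field[OF this[unfolded z_def], of UNIV]
    show "(V has_vector_derivative beta_weight \<beta> \<beta> t * W t) (at t)"
      by (simp add: V_def[abs_def] e_def E_def laplace_base_def)
  qed
  moreover have "sinh \<theta> * laplace_integral'' \<nu> \<beta> \<theta> + 2 * \<beta> * cosh \<theta> * laplace_integral' \<nu> \<beta> \<theta>
           - \<nu> * (\<nu> + 2 * \<beta>) * sinh \<theta> * laplace_integral \<nu> \<beta> \<theta> = 2 * \<nu> * integral\<^sup>L unit_borel (\<lambda>t. beta_weight \<beta> \<beta> t * W t)"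
  proof -
    have i: "integrable unit_borel (\<lambda>t. beta_weight \<beta> \<beta> t * (\<nu> * ((\<nu> - 1) * E t powr (\<nu> - 2) * (D t)\<^sup>2 + E t powr (\<nu> - 1) * E t)))"
      "integrable unit_borel (\<lambda>t. beta_weight \<beta> \<beta> t * (\<nu> * E t powr (\<nu> - 1) * D t))"
      "integrable unit_borel (\<lambda>t. beta_weight \<beta> \<beta> t * E t powr \<nu>)"
      by (intro integrable_beta_weight_continuous \<beta> continuous_intros contE contE' contD)+
    have "sinh \<theta> * laplace_integral'' \<nu> \<beta> \<theta> + 2 * \<beta> * cosh \<theta> * laplace_integral' \<nu> \<beta> \<theta>
           - \<nu> * (\<nu> + 2 * \<beta>) * sinh \<theta> * laplace_integral \<nu> \<beta> \<theta> =
       integral\<^sup>L unit_borel (\<lambda>t. sinh \<theta> * (beta_weight \<beta> \<beta> t * (\<nu> * ((\<nu> - 1) * E t powr (\<nu> - 2) * (D t)\<^sup>2 + E t powr (\<nu> - 1) * E t)))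
        + 2 * \<beta> * cosh \<theta> * (beta_weight \<beta> \<beta> t * (\<nu> * E t powr (\<nu> - 1) * D t))
        - \<nu> * (\<nu> + 2 * \<beta>) * sinh \<theta> * (beta_weight \<beta> \<beta> t * E t powr \<nu>))"
      unfolding laplace_integral''_def laplace_integral'_def laplace_integral_def
      by (simp add: i E_def[symmetric] D_def[symmetric])
    also have "\<dots> = integral\<^sup>L unit_borel (\<lambda>t. 2 * \<nu> * (beta_weight \<beta> \<beta> t * W t))"
    proof (intro Bochner_Integration.integral_cong refl)
      fix t assume "t \<in> space unit_borel"
      then have t: "t \<in> {0..1}" by simp
      show "sinh \<theta> * (beta_weight \<beta> \<beta> t * (\<nu> * ((\<nu> - 1) * E t powr (\<nu> - 2) * (D t)\<^sup>2 + E t powr (\<nu> - 1) * E t)))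
        + 2 * \<beta> * cosh \<theta> * (beta_weight \<beta> \<beta> t * (\<nu> * E t powr (\<nu> - 1) * D t))
        - \<nu> * (\<nu> + 2 * \<beta>) * sinh \<theta> * (beta_weight \<beta> \<beta> t * E t powr \<nu>) = 2 * \<nu> * (beta_weight \<beta> \<beta> t * W t)"
        using pointwise[OF t] by algebra
    qed
    finally show ?thesis by simp
  qed
  ultimately show ?thesis by simp
qed

end

lemma Re_cosh_pos:
  assumes "\<theta> \<in> strip"
  shows "Re (cosh \<theta>) > 0"
proof -
  have "- \<theta> \<in> strip" using assms by (simp add: strip_def)
  moreover have "Re (cosh \<theta>) = (Re (exp \<theta>) + Re (exp (- \<theta>))) / 2"
    by (simp add: cosh_field_def)
  ultimately show ?thesis using Re_exp_pos[OF assms] Re_exp_pos[of "- \<theta>"] by simp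
qed

lemma half_one_minus_in_cut_plane: "Re g > 0 \<Longrightarrow> (1 - g) / 2 \<in> cut_plane"
  by (auto simp: of_real_image_atLeast_1_iff complex_nonpos_Reals_iff)

text \<open>Both sides solve Gegenbauer's equation in \<open>\<theta>\<close>. At
  \<open>\<theta> = 0\<close> the relevant indicial factor is \<open>k - 1 + 2 * \<beta>\<close>, so
  a holomorphic solution is determined by its value there, and the integral has the value
  \<open>Beta \<beta> \<beta>\<close>.\<close>

lemma hyp2F1_reg_cosh:
  assumes \<beta>: "Re \<beta> > 0" and \<theta>: "\<theta> \<in> strip"
  shows "hyp2F1_reg (- \<nu>) (2 * \<beta> + \<nu>) (\<beta> + 1 / 2) ((1 - cosh \<theta>) / 2) =
           rGamma (\<beta> + 1 / 2) / Beta \<beta> \<beta> * laplace_integral \<nu> \<beta> \<theta>"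
proof -
  define F where "F = hyp2F1_reg (- \<nu>) (2 * \<beta> + \<nu>) (\<beta> + 1 / 2)"
  have "Re (- \<nu>) > 0 \<or> Re (2 * \<beta> + \<nu>) > 0" using \<beta> by auto
  then have F: "continues_hyp2F1 F (- \<nu>) (2 * \<beta> + \<nu>) (\<beta> + 1 / 2)"
    unfolding F_def by (rule hyp2F1_reg_continues)
  then have Fhol: "F holomorphic_on cut_plane" by (simp add: continues_hyp2F1_def)
  define c where "c = rGamma (\<beta> + 1 / 2) / Beta \<beta> \<beta>"
  define L where "L = laplace_integral \<nu> \<beta>"
  have L: "(L has_field_derivative laplace_integral' \<nu> \<beta> \<theta>) (at \<theta>)"
    "(laplace_integral' \<nu> \<beta> has_field_derivative laplace_integral'' \<nu> \<beta> \<theta>) (at \<theta>)" if "\<theta> \<in> strip" for \<theta>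
    using laplace_integral_deriv[OF \<beta> that] laplace_integral_deriv2[OF \<beta> that] by (simp_all add: L_def)
  define y where "y \<theta> = F ((1 - cosh \<theta>) / 2) - c * L \<theta>" for \<theta>
  have arg: "(1 - cosh \<theta>) / 2 \<in> cut_plane" if "\<theta> \<in> strip" for \<theta>
    using that by (intro half_one_minus_in_cut_plane Re_cosh_pos)
  have d: "((\<lambda>\<theta>. F ((1 - cosh \<theta>) / 2)) has_field_derivative deriv F ((1 - cosh \<theta>) / 2) * (- sinh \<theta> / 2)) (at \<theta>)"
    "((\<lambda>\<theta>. deriv F ((1 - cosh \<theta>) / 2)) has_field_derivative deriv (deriv F) ((1 - cosh \<theta>) / 2) * (- sinh \<theta> / 2)) (at \<theta>)"
    if "\<theta> \<in> strip" for \<theta>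
  proof -
    have w: "((\<lambda>\<theta>. (1 - cosh \<theta>) / 2) has_field_derivative (- sinh \<theta> / 2)) (at \<theta>)"
      by (auto intro!: derivative_eq_intros)
    show "((\<lambda>\<theta>. F ((1 - cosh \<theta>) / 2)) has_field_derivative deriv F ((1 - cosh \<theta>) / 2) * (- sinh \<theta> / 2)) (at \<theta>)"
      by (rule DERIV_chain2[OF holomorphic_derivI[OF Fhol open_cut_plane arg[OF that]] w])
    show "((\<lambda>\<theta>. deriv F ((1 - cosh \<theta>) / 2)) has_field_derivative deriv (deriv F) ((1 - cosh \<theta>) / 2) * (- sinh \<theta> / 2)) (at \<theta>)"
      by (rule DERIV_chain2[OF holomorphic_derivI[OF holomorphic_deriv[OF Fhol open_cut_plane] open_cut_plane arg[OF that]] w])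
  qed
  have y1: "(y has_field_derivative deriv F ((1 - cosh \<theta>) / 2) * (- sinh \<theta> / 2) - c * laplace_integral' \<nu> \<beta> \<theta>) (at \<theta>)"
    if "\<theta> \<in> strip" for \<theta>
    unfolding y_def by (intro DERIV_diff DERIV_cmult d L that)
  have y2: "deriv (deriv y) \<theta> = deriv (deriv F) ((1 - cosh \<theta>) / 2) * (- sinh \<theta> / 2) * (- sinh \<theta> / 2)
      + (- cosh \<theta> / 2) * deriv F ((1 - cosh \<theta>) / 2) - c * laplace_integral'' \<nu> \<beta> \<theta>"
    if \<theta>: "\<theta> \<in> strip" for \<theta>
  proof (rule DERIV_imp_deriv, rule has_field_derivative_transform_within_open[OF _ open_strip \<theta>])
    have "((\<lambda>\<theta>. - sinh \<theta> / 2) has_field_derivative (- cosh \<theta> / 2)) (at \<theta>)"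
      by (auto intro!: derivative_eq_intros)
    then show "((\<lambda>\<theta>. deriv F ((1 - cosh \<theta>) / 2) * (- sinh \<theta> / 2) - c * laplace_integral' \<nu> \<beta> \<theta>) has_field_derivative
       deriv (deriv F) ((1 - cosh \<theta>) / 2) * (- sinh \<theta> / 2) * (- sinh \<theta> / 2)
      + (- cosh \<theta> / 2) * deriv F ((1 - cosh \<theta>) / 2) - c * laplace_integral'' \<nu> \<beta> \<theta>) (at \<theta>)"
      by (intro DERIV_diff DERIV_cmult DERIV_mult d L \<theta>)
  qed (use DERIV_imp_deriv[OF y1] in auto)
  have yhol: "y holomorphic_on strip"
    using y1 by (auto simp: holomorphic_on_open[OF open_strip])
  \<comment> \<open>The hypergeometric equation is available in the unit disc only. Equality is
    therefore proved near \<open>0\<close> and then continued along the strip.\<close>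
  define T where "T = strip \<inter> {\<theta>. norm ((1 - cosh \<theta>) / 2) < 1}"
  have "open T" unfolding T_def
    by (intro open_Int open_strip open_Collect_less continuous_intros) auto
  moreover have "0 \<in> T" by (simp add: T_def strip_def)
  ultimately obtain r where r: "r > 0" "ball 0 r \<subseteq> T" using openE by blast
  have y0: "y z = 0" if z: "z \<in> ball 0 r" for z
  proof (rule holomorphic_ode_unique[where f = y and S = "ball 0 r" and Z = sinh and Z' = 1
        and P = "\<lambda>z. 2 * \<beta> * cosh z" and Q = "\<lambda>z. - (\<nu> * (\<nu> + 2 * \<beta>) * sinh z)"])
    show "y holomorphic_on ball 0 r"
      by (rule holomorphic_on_subset[OF yhol]) (use r in \<open>auto simp: T_def\<close>)
    have "L 0 = integral\<^sup>L unit_borel (beta_weight \<beta> \<beta>)"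
      by (simp add: L_def laplace_integral_def laplace_base_def)
    also have "\<dots> = Beta \<beta> \<beta>" by (rule integral_beta_weight[OF \<beta> \<beta>])
    finally have "L 0 = Beta \<beta> \<beta>" .
    moreover have "Beta \<beta> \<beta> \<noteq> 0"
    proof -
      have "\<beta> \<notin> \<int>\<^sub>\<le>\<^sub>0" "\<beta> + \<beta> \<notin> \<int>\<^sub>\<le>\<^sub>0" using \<beta> by (auto intro!: Re_pos_not_nonpos_Int simp del: mult_2)
      then show ?thesis by (simp add: Beta_altdef Gamma_eq_zero_iff rGamma_eq_zero_iff)
    qed
    ultimately show "y 0 = 0"
      using continues_hyp2F1_at_0[OF F] by (simp add: y_def c_def)
    show "(sinh has_field_derivative 1) (at (0::complex))"
      by (auto intro!: derivative_eq_intros)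
    show "1 * of_nat (k - 1) + 2 * \<beta> * cosh 0 \<noteq> 0" if "k > 0" for k
      using \<beta> by (auto simp: complex_eq_iff)
    fix \<theta> assume "\<theta> \<in> ball (0::complex) r"
    then have \<theta>: "\<theta> \<in> strip" and w: "(1 - cosh \<theta>) / 2 \<in> ball 0 1" using r by (auto simp: T_def subset_iff)
    define w where "w = (1 - cosh \<theta>) / 2"
    have ch: "cosh \<theta> = 1 - 2 * w" by (simp add: w_def field_simps)
    have "(cosh \<theta>)\<^sup>2 = (sinh \<theta>)\<^sup>2 + 1" by (rule cosh_square_eq)
    then have sh: "(sinh \<theta>)\<^sup>2 = 4 * w * (w - 1)" unfolding ch by algebra
    then have sh4: "(sinh \<theta>)\<^sup>2 / 4 = w * (w - 1)" by simp
    have oF: "w * (1 - w) * deriv (deriv F) w + ((\<beta> + 1 / 2) - (2 * \<beta> + 1) * w) * deriv F w + \<nu> * (2 * \<beta> + \<nu>) * F w = 0"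
      using continues_hyp2F1_ode[OF F w] by (simp add: w_def)
    have oL: "sinh \<theta> * laplace_integral'' \<nu> \<beta> \<theta> + 2 * \<beta> * cosh \<theta> * laplace_integral' \<nu> \<beta> \<theta>
           - \<nu> * (\<nu> + 2 * \<beta>) * sinh \<theta> * L \<theta> = 0"
      unfolding L_def by (rule laplace_integral_ode[OF \<beta> \<theta>])
    have "sinh \<theta> * deriv (deriv y) \<theta> + 2 * \<beta> * cosh \<theta> * deriv y \<theta> + - (\<nu> * (\<nu> + 2 * \<beta>) * sinh \<theta>) * y \<theta> =
      sinh \<theta> * (deriv (deriv F) w * ((sinh \<theta>)\<^sup>2 / 4) - ((\<beta> + 1 / 2) * cosh \<theta>) * deriv F w - \<nu> * (\<nu> + 2 * \<beta>) * F w)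
      - c * (sinh \<theta> * laplace_integral'' \<nu> \<beta> \<theta> + 2 * \<beta> * cosh \<theta> * laplace_integral' \<nu> \<beta> \<theta>
           - \<nu> * (\<nu> + 2 * \<beta>) * sinh \<theta> * L \<theta>)"
      unfolding DERIV_imp_deriv[OF y1[OF \<theta>]] y2[OF \<theta>] w_def[symmetric]
      by (simp add: y_def w_def[symmetric] power2_eq_square algebra_simps)
    also have "\<dots> = - sinh \<theta> * (w * (1 - w) * deriv (deriv F) w + ((\<beta> + 1 / 2) - (2 * \<beta> + 1) * w) * deriv F w + \<nu> * (2 * \<beta> + \<nu>) * F w)"
      unfolding oL sh4 unfolding ch by (simp add: algebra_simps)
    finally show "sinh \<theta> * deriv (deriv y) \<theta> + 2 * \<beta> * cosh \<theta> * deriv y \<theta> + - (\<nu> * (\<nu> + 2 * \<beta>) * sinh \<theta>) * y \<theta> = 0"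
      by (simp add: oF)
  qed (use r z in \<open>auto intro!: continuous_intros\<close>)
  have "y \<theta> = 0"
  proof (rule analytic_continuation_open[where s = "ball 0 r" and s' = strip and f = y and g = "\<lambda>_. 0"])
    show "ball 0 r \<subseteq> strip" using r by (auto simp: T_def)
  qed (use r y0 yhol \<theta> open_strip convex_strip in \<open>auto intro: convex_connected\<close>)
  then show ?thesis by (simp add: y_def F_def L_def c_def)
qed

text \<open>Legendre's duplication formula absorbs \<open>sqrt pi\<close>, the power of two and
  \<open>Gamma (\<beta> + 1 / 2)\<close> into a single factor
  \<open>1 / Gamma \<beta> ^ 2\<close>.\<close>

lemma gegenbauer_C_cosh:
  assumes \<beta>: "Re \<beta> > 0" and \<theta>: "\<theta> \<in> strip"
  shows "gegenbauer_C \<nu> \<beta> (cosh \<theta>) = Gamma (2 * \<beta> + \<nu>) / (Gamma \<beta> ^ 2 * Gamma (\<nu> + 1)) * laplace_integral \<nu> \<beta> \<theta>"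
proof -
  have nz: "\<beta> \<notin> \<int>\<^sub>\<le>\<^sub>0" "\<beta> + 1 / 2 \<notin> \<int>\<^sub>\<le>\<^sub>0" "2 * \<beta> \<notin> \<int>\<^sub>\<le>\<^sub>0"
    using \<beta> by (auto intro!: Re_pos_not_nonpos_Int)
  have dup: "Gamma \<beta> * Gamma (\<beta> + 1 / 2) = exp ((1 - 2 * \<beta>) * of_real (ln 2)) * of_real (sqrt pi) * Gamma (2 * \<beta>)"
    by (rule Gamma_legendre_duplication[OF nz(1,2)])
  have two: "2 powr (2 * \<beta> - 1) * exp ((1 - 2 * \<beta>) * of_real (ln 2)) = (1 :: complex)"
  proof -
    have "Ln 2 = of_real (ln 2)" using Ln_of_real[of 2] by simp
    then show ?thesis by (simp add: powr_def flip: exp_add) (simp add: algebra_simps flip: exp_add)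
  qed
  have G: "Gamma \<beta> \<noteq> 0" "Gamma (\<beta> + 1 / 2) \<noteq> 0" "Gamma (2 * \<beta>) \<noteq> 0" using nz by (simp_all add: Gamma_eq_zero_iff)
  have "of_real (sqrt pi) / (2 powr (2 * \<beta> - 1) * Gamma \<beta>) * (rGamma (\<beta> + 1 / 2) / Beta \<beta> \<beta>) = 1 / Gamma \<beta> ^ 2"
  proof -
    have "Gamma \<beta> * Gamma (\<beta> + 1 / 2) * 2 powr (2 * \<beta> - 1) = of_real (sqrt pi) * Gamma (2 * \<beta>)"
      unfolding dup using two by algebra
    then have "Gamma \<beta> * 2 powr (2 * \<beta> - 1) = of_real (sqrt pi) * Gamma (2 * \<beta>) / Gamma (\<beta> + 1 / 2)"
      using G by (simp add: field_simps)
    moreover have "Beta \<beta> \<beta> = Gamma \<beta> ^ 2 / Gamma (2 * \<beta>)" by (simp add: Beta_def power2_eq_square flip: mult_2)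
    moreover have "rGamma (\<beta> + 1 / 2) = 1 / Gamma (\<beta> + 1 / 2)" by (simp add: rGamma_inverse_Gamma inverse_eq_divide)
    ultimately show ?thesis using G by (simp add: mult.commute[of "2 powr _"])
  qed
  note const = this
  have "gegenbauer_C \<nu> \<beta> (cosh \<theta>) =
      of_real (sqrt pi) / (2 powr (2 * \<beta> - 1) * Gamma \<beta>) * (rGamma (\<beta> + 1 / 2) / Beta \<beta> \<beta>) *
      (Gamma (2 * \<beta> + \<nu>) / Gamma (\<nu> + 1) * laplace_integral \<nu> \<beta> \<theta>)"
    unfolding gegenbauer_C_def hyp2F1_reg_cosh[OF \<beta> \<theta>] by (simp add: mult_ac)
  then show ?thesis unfolding const by simp
qed

section \<open>Moments of the kernel\<close>

lemma of_real_mult_powr: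
  "s > 0 \<Longrightarrow> t > 0 \<Longrightarrow> complex_of_real (s * t) powr z = of_real s powr z * of_real t powr z"
  by (rule powr_times_real[of "of_real s" "of_real t" z, folded of_real_mult]) auto

text \<open>Laplace's integral for \<open>u = exp (-2 * \<theta>)\<close> with
  \<open>exp \<theta>\<close> taken out of the base. It is Euler's integral for a hypergeometric
  function with parameters \<open>- \<nu>\<close>, \<open>\<beta>\<close>,
  \<open>2 * \<beta>\<close> at \<open>1 - u\<close>.\<close>

definition euler_kernel :: "complex \<Rightarrow> complex \<Rightarrow> complex \<Rightarrow> complex" where
  "euler_kernel \<nu> \<beta> u = integral\<^sup>L unit_borel (\<lambda>t. beta_weight \<beta> \<beta> t * (1 - (1 - u) * of_real t) powr \<nu>)"

text \<open>The integrand of two composed fractional integrals of order \<open>\<beta>\<close>, with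
  an additional power of \<open>u\<close> for the moment. The indicator extends it to the plane, so
  that Fubini's theorem applies to \<open>lborel\<close> itself.\<close>

definition triangle_kernel :: "complex \<Rightarrow> complex \<Rightarrow> complex \<Rightarrow> real \<Rightarrow> real \<Rightarrow> complex" where
  "triangle_kernel p \<beta> \<nu> v u = indicator {(v, u). 0 < u \<and> u < v \<and> v < 1} (v, u) *\<^sub>R
     (of_real u powr (p - 1) * of_real (v - u) powr (\<beta> - 1) * of_real (1 - v) powr (\<beta> - 1) * of_real v powr \<nu>)"

text \<open>The absolute value is again such a kernel, so absolute integrability can be computed by
  the formula for the inner integral.\<close>

lemma norm_triangle_kernel:
  "complex_of_real (norm (triangle_kernel p \<beta> \<nu> v u)) = triangle_kernel (of_real (Re p)) (of_real (Re \<beta>)) (of_real (Re \<nu>)) v u"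
proof (cases "0 < u \<and> u < v \<and> v < 1")
  case True
  have n: "complex_of_real (norm (complex_of_real r powr (z - 1))) = of_real r powr (of_real (Re z) - 1)"
    "complex_of_real (norm (complex_of_real r powr z)) = of_real r powr of_real (Re z)" if "r > 0" for r z
    using that powr_of_real[of r "Re z - 1"] powr_of_real[of r "Re z"] by (simp_all add: norm_of_real_powr)
  show ?thesis
    using True n[of u] n[of "v - u"] n[of "1 - v"] n[of v]
    by (simp add: triangle_kernel_def norm_mult del: of_real_diff)
qed (simp add: triangle_kernel_def)

lemma borel_measurable_triangle_kernel:
  "case_prod (triangle_kernel p \<beta> \<nu>) \<in> borel_measurable (lborel \<Otimes>\<^sub>M lborel)"
proof -
  let ?T = "{(v::real, u::real). 0 < u \<and> u < v \<and> v < 1}"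
  have "open ?T"
    unfolding case_prod_unfold
    by (intro open_Collect_conj open_Collect_less continuous_intros)
  moreover have "continuous_on ?T (\<lambda>(v, u). complex_of_real u powr (p - 1) * of_real (v - u) powr (\<beta> - 1) * of_real (1 - v) powr (\<beta> - 1) * of_real v powr \<nu>)"
    unfolding case_prod_unfold
    by (intro continuous_on_mult continuous_on_powr_slit continuous_intros)
       (auto simp: complex_nonpos_Reals_iff)
  ultimately have "(\<lambda>x. indicator ?T x *\<^sub>R (case x of (v, u) \<Rightarrow> complex_of_real u powr (p - 1) * of_real (v - u) powr (\<beta> - 1) * of_real (1 - v) powr (\<beta> - 1) * of_real v powr \<nu>)) \<in> borel_measurable borel"
    by (intro borel_measurable_continuous_on_indicator) auto
  moreover have "(\<lambda>x. indicator ?T x *\<^sub>R (case x of (v, u) \<Rightarrow> complex_of_real u powr (p - 1) * of_real (v - u) powr (\<beta> - 1) * of_real (1 - v) powr (\<beta> - 1) * of_real v powr \<nu>)) = case_prod (triangle_kernel p \<beta> \<nu>)"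
    by (auto simp: triangle_kernel_def fun_eq_iff)
  ultimately show ?thesis
    by (simp add: lborel_prod)
qed

context
  fixes p \<beta> \<nu> :: complex
  assumes p: "Re p > 0" and \<beta>: "Re \<beta> > 0"
begin

text \<open>The substitution \<open>u = v * s\<close> separates \<open>Beta p \<beta>\<close> from
  the powers of \<open>v\<close>. Their exponents \<open>p - 1\<close>, \<open>\<beta> - 1\<close>,
  \<open>\<nu>\<close> and the \<open>1\<close> from \<open>du = v ds\<close> add up to
  \<open>p + \<nu> + \<beta> - 1\<close>.\<close>

lemma triangle_kernel_inner:
  shows "integrable lborel (triangle_kernel p \<beta> \<nu> v)"
    and "integral\<^sup>L lborel (triangle_kernel p \<beta> \<nu> v) = indicator {0<..<1} v *\<^sub>R (beta_weight (p + \<nu> + \<beta>) \<beta> v * Beta p \<beta>)"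
proof -
  have *: "integrable lborel (triangle_kernel p \<beta> \<nu> v) \<and>
     integral\<^sup>L lborel (triangle_kernel p \<beta> \<nu> v) = indicator {0<..<1} v *\<^sub>R (beta_weight (p + \<nu> + \<beta>) \<beta> v * Beta p \<beta>)"
  proof (cases "v \<in> {0<..<1}")
    case False
    then have "triangle_kernel p \<beta> \<nu> v = (\<lambda>_. 0)" by (auto simp: triangle_kernel_def fun_eq_iff)
    then show ?thesis using False by simp
  next
    case True
    then have v: "0 < v" "v < 1" by auto
    define C where "C = of_real v powr (p - 1) * of_real v powr (\<beta> - 1) * of_real (1 - v) powr (\<beta> - 1) * of_real v powr \<nu>"
    have eq: "triangle_kernel p \<beta> \<nu> v (0 + v * s) = C * (indicator {0<..<1} s *\<^sub>R beta_weight p \<beta> s)" for s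
    proof (cases "s \<in> {0<..<1}")
      case s: True
      then have "v - v * s = v * (1 - s)" "v * s < v" using v by (auto simp: algebra_simps)
      then show ?thesis
        using v s of_real_mult_powr[of v s] of_real_mult_powr[of v "1 - s"]
        by (simp add: triangle_kernel_def beta_weight_def C_def mult_ac del: of_real_diff of_real_mult)
    qed (use v in \<open>auto simp: triangle_kernel_def zero_less_mult_iff\<close>)
    have i: "integrable lborel (\<lambda>s. indicator {0<..<1} s *\<^sub>R beta_weight p \<beta> s)"
      using integrable_beta_weight[OF p \<beta>] by (simp add: integrable_restrict_space)
    have "integrable lborel (\<lambda>s. triangle_kernel p \<beta> \<nu> v (0 + v * s))"
      unfolding eq using i by (rule integrable_mult_right)
    then have 1: "integrable lborel (triangle_kernel p \<beta> \<nu> v)"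
      using v by (subst (asm) lborel_integrable_real_affine_iff) auto
    have "integral\<^sup>L lborel (triangle_kernel p \<beta> \<nu> v) = \<bar>v\<bar> *\<^sub>R integral\<^sup>L lborel (\<lambda>s. triangle_kernel p \<beta> \<nu> v (0 + v * s))"
      using v by (intro lborel_integral_real_affine) auto
    also have "\<dots> = of_real v * C * Beta p \<beta>"
      using v integral_beta_weight[OF p \<beta>] unfolding eq
      by (simp add: integral_restrict_space scaleR_conv_of_real)
    also have "of_real v * C = beta_weight (p + \<nu> + \<beta>) \<beta> v"
    proof -
      have "of_real v powr (p + \<nu> + \<beta> - 1) = of_real v powr (1 + (p - 1) + (\<beta> - 1) + \<nu>)"
        by (simp add: algebra_simps)
      also have "\<dots> = of_real v * of_real v powr (p - 1) * of_real v powr (\<beta> - 1) * of_real v powr \<nu>"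
        using v by (simp only: powr_add) simp
      finally show ?thesis by (simp add: C_def beta_weight_def mult_ac)
    qed
    finally show ?thesis using 1 True by simp
  qed
  then show "integrable lborel (triangle_kernel p \<beta> \<nu> v)"
    "integral\<^sup>L lborel (triangle_kernel p \<beta> \<nu> v) = indicator {0<..<1} v *\<^sub>R (beta_weight (p + \<nu> + \<beta>) \<beta> v * Beta p \<beta>)"
    by blast+
qed

text \<open>With \<open>v = 1 - (1 - u) * s\<close> one has \<open>v - u = (1 - u) * (1 - s)\<close>
  and \<open>1 - v = (1 - u) * s\<close>. The powers of \<open>1 - u\<close> combine to exponent
  \<open>2 * \<beta> - 1\<close>, and \<open>v powr \<nu>\<close> is the integrand of
  \<open>euler_kernel\<close>.\<close>

lemma triangle_kernel_outer:
  "integral\<^sup>L lborel (\<lambda>v. triangle_kernel p \<beta> \<nu> v u) = indicator {0<..<1} u *\<^sub>R (beta_weight p (2 * \<beta>) u * euler_kernel \<nu> \<beta> (of_real u))"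
proof (cases "u \<in> {0<..<1}")
  case False
  then have "(\<lambda>v. triangle_kernel p \<beta> \<nu> v u) = (\<lambda>_. 0)" by (auto simp: triangle_kernel_def fun_eq_iff)
  then show ?thesis using False by simp
next
  case True
  then have u: "0 < u" "u < 1" by auto
  define C where "C = of_real u powr (p - 1) * of_real (1 - u) powr (\<beta> - 1) * of_real (1 - u) powr (\<beta> - 1)"
  have eq: "triangle_kernel p \<beta> \<nu> (1 + (- (1 - u)) * s) u =
      C * (indicator {0<..<1} s *\<^sub>R (beta_weight \<beta> \<beta> s * (1 - (1 - of_real u) * of_real s) powr \<nu>))" for s
  proof (cases "s \<in> {0<..<1}")
    case s: True
    then have s': "0 < s" "s < 1" by auto
    define v where "v = 1 + (- (1 - u)) * s"
    have e1: "v - u = (1 - u) * (1 - s)" and e2: "1 - v = (1 - u) * s" by (simp_all add: v_def algebra_simps)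
    have "(1 - u) * (1 - s) > 0" "(1 - u) * s > 0" using u s' by auto
    then have "u < v" "v < 1" unfolding e1[symmetric] e2[symmetric] by simp_all
    then have "triangle_kernel p \<beta> \<nu> v u = of_real u powr (p - 1) * of_real ((1 - u) * (1 - s)) powr (\<beta> - 1) *
        of_real ((1 - u) * s) powr (\<beta> - 1) * of_real v powr \<nu>"
      unfolding e1[symmetric] e2[symmetric] using u by (simp add: triangle_kernel_def)
    also have "\<dots> = C * (beta_weight \<beta> \<beta> s * of_real v powr \<nu>)"
      using u s' by (simp add: of_real_mult_powr beta_weight_def C_def mult_ac del: of_real_diff of_real_mult)
    also have "complex_of_real v = 1 - (1 - of_real u) * of_real s" by (simp add: v_def algebra_simps)
    finally show ?thesis using s by (simp add: v_def)
  next
    case s: False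
    have "\<not> (u < 1 + (- (1 - u)) * s \<and> 1 + (- (1 - u)) * s < 1)"
    proof
      assume "u < 1 + (- (1 - u)) * s \<and> 1 + (- (1 - u)) * s < 1"
      then have "0 < (1 - u) * (1 - s)" "0 < (1 - u) * s" by (auto simp: algebra_simps)
      then show False using u s by (auto simp: zero_less_mult_iff)
    qed
    then show ?thesis using s by (simp add: triangle_kernel_def)
  qed
  have "integral\<^sup>L lborel (\<lambda>v. triangle_kernel p \<beta> \<nu> v u) =
      \<bar>- (1 - u)\<bar> *\<^sub>R integral\<^sup>L lborel (\<lambda>s. triangle_kernel p \<beta> \<nu> (1 + (- (1 - u)) * s) u)"
    using u by (intro lborel_integral_real_affine) auto
  also have "\<dots> = of_real (1 - u) * C * euler_kernel \<nu> \<beta> (of_real u)"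
    using u unfolding eq by (simp add: euler_kernel_def integral_restrict_space scaleR_conv_of_real)
  also have "of_real (1 - u) * C = beta_weight p (2 * \<beta>) u"
  proof -
    have "complex_of_real (1 - u) powr (2 * \<beta> - 1) = of_real (1 - u) powr (1 + (\<beta> - 1) + (\<beta> - 1))"
      by (simp add: algebra_simps)
    also have "\<dots> = of_real (1 - u) * of_real (1 - u) powr (\<beta> - 1) * of_real (1 - u) powr (\<beta> - 1)"
      using u by (simp only: powr_add) simp
    finally show ?thesis by (simp add: C_def beta_weight_def mult_ac)
  qed
  finally show ?thesis using True by simp
qed

end

text \<open>The moments of the kernel factor because the kernel is a multiplicative convolution of two
  power weights; this is Fubini's theorem on the triangle \<open>0 < u < v < 1\<close>.\<close>
lemma euler_kernel_integral:
  assumes p: "Re p > 0" and \<beta>: "Re \<beta> > 0" and q: "Re (p + \<nu> + \<beta>) > 0"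
  shows "integrable unit_borel (\<lambda>u. beta_weight p (2 * \<beta>) u * euler_kernel \<nu> \<beta> (of_real u))"
    and "integral\<^sup>L unit_borel (\<lambda>u. beta_weight p (2 * \<beta>) u * euler_kernel \<nu> \<beta> (of_real u)) =
           Beta p \<beta> * Beta (p + \<nu> + \<beta>) \<beta>"
proof -
  have int_w: "integrable lborel (\<lambda>v. indicator {0<..<1} v *\<^sub>R (beta_weight a b v * c))" if "Re a > 0" "Re b > 0" for a b c
    using integrable_mult_left[OF integrable_beta_weight[OF that], of c] by (simp add: integrable_restrict_space)
  have int: "integrable (lborel \<Otimes>\<^sub>M lborel) (case_prod (triangle_kernel p \<beta> \<nu>))"
  proof (rule lborel_pair.Fubini_integrable[OF borel_measurable_triangle_kernel])
    \<comment> \<open>The kernel for the real parts of the parameters; its inner integral is a Beta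
      weight with positive parameters, hence integrable in \<open>v\<close>.\<close>
    let ?k = "triangle_kernel (of_real (Re p)) (of_real (Re \<beta>)) (of_real (Re \<nu>))"
    have "integrable lborel (\<lambda>v. integral\<^sup>L lborel (?k v))"
      using p \<beta> q by (subst triangle_kernel_inner(2)) (auto intro!: int_w)
    also have "(\<lambda>v. integral\<^sup>L lborel (?k v)) = (\<lambda>v. complex_of_real (\<integral>u. norm (triangle_kernel p \<beta> \<nu> v u) \<partial>lborel))"
    proof
      fix v
      have "?k v = (\<lambda>u. complex_of_real (norm (triangle_kernel p \<beta> \<nu> v u)))"
        by (simp add: norm_triangle_kernel)
      then show "integral\<^sup>L lborel (?k v) = complex_of_real (\<integral>u. norm (triangle_kernel p \<beta> \<nu> v u) \<partial>lborel)"
        by simp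
    qed
    finally show "integrable lborel (\<lambda>v. \<integral>u. norm (case (v, u) of (v, u) \<Rightarrow> triangle_kernel p \<beta> \<nu> v u) \<partial>lborel)"
      by (simp add: complex_of_real_integrable_eq)
    show "AE v in lborel. integrable lborel (\<lambda>u. case (v, u) of (v, u) \<Rightarrow> triangle_kernel p \<beta> \<nu> v u)"
      using triangle_kernel_inner(1)[OF p \<beta>] by simp
  qed
  from lborel_pair.integrable_snd[OF int]
  show "integrable unit_borel (\<lambda>u. beta_weight p (2 * \<beta>) u * euler_kernel \<nu> \<beta> (of_real u))"
    by (simp add: triangle_kernel_outer[OF p \<beta>] integrable_restrict_space)
  have "integral\<^sup>L unit_borel (\<lambda>u. beta_weight p (2 * \<beta>) u * euler_kernel \<nu> \<beta> (of_real u)) =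
      (\<integral>u. (\<integral>v. triangle_kernel p \<beta> \<nu> v u \<partial>lborel) \<partial>lborel)"
    by (simp add: triangle_kernel_outer[OF p \<beta>] integral_restrict_space)
  also have "\<dots> = (\<integral>v. (\<integral>u. triangle_kernel p \<beta> \<nu> v u \<partial>lborel) \<partial>lborel)"
    by (rule lborel_pair.Fubini_integral[OF int])
  also have "\<dots> = integral\<^sup>L unit_borel (\<lambda>v. beta_weight (p + \<nu> + \<beta>) \<beta> v * Beta p \<beta>)"
    unfolding triangle_kernel_inner(2)[OF p \<beta>] by (subst integral_restrict_space) simp_all
  also have "\<dots> = Beta p \<beta> * Beta (p + \<nu> + \<beta>) \<beta>"
    using integral_beta_weight[OF q \<beta>] by simp
  finally show "integral\<^sup>L unit_borel (\<lambda>u. beta_weight p (2 * \<beta>) u * euler_kernel \<nu> \<beta> (of_real u)) =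
           Beta p \<beta> * Beta (p + \<nu> + \<beta>) \<beta>" .
qed

text \<open>The hypergeometric function is reproduced by the integral operator up to a factor. This
  needs \<open>c - a = b + \<beta>\<close> and \<open>c - b = a + \<beta>\<close>, which is the
  content of \<open>c = a + b + \<beta>\<close>, while \<open>a = b + \<nu> + \<beta>\<close> makes
  \<open>a\<close> the first argument of the second Beta function.\<close>

lemma kernel_integral_hyp2F1:
  assumes a: "Re a > 0" and b: "Re b > 0" and \<beta>: "Re \<beta> > 0" and y: "norm y < 1"
    and \<nu>: "a = b + \<nu> + \<beta>" and c: "c = a + b + \<beta>"
  shows "integral\<^sup>L unit_borel (\<lambda>u. beta_weight b (2 * \<beta>) u * euler_kernel \<nu> \<beta> (of_real u)
            * hyp2F1_reg (b + \<beta>) (a + \<beta>) c (y * of_real u)) =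
         (Gamma \<beta>)\<^sup>2 * Gamma a * Gamma b * rGamma (a + \<beta>) * rGamma (b + \<beta>) * (1 - y) powr \<beta> *
           hyp2F1_reg (b + \<beta>) (a + \<beta>) c y"
proof -
  define F where "F = hyp2F1_reg (b + \<beta>) (a + \<beta>) c"
  define F' where "F' = hyp2F1_reg a b c"
  have F: "continues_hyp2F1 F (b + \<beta>) (a + \<beta>) c" unfolding F_def
    using b \<beta> by (intro hyp2F1_reg_continues) auto
  have F': "continues_hyp2F1 F' a b c" unfolding F'_def
    using a by (intro hyp2F1_reg_continues) auto
  define q where "q n = hyp2F1_coeff (b + \<beta>) (a + \<beta>) c n * y ^ n" for n
  have q: "summable (\<lambda>n. norm (q n))"
  proof -
    \<comment> \<open>Convergence at a radius strictly between \<open>norm y\<close> and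
      \<open>1\<close> gives absolute convergence at \<open>y\<close>.\<close>
    define r where "r = complex_of_real ((1 + norm y) / 2)"
    have r: "norm r = (1 + norm y) / 2"
      unfolding r_def norm_of_real by (simp add: add_nonneg_nonneg)
    with y have "r \<in> ball 0 1" by simp
    then have "summable (\<lambda>n. hyp2F1_coeff (b + \<beta>) (a + \<beta>) c n * r ^ n)"
      using F by (auto simp: continues_hyp2F1_def sums_iff)
    moreover have "norm y < norm r" using y r by simp
    ultimately show ?thesis unfolding q_def by (rule powser_insidea)
  qed
  define g where "g u = beta_weight b (2 * \<beta>) u * euler_kernel \<nu> \<beta> (of_real u)" for u
  have gi: "integrable unit_borel g" unfolding g_def
    using euler_kernel_integral(1)[OF b \<beta>] a \<nu> by simp
  define K where "K = (Gamma \<beta>)\<^sup>2 * Gamma a * Gamma b * rGamma (a + \<beta>) * rGamma (b + \<beta>)"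
  have moment: "q n * integral\<^sup>L unit_borel (\<lambda>u. g u * of_real u ^ n) = K * (hyp2F1_coeff a b c n * y ^ n)" for n
  proof -
    have bn: "Re (b + of_nat n) > 0" "Re (b + of_nat n + \<nu> + \<beta>) > 0" using b a \<nu> by (auto simp: add_pos_nonneg)
    have "integral\<^sup>L unit_borel (\<lambda>u. g u * of_real u ^ n) =
        integral\<^sup>L unit_borel (\<lambda>u. beta_weight (b + of_nat n) (2 * \<beta>) u * euler_kernel \<nu> \<beta> (of_real u))"
      by (intro Bochner_Integration.integral_cong refl) (simp add: g_def mult.assoc mult.left_commute[of "euler_kernel _ _ _"]
           flip: beta_weight_power)
    also have "\<dots> = Beta (b + of_nat n) \<beta> * Beta (a + of_nat n) \<beta>"
      using euler_kernel_integral(2)[OF bn(1) \<beta> bn(2)] by (simp add: \<nu> add_ac)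
    finally have I: "integral\<^sup>L unit_borel (\<lambda>u. g u * of_real u ^ n) = Beta (b + of_nat n) \<beta> * Beta (a + of_nat n) \<beta>" .
    have G: "Gamma (z + of_nat n) = pochhammer z n * Gamma z" if "Re z > 0" for z :: complex
      using that by (subst pochhammer_Gamma) (auto simp: Gamma_eq_zero_iff Re_pos_not_nonpos_Int)
    \<comment> \<open>The Pochhammer symbol of the series cancels the denominator of the Beta
      function, and its numerator leaves the symbol with parameter lowered by
      \<open>\<beta>\<close>.\<close>
    have B: "pochhammer (z + \<beta>) n * Beta (z + of_nat n) \<beta> = pochhammer z n * Gamma z * Gamma \<beta> * rGamma (z + \<beta>)" if "Re z > 0" for z
      using pochhammer_rGamma[of "z + \<beta>" n] by (simp add: Beta_altdef G[OF that] add_ac mult_ac)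
    have "q n * (Beta (b + of_nat n) \<beta> * Beta (a + of_nat n) \<beta>) =
        (pochhammer (b + \<beta>) n * Beta (b + of_nat n) \<beta>) * (pochhammer (a + \<beta>) n * Beta (a + of_nat n) \<beta>)
         * (rGamma (c + of_nat n) / fact n * y ^ n)"
      by (simp add: q_def hyp2F1_coeff_def mult_ac)
    also have "\<dots> = K * (hyp2F1_coeff a b c n * y ^ n)"
      unfolding B[OF a] B[OF b] by (simp add: K_def hyp2F1_coeff_def power2_eq_square mult_ac)
    finally show ?thesis unfolding I .
  qed
  have "(\<lambda>n. K * (hyp2F1_coeff a b c n * y ^ n)) sums integral\<^sup>L unit_borel (\<lambda>u. g u * (\<Sum>n. q n * of_real u ^ n))"
    using integral_power_series_sums[OF gi q] by (simp add: moment)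
  moreover have "(\<lambda>n. K * (hyp2F1_coeff a b c n * y ^ n)) sums (K * F' y)"
    using F' y by (intro sums_mult) (auto simp: continues_hyp2F1_def)
  ultimately have "integral\<^sup>L unit_borel (\<lambda>u. g u * (\<Sum>n. q n * of_real u ^ n)) = K * F' y"
    by (rule sums_unique2)
  moreover have "integral\<^sup>L unit_borel (\<lambda>u. g u * (\<Sum>n. q n * of_real u ^ n)) = integral\<^sup>L unit_borel (\<lambda>u. g u * F (y * of_real u))"
  proof (intro Bochner_Integration.integral_cong refl)
    fix u assume "u \<in> space unit_borel"
    then have "y * of_real u \<in> ball 0 1"
      using y by (auto simp: norm_mult intro: le_less_trans[OF mult_left_le])
    then have "(\<lambda>n. hyp2F1_coeff (b + \<beta>) (a + \<beta>) c n * (y * of_real u) ^ n) sums F (y * of_real u)"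
      using F unfolding continues_hyp2F1_def by blast
    then have "(\<lambda>n. q n * of_real u ^ n) sums F (y * of_real u)"
      by (simp add: q_def power_mult_distrib mult.assoc)
    then show "g u * (\<Sum>n. q n * of_real u ^ n) = g u * F (y * of_real u)" by (simp add: sums_iff)
  qed
  moreover have "F' y = (1 - y) powr \<beta> * F y"
  proof -
    have "continues_hyp2F1 F (c - a) (c - b) c" using F c by (simp add: add_ac)
    moreover have "Re c > 0" "y \<in> ball 0 1" using a b \<beta> c y by auto
    ultimately have "F' y = (1 - y) powr (c - a - b) * F y" using F' by (intro euler_transformation)
    then show ?thesis using c by simp
  qed
  ultimately show ?thesis by (simp add: g_def F_def K_def mult_ac)
qed

lemma minus_Ln_in_strip:
  assumes "Re \<rho> > 0"
  shows "- Ln \<rho> \<in> strip" "exp (- Ln \<rho>) = inverse \<rho>" "cosh (- Ln \<rho>) = (\<rho> + inverse \<rho>) / 2"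
proof -
  have nz: "\<rho> \<noteq> 0" using assms by auto
  then show "- Ln \<rho> \<in> strip" using assms Re_Ln_pos_lt[OF nz] by (simp add: strip_def)
  show e: "exp (- Ln \<rho>) = inverse \<rho>" using nz by (simp add: exp_minus)
  show "cosh (- Ln \<rho>) = (\<rho> + inverse \<rho>) / 2" using nz e by (simp add: cosh_field_def exp_minus add_ac)
qed

lemma laplace_base_minus_Ln:
  assumes "Re \<rho> > 0"
  shows "laplace_base (- Ln \<rho>) t = inverse \<rho> * (1 - (1 - \<rho>\<^sup>2) * of_real t)"
proof -
  have "\<rho> \<noteq> 0" using assms by auto
  then show ?thesis by (simp add: laplace_base_def exp_minus field_simps power2_eq_square)
qed

text \<open>For real \<open>r\<close> both factors of the base are positive, so the power of the
  product splits. For complex roots only moduli will be compared, and no such splitting is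
  required.\<close>

lemma laplace_integral_of_real:
  assumes "r > 0"
  shows "laplace_integral \<nu> \<beta> (- Ln (of_real r)) = of_real r powr (- \<nu>) * euler_kernel \<nu> \<beta> (of_real (r\<^sup>2))"
proof -
  have "laplace_integral \<nu> \<beta> (- Ln (of_real r)) =
      integral\<^sup>L unit_borel (\<lambda>t. of_real r powr (- \<nu>) * (beta_weight \<beta> \<beta> t * (1 - (1 - of_real (r\<^sup>2)) * of_real t) powr \<nu>))"
    unfolding laplace_integral_def
  proof (intro Bochner_Integration.integral_cong refl)
    fix t assume t: "t \<in> space unit_borel"
    then have "0 < (1 - t) + r\<^sup>2 * t" using assms by (intro add_pos_pos) auto
    then have pos: "0 < 1 - (1 - r\<^sup>2) * t" by (simp add: algebra_simps)
    have "laplace_base (- Ln (of_real r)) t = of_real (inverse r * (1 - (1 - r\<^sup>2) * t))"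
      using assms by (subst laplace_base_minus_Ln) auto
    then have "laplace_base (- Ln (of_real r)) t powr \<nu> = of_real (inverse r) powr \<nu> * of_real (1 - (1 - r\<^sup>2) * t) powr \<nu>"
      using assms pos of_real_mult_powr[of "inverse r" "1 - (1 - r\<^sup>2) * t" \<nu>] by (simp del: of_real_mult of_real_diff)
    moreover have "complex_of_real (inverse r) powr \<nu> = of_real r powr (- \<nu>)"
      using assms by (simp add: powr_def Ln_of_real ln_inverse flip: of_real_inverse)
    ultimately show "beta_weight \<beta> \<beta> t * laplace_base (- Ln (of_real r)) t powr \<nu> =
       of_real r powr (- \<nu>) * (beta_weight \<beta> \<beta> t * (1 - (1 - of_real (r\<^sup>2)) * of_real t) powr \<nu>)"
      by simp
  qed
  then show ?thesis by (simp add: euler_kernel_def)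
qed

section \<open>The segment from x to 1\<close>

definition slit_halfplane :: "complex set" where
  "slit_halfplane = {x. Re x > 0} \<inter> cut_plane"

definition cayley :: "complex \<Rightarrow> complex" where
  "cayley x = (1 - x) / (1 + x)"

text \<open>With the parameter in a fixed interval, the singularities at \<open>t = x\<close> and
  \<open>t = 1\<close> stay at \<open>w = 0\<close> and \<open>w = 1\<close> while \<open>x\<close>
  varies.\<close>

definition seg_pt :: "complex \<Rightarrow> real \<Rightarrow> complex" where
  "seg_pt x w = (1 - of_real w) * x + of_real w"

text \<open>This is \<open>(1 - t\<^sup>2) / (1 - x\<^sup>2)\<close> for \<open>t = seg_pt x w\<close>. Since \<open>cayley x\<close> lies in the unit disc for \<open>Re x > 0\<close>, the
  factored form shows that the ratio has positive real part and is comparable to \<open>1 - w\<close>.\<close>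
definition seg_ratio :: "complex \<Rightarrow> real \<Rightarrow> complex" where
  "seg_ratio x w = (1 - of_real w) * (1 + cayley x * of_real w)"

text \<open>The roots are separated as in \<open>G_arg\<close>. A priori the quotient could be the
  negative of the principal root of \<open>seg_ratio x w\<close>, so the sign of its real part needs
  an argument.\<close>

definition seg_root :: "complex \<Rightarrow> real \<Rightarrow> complex" where
  "seg_root x w = csqrt (1 - (seg_pt x w)\<^sup>2) / csqrt (1 - x\<^sup>2)"

lemma open_slit_halfplane: "open slit_halfplane"
  unfolding slit_halfplane_def by (intro open_Int open_halfspace_Re_gt open_cut_plane)

lemma slit_halfplane_iff: "x \<in> slit_halfplane \<longleftrightarrow> Re x > 0 \<and> (Im x = 0 \<longrightarrow> Re x < 1)"
  by (auto simp: slit_halfplane_def of_real_image_atLeast_1_iff complex_nonpos_Reals_iff)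

lemma square_slit: "Re z > 0 \<Longrightarrow> z\<^sup>2 \<notin> \<real>\<^sub>\<le>\<^sub>0"
  by (auto simp: complex_nonpos_Reals_iff power2_eq_square not_le)

lemma Re_csqrt_pos:
  assumes "z \<notin> \<real>\<^sub>\<le>\<^sub>0"
  shows "Re (csqrt z) > 0"
proof (rule ccontr)
  assume neg: "\<not> Re (csqrt z) > 0"
  define c where "c = csqrt z"
  have "Re c = 0" using csqrt_principal[of z] neg by (auto simp: c_def simp del: csqrt.simps)
  moreover have "c\<^sup>2 = z" by (simp add: c_def)
  ultimately have "z = - of_real ((Im c)\<^sup>2)" by (auto simp: complex_eq_iff power2_eq_square)
  with assms show False by (simp add: complex_nonpos_Reals_iff)
qed

lemma one_minus_square_slit:
  assumes "x \<in> slit_halfplane"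
  shows "1 - x\<^sup>2 \<notin> \<real>\<^sub>\<le>\<^sub>0"
proof
  assume "1 - x\<^sup>2 \<in> \<real>\<^sub>\<le>\<^sub>0"
  then have "1 \<le> Re (x\<^sup>2)" "Im (x\<^sup>2) = 0" by (auto simp: complex_nonpos_Reals_iff)
  then have "Im x = 0" "1 \<le> (Re x)\<^sup>2" using assms by (auto simp: slit_halfplane_iff power2_eq_square)
  moreover have "(Re x)\<^sup>2 < 1" using assms \<open>Im x = 0\<close> by (auto simp: slit_halfplane_iff power2_less_1_iff)
  ultimately show False by simp
qed

lemma one_minus_square_cut_plane: "Re t > 0 \<Longrightarrow> 1 - t\<^sup>2 \<in> cut_plane"
  using square_slit[of t] by (simp add: of_real_image_atLeast_1_iff)

lemma Re_seg_pt_pos: "Re x > 0 \<Longrightarrow> 0 \<le> w \<Longrightarrow> w \<le> 1 \<Longrightarrow> Re (seg_pt x w) > 0"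
  by (cases "w = 1") (auto simp: seg_pt_def intro!: add_pos_nonneg)

lemma seg_pt_slit_halfplane:
  assumes "x \<in> slit_halfplane" "0 \<le> w" "w < 1"
  shows "seg_pt x w \<in> slit_halfplane"
proof -
  have "Re (seg_pt x w) < 1" if "Im (seg_pt x w) = 0"
  proof -
    have "Im x = 0" using that assms by (auto simp: seg_pt_def)
    then have "(1 - w) * (1 - Re x) > 0" using assms by (auto simp: slit_halfplane_iff)
    then show ?thesis by (simp add: seg_pt_def algebra_simps)
  qed
  then show ?thesis using assms Re_seg_pt_pos[of x w] by (auto simp: slit_halfplane_iff)
qed

lemma one_plus_nonzero: "Re x > 0 \<Longrightarrow> 1 + x \<noteq> 0"
  by (auto simp: complex_eq_iff)

lemma norm_cayley_less_1:
  assumes "Re x > 0"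
  shows "norm (cayley x) < 1"
proof -
  have "norm (1 - x) ^ 2 < norm (1 + x) ^ 2"
    using assms unfolding cmod_power2 by (simp add: power2_eq_square algebra_simps)
  then have "norm (1 - x) < norm (1 + x)" by (rule power2_less_imp_less) simp
  then show ?thesis using one_plus_nonzero[OF assms] by (simp add: norm_divide cayley_def)
qed

text \<open>For \<open>t = seg_pt x w\<close> one has \<open>1 - t = (1 - w) * (1 - x)\<close> and
  \<open>1 + t = (1 + x) * (1 + cayley x * w)\<close>.\<close>

lemma one_minus_seg_pt_square:
  assumes "Re x > 0"
  shows "1 - (seg_pt x w)\<^sup>2 = (1 - x\<^sup>2) * seg_ratio x w"
  using one_plus_nonzero[OF assms] unfolding seg_pt_def seg_ratio_def cayley_def
  by (simp add: divide_simps) (simp add: power2_eq_square algebra_simps)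

text \<open>Displays the simple zero at \<open>w = 0\<close>, hence the double zero there of
  \<open>G\<close> squared minus one; the remaining factor stays away from \<open>0\<close>.\<close>

lemma one_minus_seg_ratio:
  "1 - seg_ratio x w = of_real w * (1 - cayley x * of_real (1 - w))"
  unfolding seg_ratio_def by (simp add: algebra_simps)

lemma Re_one_plus_pos: "norm z < 1 \<Longrightarrow> Re (1 + z) > 0"
  using abs_Re_le_cmod[of z] by simp

context
  fixes x :: complex and w :: real
  assumes x: "x \<in> slit_halfplane" and w: "0 < w" "w < 1"
begin

lemma Re_x_pos: "Re x > 0" using x by (simp add: slit_halfplane_iff)

lemma norm_cayley_mult_less: "0 \<le> s \<Longrightarrow> s \<le> 1 \<Longrightarrow> norm (cayley x * of_real s) < 1"
  using norm_cayley_less_1[OF Re_x_pos] by (simp add: norm_mult) (meson le_less_trans mult_left_le norm_ge_zero)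

lemma Re_seg_ratio_pos: "Re (seg_ratio x w) > 0"
proof -
  have "Re (seg_ratio x w) = (1 - w) * Re (1 + cayley x * of_real w)"
    unfolding seg_ratio_def by simp
  then show ?thesis using Re_one_plus_pos[OF norm_cayley_mult_less[of w]] w by simp
qed

lemma norm_seg_ratio_less: "norm (seg_ratio x w) < 1"
proof -
  have "norm (1 + cayley x * of_real w) \<le> 1 + norm (cayley x) * w"
    using norm_triangle_ineq[of 1 "cayley x * of_real w"] w by (simp add: norm_mult)
  also have "\<dots> \<le> 1 + w" using norm_cayley_less_1[OF Re_x_pos] w by simp
  finally have "norm (1 + cayley x * of_real w) \<le> 1 + w" .
  moreover have "norm (1 - complex_of_real w) = 1 - w"
    using norm_of_real[of "1 - w", where ?'a = complex] w by simp
  ultimately have "norm (seg_ratio x w) \<le> (1 - w) * (1 + w)"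
    unfolding seg_ratio_def norm_mult using w by (simp add: mult_left_mono)
  also have "\<dots> < 1" using w by (simp add: algebra_simps)
  finally show ?thesis .
qed

lemma seg_root_square: "(seg_root x w)\<^sup>2 = seg_ratio x w"
  using one_minus_seg_pt_square[OF Re_x_pos, of w] one_minus_square_slit[OF x]
  by (auto simp: seg_root_def power_divide)

text \<open>Taking imaginary parts of the squares shows that the two roots \<open>A\<close> and
  \<open>B\<close> have imaginary parts of equal sign, because \<open>Im t\<close> is a positive
  multiple of \<open>Im x\<close>. The real part of \<open>A\<close> times the conjugate of
  \<open>B\<close> is then at least \<open>Re A * Re B\<close>.\<close>

lemma Re_seg_root_pos: "Re (seg_root x w) > 0"
proof -
  define t where "t = seg_pt x w"
  have t: "t \<in> slit_halfplane" using x w by (auto simp: t_def intro: seg_pt_slit_halfplane)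
  define A B where "A = csqrt (1 - t\<^sup>2)" and "B = csqrt (1 - x\<^sup>2)"
  have AB: "Re A > 0" "Re B > 0"
    unfolding A_def B_def by (intro Re_csqrt_pos one_minus_square_slit t x)+
  have "A\<^sup>2 = 1 - t\<^sup>2" "B\<^sup>2 = 1 - x\<^sup>2" by (simp_all add: A_def B_def)
  then have "Re A * Im A = - (Re t * Im t)" "Re B * Im B = - (Re x * Im x)"
    by (simp_all add: complex_eq_iff power2_eq_square mult.commute)
  moreover have "Im t = (1 - w) * Im x" by (simp add: t_def seg_pt_def)
  ultimately have "(Re A * Re B) * (Im A * Im B) = Re t * Re x * (1 - w) * (Im x)\<^sup>2"
    by algebra
  also have "\<dots> \<ge> 0" using t Re_x_pos w by (auto simp: slit_halfplane_iff)
  finally have "Im A * Im B \<ge> 0" by (metis AB mult_pos_pos mult_pos_neg not_le)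
  moreover have "Re (A / B) = (Re A * Re B + Im A * Im B) / norm B ^ 2"
    by (simp add: Re_divide cmod_power2)
  moreover have "norm B > 0" using AB by auto
  ultimately show ?thesis using AB by (simp add: seg_root_def A_def[symmetric] B_def[symmetric] t_def[symmetric] add_pos_nonneg)
qed

lemma G_arg_seg_pt: "G_arg x (seg_pt x w) = cosh (- Ln (seg_root x w))"
proof -
  define A B where "A = csqrt (1 - (seg_pt x w)\<^sup>2)" and "B = csqrt (1 - x\<^sup>2)"
  have "A / B \<noteq> 0" using Re_seg_root_pos by (auto simp: seg_root_def A_def B_def)
  then have nz: "A \<noteq> 0" "B \<noteq> 0" by auto
  have "2 - x\<^sup>2 - (seg_pt x w)\<^sup>2 = A\<^sup>2 + B\<^sup>2" by (simp add: A_def B_def)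
  then have "G_arg x (seg_pt x w) = (A\<^sup>2 + B\<^sup>2) / (2 * (B * A))" by (simp add: G_arg_def A_def B_def)
  also have "\<dots> = (A / B + inverse (A / B)) / 2" using nz by (simp add: field_simps power2_eq_square)
  also have "A / B = seg_root x w" by (simp add: seg_root_def A_def B_def)
  finally show ?thesis by (simp only: minus_Ln_in_strip(3)[OF Re_seg_root_pos])
qed

lemma Re_G_arg_pos: "Re (G_arg x (seg_pt x w)) > 0"
  unfolding G_arg_seg_pt by (intro Re_cosh_pos minus_Ln_in_strip Re_seg_root_pos)

text \<open>The first form decides the branch of the power, as the square of a number in the right
  half-plane; the second gives the size in terms of \<open>seg_ratio\<close>.\<close>

lemma G_arg_square: "(G_arg x (seg_pt x w))\<^sup>2 - 1 = ((inverse (seg_root x w) - seg_root x w) / 2)\<^sup>2"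
  "(G_arg x (seg_pt x w))\<^sup>2 - 1 = (1 - seg_ratio x w)\<^sup>2 / (4 * seg_ratio x w)"
proof -
  have nz: "seg_root x w \<noteq> 0" using Re_seg_root_pos by auto
  have G: "G_arg x (seg_pt x w) = (seg_root x w + inverse (seg_root x w)) / 2"
    using minus_Ln_in_strip(3)[OF Re_seg_root_pos] by (simp add: G_arg_seg_pt)
  show "(G_arg x (seg_pt x w))\<^sup>2 - 1 = ((inverse (seg_root x w) - seg_root x w) / 2)\<^sup>2"
    unfolding G using nz by (simp add: field_simps power2_eq_square)
  show "(G_arg x (seg_pt x w))\<^sup>2 - 1 = (1 - seg_ratio x w)\<^sup>2 / (4 * seg_ratio x w)"
    unfolding G seg_root_square[symmetric] using nz by (simp add: field_simps power2_eq_square)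
qed

text \<open>Inversion divides the real part by the squared modulus, which is less than one.\<close>

lemma Re_inverse_seg_root_minus_pos: "Re (inverse (seg_root x w) - seg_root x w) > 0"
proof -
  have "norm (seg_root x w) ^ 2 < 1"
    using norm_seg_ratio_less by (simp flip: norm_power seg_root_square)
  then have n: "(Re (seg_root x w))\<^sup>2 + (Im (seg_root x w))\<^sup>2 < 1" by (simp add: cmod_power2)
  have "Re (seg_root x w) * ((Re (seg_root x w))\<^sup>2 + (Im (seg_root x w))\<^sup>2) < Re (seg_root x w)"
    using n Re_seg_root_pos by simp
  moreover have "(Re (seg_root x w))\<^sup>2 + (Im (seg_root x w))\<^sup>2 > 0"
    using Re_seg_root_pos by (simp add: add_pos_nonneg)
  moreover have "Re (inverse (seg_root x w)) = Re (seg_root x w) / ((Re (seg_root x w))\<^sup>2 + (Im (seg_root x w))\<^sup>2)"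
    by simp
  ultimately show ?thesis by (simp only: minus_complex.sel diff_gt_0_iff_gt pos_less_divide_eq)
qed

lemma G_arg_square_slit: "(G_arg x (seg_pt x w))\<^sup>2 - 1 \<notin> \<real>\<^sub>\<le>\<^sub>0"
  unfolding G_arg_square(1) using Re_inverse_seg_root_minus_pos by (intro square_slit) simp

end

section \<open>Majorants with real parameters\<close>

definition real_euler_kernel :: "real \<Rightarrow> real \<Rightarrow> real \<Rightarrow> real" where
  "real_euler_kernel s b q = integral\<^sup>L unit_borel (\<lambda>t. t powr (b - 1) * (1 - t) powr (b - 1) * (1 - (1 - q) * t) powr s)"

lemma one_minus_mult_pos: "q > 0 \<Longrightarrow> t \<in> {0..1} \<Longrightarrow> 0 < 1 - (1 - q) * (t::real)"
proof -
  assume "q > 0" "t \<in> {0..1}"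
  then have "0 < (1 - t) + q * t" by (cases "t = 1") (auto intro!: add_pos_nonneg)
  then show ?thesis by (simp add: algebra_simps)
qed

lemma euler_kernel_of_real_integrand:
  assumes "q > 0" "t \<in> {0<..<1}"
  shows "beta_weight (of_real b) (of_real b) t * (1 - (1 - of_real q) * of_real t) powr (of_real s) =
           complex_of_real (t powr (b - 1) * (1 - t) powr (b - 1) * (1 - (1 - q) * t) powr s)"
proof -
  have "0 < 1 - (1 - q) * t" using assms by (intro one_minus_mult_pos) auto
  then have "complex_of_real ((1 - (1 - q) * t) powr s) = (1 - (1 - of_real q) * of_real t) powr (of_real s)"
    by (subst powr_of_real[symmetric]) auto
  moreover have "complex_of_real (t powr (b - 1)) = of_real t powr (of_real b - 1)"
    "complex_of_real ((1 - t) powr (b - 1)) = of_real (1 - t) powr (of_real b - 1)"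
    using assms by (auto simp flip: powr_of_real)
  ultimately show ?thesis by (simp add: beta_weight_def)
qed

lemma integrable_real_euler_kernel_integrand:
  assumes "q > 0" "b > 0"
  shows "integrable unit_borel (\<lambda>t. t powr (b - 1) * (1 - t) powr (b - 1) * (1 - (1 - q) * t) powr s)"
proof -
  have "integrable unit_borel (\<lambda>t. beta_weight (of_real b) (of_real b) t * (1 - (1 - of_real q) * of_real t) powr (of_real s))"
  proof (rule integrable_beta_weight_continuous)
    show "continuous_on {0..1} (\<lambda>t. (1 - (1 - complex_of_real q) * of_real t) powr of_real s)"
    proof (intro continuous_on_powr_slit continuous_intros)
      fix t :: real assume "t \<in> {0..1}"
      from one_minus_mult_pos[OF assms(1) this]
      show "1 - (1 - complex_of_real q) * of_real t \<notin> \<real>\<^sub>\<le>\<^sub>0"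
        by (auto simp: complex_nonpos_Reals_iff)
    qed
  qed (use assms in auto)
  also have "?this \<longleftrightarrow> integrable unit_borel (\<lambda>t. complex_of_real (t powr (b - 1) * (1 - t) powr (b - 1) * (1 - (1 - q) * t) powr s))"
    by (intro Bochner_Integration.integrable_cong refl) (use euler_kernel_of_real_integrand[OF assms(1)] in auto)
  finally show ?thesis by (simp only: complex_of_real_integrable_eq)
qed

lemma euler_kernel_of_real:
  assumes "q > 0"
  shows "euler_kernel (of_real s) (of_real b) (of_real q) = of_real (real_euler_kernel s b q)"
proof -
  have "euler_kernel (of_real s) (of_real b) (of_real q) =
     integral\<^sup>L unit_borel (\<lambda>t. complex_of_real (t powr (b - 1) * (1 - t) powr (b - 1) * (1 - (1 - q) * t) powr s))"
    unfolding euler_kernel_def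
    by (intro Bochner_Integration.integral_cong refl) (use euler_kernel_of_real_integrand[OF assms] in auto)
  then show ?thesis by (simp only: integral_complex_of_real real_euler_kernel_def)
qed

lemma integrable_unit_borel_reflect:
  fixes f :: "real \<Rightarrow> 'a :: {banach, second_countable_topology}"
  assumes "integrable unit_borel f"
  shows "integrable unit_borel (\<lambda>t. f (1 - t))"
proof -
  have "integrable lborel (\<lambda>t. indicator {0<..<1} t *\<^sub>R f t)"
    using assms by (simp add: integrable_restrict_space)
  from lborel_integrable_real_affine[OF this, of "-1" 1]
  have "integrable lborel (\<lambda>t. indicator {0<..<1} (1 - t) *\<^sub>R f (1 - t))" by simp
  also have "(\<lambda>t. indicator {0<..<1} (1 - t) *\<^sub>R f (1 - t)) = (\<lambda>t. indicator {0<..<1} t *\<^sub>R f (1 - t))"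
    by (auto simp: indicator_def)
  finally show ?thesis by (simp add: integrable_restrict_space)
qed

lemma integrable_real_euler_kernel:
  assumes "p > 0" "b > 0" "p + s + b > 0"
  shows "integrable unit_borel (\<lambda>q. q powr (p - 1) * (1 - q) powr (2 * b - 1) * real_euler_kernel s b q)"
proof -
  have "integrable unit_borel (\<lambda>q. beta_weight (of_real p) (2 * of_real b) q * euler_kernel (of_real s) (of_real b) (of_real q))"
    using assms by (intro euler_kernel_integral(1)) auto
  also have "?this \<longleftrightarrow> integrable unit_borel (\<lambda>q. complex_of_real (q powr (p - 1) * (1 - q) powr (2 * b - 1) * real_euler_kernel s b q))"
  proof (intro Bochner_Integration.integrable_cong refl)
    fix q assume "q \<in> space unit_borel"
    then have "complex_of_real (q powr (p - 1)) = of_real q powr (of_real p - 1)"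
      "complex_of_real ((1 - q) powr (2 * b - 1)) = of_real (1 - q) powr (2 * of_real b - 1)" "q > 0"
      by (auto simp flip: powr_of_real)
    then show "beta_weight (of_real p) (2 * of_real b) q * euler_kernel (of_real s) (of_real b) (of_real q) =
      complex_of_real (q powr (p - 1) * (1 - q) powr (2 * b - 1) * real_euler_kernel s b q)"
      by (simp add: beta_weight_def euler_kernel_of_real)
  qed
  finally show ?thesis by (simp only: complex_of_real_integrable_eq)
qed

lemma real_euler_kernel_nonneg: "real_euler_kernel s b q \<ge> 0"
  unfolding real_euler_kernel_def by (intro integral_nonneg_AE AE_I2) auto

text \<open>The upper bound on \<open>z\<close> is relevant for \<open>s \<ge> 0\<close>, the lower
  one for \<open>s < 0\<close>. Adding both constants gives one expression that is continuous in
  them for either sign.\<close>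

lemma powr_between_le:
  fixes c C v z s :: real
  assumes "0 < c" "c * v \<le> z" "z \<le> C * v" "v > 0" "0 < C"
  shows "z powr s \<le> (C powr s + c powr s) * v powr s"
proof -
  have z: "z > 0" using assms by (meson less_le_trans mult_pos_pos)
  show ?thesis
  proof (cases "s \<ge> 0")
    case True
    then have "z powr s \<le> (C * v) powr s" using assms z by (intro powr_mono2) auto
    also have "\<dots> = C powr s * v powr s" using assms by (simp add: powr_mult)
    finally show ?thesis by (simp add: algebra_simps add_increasing2)
  next
    case False
    then have "z powr s \<le> (c * v) powr s" using assms z by (intro powr_mono2') auto
    also have "\<dots> = c powr s * v powr s" using assms by (simp add: powr_mult)
    finally show ?thesis by (simp add: algebra_simps add_increasing)
  qed
qed

text \<open>For \<open>Re u \<ge> 0\<close> the mixed term in the squared modulus is nonnegative,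
  and a sum of two numbers is at most \<open>sqrt 2\<close> times the root of the sum of their
  squares.\<close>

lemma norm_convex_combination_ge:
  fixes u :: complex and t :: real
  assumes u: "Re u \<ge> 0" and t: "0 \<le> t" "t \<le> 1"
  shows "((1 - t) + norm u * t) / sqrt 2 \<le> norm (1 - (1 - u) * of_real t)"
proof -
  have e: "1 - (1 - u) * of_real t = of_real (1 - t) + u * of_real t" by (simp add: algebra_simps)
  have "norm (1 - (1 - u) * of_real t) ^ 2 = (1 - t)\<^sup>2 + 2 * ((1 - t) * t * Re u) + (norm u * t)\<^sup>2"
    unfolding e cmod_power2 power_mult_distrib by (simp add: power2_eq_square algebra_simps)
  moreover have "(1 - t) * t * Re u \<ge> 0" using assms by simp
  moreover have "0 \<le> ((1 - t) - norm u * t)\<^sup>2" by simp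
  ultimately have "((1 - t) + norm u * t)\<^sup>2 \<le> 2 * norm (1 - (1 - u) * of_real t) ^ 2"
    by (simp add: power2_eq_square algebra_simps)
  then have "((1 - t) + norm u * t)\<^sup>2 \<le> (sqrt 2 * norm (1 - (1 - u) * of_real t))\<^sup>2"
    by (simp add: power_mult_distrib)
  then have "(1 - t) + norm u * t \<le> sqrt 2 * norm (1 - (1 - u) * of_real t)"
    by (rule power2_le_imp_le) simp
  then show ?thesis by (simp add: divide_le_eq mult.commute)
qed

text \<open>The modulus of the complex base is compared with the real base at \<open>q\<close>, up
  to constants depending on \<open>m\<close>. In the application \<open>q = 1 - w\<close> and
  \<open>m = norm (1 + cayley x * of_real w)\<close>, so the remaining integral does not depend on
  \<open>x\<close>.\<close>

lemma laplace_integral_norm_bound: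
  assumes \<beta>: "Re \<beta> > 0" and \<rho>: "Re \<rho> > 0" and u: "u = \<rho>\<^sup>2" "Re u \<ge> 0" and q: "norm u = q * m" "0 < q" "q < 1" "0 < m"
  shows "norm (laplace_integral \<nu> \<beta> (- Ln \<rho>)) \<le>
     exp (pi * \<bar>Im \<nu>\<bar>) * norm u powr (- Re \<nu> / 2) * ((max 1 m) powr Re \<nu> + (min 1 m / sqrt 2) powr Re \<nu>) *
       real_euler_kernel (Re \<nu>) (Re \<beta>) q"
proof -
  define B where "B = (max 1 m) powr Re \<nu> + (min 1 m / sqrt 2) powr Re \<nu>"
  define A where "A = exp (pi * \<bar>Im \<nu>\<bar>) * norm u powr (- Re \<nu> / 2) * B"
  have \<rho>0: "norm \<rho> > 0" using \<rho> by auto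
  have pointwise: "norm (beta_weight \<beta> \<beta> t * laplace_base (- Ln \<rho>) t powr \<nu>) \<le>
      A * (t powr (Re \<beta> - 1) * (1 - t) powr (Re \<beta> - 1) * (1 - (1 - q) * t) powr Re \<nu>)" if t: "t \<in> {0<..<1}" for t
  proof -
    define v where "v = 1 - (1 - q) * t"
    have v: "v > 0" "v = (1 - t) + q * t" using one_minus_mult_pos[of q t] q t by (auto simp: v_def algebra_simps)
    define z where "z = norm (1 - (1 - u) * of_real t)"
    have lower: "min 1 m / sqrt 2 * v \<le> z"
    proof -
      have "min 1 m * v \<le> (1 - t) + norm u * t"
        unfolding v(2) q(1) using q t by (auto simp: distrib_left mult_ac intro!: add_mono mult_left_le)
      then have "min 1 m * v / sqrt 2 \<le> ((1 - t) + norm u * t) / sqrt 2" by (intro divide_right_mono) auto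
      also have "\<dots> \<le> z" unfolding z_def using u t by (intro norm_convex_combination_ge) auto
      finally show ?thesis by simp
    qed
    have upper: "z \<le> max 1 m * v"
    proof -
      have "z = norm (of_real (1 - t) + u * of_real t)" by (simp add: z_def algebra_simps)
      also have "\<dots> \<le> norm (complex_of_real (1 - t)) + norm (u * of_real t)" by (rule norm_triangle_ineq)
      also have "\<dots> = (1 - t) + q * m * t" using t by (simp only: norm_mult norm_of_real q(1)) simp
      also have "\<dots> \<le> max 1 m * (1 - t) + max 1 m * (q * t)"
      proof (rule add_mono)
        show "1 - t \<le> max 1 m * (1 - t)" using t mult_right_mono[of 1 "max 1 m" "1 - t"] by simp
        show "q * m * t \<le> max 1 m * (q * t)" using t q mult_right_mono[of m "max 1 m" "q * t"] by (simp add: mult_ac)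
      qed
      finally show ?thesis by (simp add: v(2) distrib_left)
    qed
    have "norm (laplace_base (- Ln \<rho>) t powr \<nu>) \<le> norm (laplace_base (- Ln \<rho>) t) powr Re \<nu> * exp (pi * \<bar>Im \<nu>\<bar>)"
      by (rule norm_powr_complex_le)
    also have "norm (laplace_base (- Ln \<rho>) t) = inverse (norm \<rho>) * z"
      unfolding laplace_base_minus_Ln[OF \<rho>] by (simp add: norm_mult norm_inverse z_def u(1))
    also have "(inverse (norm \<rho>) * z) powr Re \<nu> = inverse (norm \<rho>) powr Re \<nu> * z powr Re \<nu>"
      by (rule powr_mult)
    also have "inverse (norm \<rho>) powr Re \<nu> = norm u powr (- Re \<nu> / 2)"
    proof -
      have "norm u = norm \<rho> powr 2" using \<rho>0 by (simp add: u(1) norm_power powr_numeral)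
      then have "norm u powr (- Re \<nu> / 2) = norm \<rho> powr (- Re \<nu>)" by (simp only: powr_powr) simp
      then show ?thesis using \<rho>0 by (simp add: powr_minus inverse_powr)
    qed
    also have "z powr Re \<nu> \<le> B * v powr Re \<nu>"
      unfolding B_def by (rule powr_between_le) (use lower upper v q in auto)
    finally have "norm (laplace_base (- Ln \<rho>) t powr \<nu>) \<le> A * v powr Re \<nu>"
      by (simp add: A_def mult_left_mono mult_right_mono mult_ac)
    then have "norm (beta_weight \<beta> \<beta> t) * norm (laplace_base (- Ln \<rho>) t powr \<nu>) \<le> norm (beta_weight \<beta> \<beta> t) * (A * v powr Re \<nu>)"
      by (rule mult_left_mono) simp
    then show ?thesis
      unfolding v_def[symmetric] by (simp add: norm_mult norm_beta_weight[OF t] mult_ac)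
  qed
  have "norm (laplace_integral \<nu> \<beta> (- Ln \<rho>)) \<le> integral\<^sup>L unit_borel (\<lambda>t. A * (t powr (Re \<beta> - 1) * (1 - t) powr (Re \<beta> - 1) * (1 - (1 - q) * t) powr Re \<nu>))"
    unfolding laplace_integral_def
  proof (rule order_trans[OF integral_norm_bound integral_mono_AE'])
    show "integrable unit_borel (\<lambda>t. A * (t powr (Re \<beta> - 1) * (1 - t) powr (Re \<beta> - 1) * (1 - (1 - q) * t) powr Re \<nu>))"
      using \<beta> q by (intro integrable_mult_right integrable_real_euler_kernel_integrand) auto
  qed (use pointwise in \<open>auto intro!: AE_I2 order_trans[OF norm_ge_zero pointwise]\<close>)
  then show ?thesis by (simp add: real_euler_kernel_def A_def B_def)
qed

lemma continuous_on_csqrt_slit: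
  "continuous_on S f \<Longrightarrow> (\<And>z. z \<in> S \<Longrightarrow> f z \<notin> \<real>\<^sub>\<le>\<^sub>0) \<Longrightarrow> continuous_on S (\<lambda>z. csqrt (f z))"
  by (rule continuous_on_compose2[OF holomorphic_on_imp_continuous_on[OF holomorphic_on_csqrt]]) auto

section \<open>Domination and holomorphy of the integral over the segment\<close>

locale jacobi_params =
  fixes \<alpha> \<beta> \<gamma> :: complex
  assumes Re_\<beta>: "Re \<beta> > 0" and Re_\<beta>\<gamma>: "Re (\<beta> + \<gamma>) < 0" and Re_\<alpha>\<gamma>: "Re (\<alpha> + \<gamma>) > -1"
begin

abbreviation "\<nu> \<equiv> \<alpha> + 2 * \<gamma> + 1"
abbreviation "FJ \<equiv> hyp2F1_reg (- \<gamma>) (\<alpha> + \<beta> + \<gamma> + 1) (\<alpha> + 1)"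
abbreviation "FG \<equiv> hyp2F1_reg (- \<nu>) (2 * \<beta> + \<nu>) (\<beta> + 1 / 2)"

definition C_J :: complex where "C_J = Gamma (\<alpha> + \<gamma> + 1) / Gamma (\<gamma> + 1)"
definition C_G :: complex where "C_G = Gamma (2 * \<beta> + \<nu>) / (Gamma \<beta> ^ 2 * Gamma (\<nu> + 1))"

lemma FJ_holomorphic: "FJ holomorphic_on cut_plane"
  using hyp2F1_reg_continues[of "- \<gamma>" "\<alpha> + \<beta> + \<gamma> + 1" "\<alpha> + 1"] Re_\<beta> Re_\<beta>\<gamma>
  by (auto simp: continues_hyp2F1_def)

lemma FG_holomorphic: "FG holomorphic_on cut_plane"
proof -
  have "Re (- \<nu>) > 0 \<or> Re (2 * \<beta> + \<nu>) > 0" using Re_\<beta> by auto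
  then show ?thesis using hyp2F1_reg_continues unfolding continues_hyp2F1_def by blast
qed

lemma jacobi_P_eq: "jacobi_P \<gamma> \<alpha> \<beta> (2 * t\<^sup>2 - 1) = C_J * FJ (1 - t\<^sup>2)"
proof -
  have "(1 - (2 * t\<^sup>2 - 1)) / 2 = 1 - t\<^sup>2" by (simp add: field_simps)
  then show ?thesis by (simp only: jacobi_P_def C_J_def)
qed

definition seg_integrand :: "complex \<Rightarrow> real \<Rightarrow> complex" where
  "seg_integrand x w = jacobi_integrand \<alpha> \<beta> \<gamma> x (seg_pt x w) * (1 - x)"

lemma seg_integrand_holomorphic:
  assumes w: "w \<in> {0<..<1}"
  shows "(\<lambda>x. seg_integrand x w) holomorphic_on slit_halfplane"
proof -
  have w': "0 < w" "w < 1" using w by auto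
  have t: "(\<lambda>x. seg_pt x w) holomorphic_on slit_halfplane" unfolding seg_pt_def by (intro holomorphic_intros)
  have tD: "seg_pt x w \<in> slit_halfplane" if "x \<in> slit_halfplane" for x
    using that w by (intro seg_pt_slit_halfplane) auto
  have G: "(\<lambda>x. G_arg x (seg_pt x w)) holomorphic_on slit_halfplane"
    unfolding G_arg_def
    using one_minus_square_slit one_minus_square_slit[OF tD]
    by (intro holomorphic_intros t holomorphic_on_csqrt') force+
  have J: "(\<lambda>x. FJ (1 - (seg_pt x w)\<^sup>2)) holomorphic_on slit_halfplane"
    by (rule holomorphic_on_compose_gen[OF _ FJ_holomorphic, unfolded o_def])
       (intro holomorphic_intros t, intro image_subsetI one_minus_square_cut_plane, use tD in \<open>simp add: slit_halfplane_iff\<close>)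
  have Gg: "(\<lambda>x. FG ((1 - G_arg x (seg_pt x w)) / 2)) holomorphic_on slit_halfplane"
    by (rule holomorphic_on_compose_gen[OF _ FG_holomorphic, unfolded o_def])
       (intro holomorphic_intros G, simp, intro image_subsetI half_one_minus_in_cut_plane Re_G_arg_pos w', simp_all)
  show ?thesis
    unfolding seg_integrand_def jacobi_integrand_def jacobi_P_eq gegenbauer_C_def
    by (intro holomorphic_intros J G Gg t one_minus_square_slit tD G_arg_square_slit w')
qed

lemma seg_integrand_continuous:
  assumes x: "x \<in> slit_halfplane"
  shows "continuous_on {0<..<1} (seg_integrand x)"
proof -
  have t: "continuous_on {0<..<1} (seg_pt x)" unfolding seg_pt_def by (intro continuous_intros)
  have tD: "seg_pt x w \<in> slit_halfplane" if "w \<in> {0<..<1}" for w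
    using that x by (intro seg_pt_slit_halfplane) auto
  have G: "continuous_on {0<..<1} (\<lambda>w. G_arg x (seg_pt x w))"
    unfolding G_arg_def
    using one_minus_square_slit[OF x] one_minus_square_slit[OF tD]
    by (intro continuous_intros t continuous_on_csqrt_slit) force+
  have J: "continuous_on {0<..<1} (\<lambda>w. FJ (1 - (seg_pt x w)\<^sup>2))"
    by (rule continuous_on_compose2[OF holomorphic_on_imp_continuous_on[OF FJ_holomorphic]])
       (intro continuous_intros t, intro image_subsetI one_minus_square_cut_plane, use tD in \<open>simp add: slit_halfplane_iff\<close>)
  have Gg: "continuous_on {0<..<1} (\<lambda>w. FG ((1 - G_arg x (seg_pt x w)) / 2))"
    by (rule continuous_on_compose2[OF holomorphic_on_imp_continuous_on[OF FG_holomorphic]])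
       (intro continuous_intros G, simp, intro image_subsetI half_one_minus_in_cut_plane Re_G_arg_pos x, simp_all)
  show ?thesis
    unfolding seg_integrand_def[abs_def] jacobi_integrand_def jacobi_P_eq gegenbauer_C_def
    by (intro continuous_on_mult continuous_on_const continuous_on_powr_slit J Gg t continuous_on_diff continuous_on_power G
         one_minus_square_slit tD G_arg_square_slit x) auto
qed

text \<open>Collects the factors of the estimate that vary with \<open>x\<close>, and constants.
  Since \<open>norm (cayley x) < 1\<close>, every base of a power here stays positive up to
  \<open>w = 0\<close> and \<open>w = 1\<close>, which gives continuity on the closed interval and
  hence bounds that are locally uniform in \<open>x\<close>. The exponentials stem from
  \<open>norm_powr_complex_le\<close>.\<close>

definition seg_const :: "complex \<Rightarrow> real \<Rightarrow> real" where
  "seg_const x w = norm (C_J * FJ (1 - (seg_pt x w)\<^sup>2) * seg_pt x w) * norm (1 - x) *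
     (norm (1 - x\<^sup>2) * norm (1 + cayley x * of_real w)) powr Re ((\<alpha> - 2) / 2) *
     ((norm (1 - cayley x * of_real (1 - w)))\<^sup>2 / (4 * norm (1 + cayley x * of_real w))) powr Re (\<beta> - 1 / 2) *
     norm (1 + cayley x * of_real w) powr (- Re \<nu> / 2) *
     ((max 1 (norm (1 + cayley x * of_real w))) powr Re \<nu> + (min 1 (norm (1 + cayley x * of_real w)) / sqrt 2) powr Re \<nu>) *
     (exp (pi * \<bar>Im ((\<alpha> - 2) / 2)\<bar>) * exp (pi * \<bar>Im (\<beta> - 1 / 2)\<bar>) * norm C_G * exp (pi * \<bar>Im \<nu>\<bar>))"

text \<open>Up to a factor bounded locally in \<open>x\<close>, the dominating function is the integrand for the real parts of the
  parameters, whose integrability is already contained in the moment formula.\<close>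
definition seg_weight :: "real \<Rightarrow> real" where
  "seg_weight w = (1 - w) powr (- Re (\<beta> + \<gamma>) - 1) * w powr (2 * Re \<beta> - 1) * real_euler_kernel (Re \<nu>) (Re \<beta>) (1 - w)"

lemma integrable_seg_weight: "integrable unit_borel seg_weight"
proof -
  have "integrable unit_borel (\<lambda>q. q powr (- Re (\<beta> + \<gamma>) - 1) * (1 - q) powr (2 * Re \<beta> - 1) * real_euler_kernel (Re \<nu>) (Re \<beta>) q)"
    using Re_\<beta> Re_\<beta>\<gamma> Re_\<alpha>\<gamma> by (intro integrable_real_euler_kernel) auto
  from integrable_unit_borel_reflect[OF this] show ?thesis by (simp add: seg_weight_def[abs_def])
qed

lemma seg_weight_nonneg: "seg_weight w \<ge> 0"
  by (simp add: seg_weight_def real_euler_kernel_nonneg)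

lemma cayley_nonzero:
  assumes "Re x > 0" "0 \<le> w" "w \<le> 1"
  shows "1 + cayley x * of_real w \<noteq> 0" "1 - cayley x * of_real w \<noteq> 0"
proof -
  have "norm (cayley x * of_real w) < 1"
    using norm_cayley_less_1[OF assms(1)] assms(2,3) by (simp add: norm_mult) (meson le_less_trans mult_left_le norm_ge_zero)
  then have "cayley x * of_real w \<noteq> - 1" "cayley x * of_real w \<noteq> 1"
    by (metis norm_minus_cancel norm_one less_irrefl)+
  then show "1 + cayley x * of_real w \<noteq> 0" "1 - cayley x * of_real w \<noteq> 0"
    by (simp_all add: add_eq_0_iff)
qed

lemma seg_const_continuous: "continuous_on (slit_halfplane \<times> {0..1}) (\<lambda>(x, w). seg_const x w)"
proof -
  let ?S = "slit_halfplane \<times> {0..1::real}"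
  have Re: "Re (fst p) > 0" if "p \<in> ?S" for p using that by (auto simp: slit_halfplane_iff)
  have c: "continuous_on ?S (\<lambda>p. cayley (fst p))"
    unfolding cayley_def using one_plus_nonzero[OF Re] by (intro continuous_intros) auto
  have t: "continuous_on ?S (\<lambda>p. seg_pt (fst p) (snd p))"
    unfolding seg_pt_def by (intro continuous_intros)
  have J: "continuous_on ?S (\<lambda>p. FJ (1 - (seg_pt (fst p) (snd p))\<^sup>2))"
    by (rule continuous_on_compose2[OF holomorphic_on_imp_continuous_on[OF FJ_holomorphic]])
       (intro continuous_intros t, intro image_subsetI one_minus_square_cut_plane Re_seg_pt_pos, auto simp: slit_halfplane_iff)
  define m3 where "m3 p = norm (1 + cayley (fst p) * of_real (snd p))" for p :: "complex \<times> real"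
  define m2 where "m2 p = norm (1 - cayley (fst p) * of_real (1 - snd p))" for p :: "complex \<times> real"
  define Y where "Y p = norm (1 - (fst p)\<^sup>2)" for p :: "complex \<times> real"
  have m: "continuous_on ?S m3" "continuous_on ?S m2" "continuous_on ?S Y"
    unfolding m3_def m2_def Y_def by (intro continuous_intros c)+
  have pos: "m3 p > 0" "m2 p > 0" "Y p > 0" if "p \<in> ?S" for p
  proof -
    have p: "0 \<le> snd p" "snd p \<le> 1" "0 \<le> 1 - snd p" "1 - snd p \<le> 1" "fst p \<in> slit_halfplane" using that by auto
    show "m3 p > 0" unfolding m3_def zero_less_norm_iff by (rule cayley_nonzero(1)[OF Re[OF that] p(1,2)])
    show "m2 p > 0" unfolding m2_def zero_less_norm_iff by (rule cayley_nonzero(2)[OF Re[OF that] p(3,4)])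
    have "1 - (fst p)\<^sup>2 \<noteq> 0" using one_minus_square_slit[OF p(5)] by (metis nonpos_Reals_zero_I)
    then show "Y p > 0" unfolding Y_def zero_less_norm_iff .
  qed
  have nz': "Y p * m3 p \<noteq> 0" "(m2 p)\<^sup>2 / (4 * m3 p) \<noteq> 0" "m3 p \<noteq> 0" "4 * m3 p \<noteq> 0"
    "max 1 (m3 p) \<noteq> 0" "min 1 (m3 p) / sqrt 2 \<noteq> 0" if p: "p \<in> ?S" for p
    using pos[OF p] by (auto simp: min_def max_def)
  have nz: "\<forall>p\<in>?S. Y p * m3 p \<noteq> 0" "\<forall>p\<in>?S. (m2 p)\<^sup>2 / (4 * m3 p) \<noteq> 0" "\<forall>p\<in>?S. m3 p \<noteq> 0" "\<forall>p\<in>?S. 4 * m3 p \<noteq> 0"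
    "\<forall>p\<in>?S. max 1 (m3 p) \<noteq> 0" "\<forall>p\<in>?S. min 1 (m3 p) / sqrt 2 \<noteq> 0" "\<forall>p\<in>?S. sqrt 2 \<noteq> (0::real)"
    by (intro ballI nz', assumption)+ simp
  have "continuous_on ?S (\<lambda>p. norm (C_J * FJ (1 - (seg_pt (fst p) (snd p))\<^sup>2) * seg_pt (fst p) (snd p)) * norm (1 - fst p) *
     (Y p * m3 p) powr Re ((\<alpha> - 2) / 2) * ((m2 p)\<^sup>2 / (4 * m3 p)) powr Re (\<beta> - 1 / 2) * m3 p powr (- Re \<nu> / 2) *
     ((max 1 (m3 p)) powr Re \<nu> + (min 1 (m3 p) / sqrt 2) powr Re \<nu>) *
     (exp (pi * \<bar>Im ((\<alpha> - 2) / 2)\<bar>) * exp (pi * \<bar>Im (\<beta> - 1 / 2)\<bar>) * norm C_G * exp (pi * \<bar>Im \<nu>\<bar>)))"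
    by (intro continuous_on_mult continuous_on_const continuous_on_powr continuous_on_add continuous_on_divide
          continuous_on_max continuous_on_min continuous_on_norm continuous_on_diff continuous_on_power m J t
          continuous_on_fst continuous_on_id nz)
  then show ?thesis
    unfolding case_prod_unfold seg_const_def m3_def m2_def Y_def .
qed

lemma norm_seg_integrand_le:
  assumes x: "x \<in> slit_halfplane" and w: "w \<in> {0<..<1}"
  shows "norm (seg_integrand x w) \<le> seg_const x w * seg_weight w"
proof -
  have w': "0 < w" "w < 1" and Rx: "Re x > 0" using w x by (auto simp: slit_halfplane_iff)
  define m3 where "m3 = norm (1 + cayley x * of_real w)"
  define m2 where "m2 = norm (1 - cayley x * of_real (1 - w))"
  have m: "m3 > 0" "m2 > 0"
    using cayley_nonzero[OF Rx, of w] cayley_nonzero[OF Rx, of "1 - w"] w by (auto simp: m3_def m2_def simp del: of_real_diff)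
  define Y where "Y = norm (1 - x\<^sup>2)"
  have nu: "norm (seg_ratio x w) = (1 - w) * m3"
    unfolding seg_ratio_def m3_def norm_mult using w' norm_of_real[of "1 - w", where ?'a = complex] by simp
  have nt: "norm (1 - (seg_pt x w)\<^sup>2) = (Y * m3) * (1 - w)"
    unfolding one_minus_seg_pt_square[OF Rx] norm_mult nu by (simp add: Y_def mult_ac)
  have nG: "norm ((G_arg x (seg_pt x w))\<^sup>2 - 1) = (m2\<^sup>2 / (4 * m3)) * (w powr 2 * inverse (1 - w))"
  proof -
    have "norm (1 - seg_ratio x w) = w * m2"
      unfolding one_minus_seg_ratio norm_mult m2_def using w' by simp
    then show ?thesis
      unfolding G_arg_square(2)[OF x w'] norm_divide norm_mult norm_power nu using w' m
      by (simp add: powr_numeral field_simps power2_eq_square)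
  qed
  have Y: "Y > 0" using one_minus_square_slit[OF x] by (auto simp: Y_def)
  have 1: "norm ((1 - (seg_pt x w)\<^sup>2) powr ((\<alpha> - 2) / 2)) \<le>
     (Y * m3) powr Re ((\<alpha> - 2) / 2) * (1 - w) powr Re ((\<alpha> - 2) / 2) * exp (pi * \<bar>Im ((\<alpha> - 2) / 2)\<bar>)"
    using norm_powr_complex_le[of "1 - (seg_pt x w)\<^sup>2" "(\<alpha> - 2) / 2"] w' m Y
    unfolding nt by (subst (asm) powr_mult) auto
  have 2: "norm (((G_arg x (seg_pt x w))\<^sup>2 - 1) powr (\<beta> - 1 / 2)) \<le>
     (m2\<^sup>2 / (4 * m3)) powr Re (\<beta> - 1 / 2) * (w powr (2 * Re (\<beta> - 1 / 2)) * (1 - w) powr (- Re (\<beta> - 1 / 2))) * exp (pi * \<bar>Im (\<beta> - 1 / 2)\<bar>)"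
  proof -
    have "(w powr 2 * inverse (1 - w)) powr s = w powr (2 * s) * (1 - w) powr (- s)" for s
    proof -
      have "inverse (1 - w) powr s = (1 - w) powr (- s)"
        using w' by (simp add: powr_minus inverse_powr)
      then show ?thesis by (simp only: powr_mult powr_powr)
    qed
    then show ?thesis
      using norm_powr_complex_le[of "(G_arg x (seg_pt x w))\<^sup>2 - 1" "\<beta> - 1 / 2"] w' m
      unfolding nG by (subst (asm) powr_mult) auto
  qed
  define B where "B = (max 1 m3) powr Re \<nu> + (min 1 m3 / sqrt 2) powr Re \<nu>"
  have 3: "norm (gegenbauer_C \<nu> \<beta> (G_arg x (seg_pt x w))) \<le> norm C_G * (exp (pi * \<bar>Im \<nu>\<bar>) *
      ((1 - w) powr (- Re \<nu> / 2) * m3 powr (- Re \<nu> / 2)) * B * real_euler_kernel (Re \<nu>) (Re \<beta>) (1 - w))"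
  proof -
    have "gegenbauer_C \<nu> \<beta> (G_arg x (seg_pt x w)) = C_G * laplace_integral \<nu> \<beta> (- Ln (seg_root x w))"
      unfolding G_arg_seg_pt[OF x w'] C_G_def by (rule gegenbauer_C_cosh[OF Re_\<beta> minus_Ln_in_strip(1)[OF Re_seg_root_pos[OF x w']]])
    moreover have "norm (laplace_integral \<nu> \<beta> (- Ln (seg_root x w))) \<le> exp (pi * \<bar>Im \<nu>\<bar>) *
      norm (seg_ratio x w) powr (- Re \<nu> / 2) * ((max 1 m3) powr Re \<nu> + (min 1 m3 / sqrt 2) powr Re \<nu>) * real_euler_kernel (Re \<nu>) (Re \<beta>) (1 - w)"
      by (rule laplace_integral_norm_bound[OF Re_\<beta> Re_seg_root_pos[OF x w']])
         (use seg_root_square[OF x w'] Re_seg_ratio_pos[OF x w'] nu w' m in auto)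
    moreover have "norm (seg_ratio x w) powr (- Re \<nu> / 2) = (1 - w) powr (- Re \<nu> / 2) * m3 powr (- Re \<nu> / 2)"
      unfolding nu using w' m by (subst powr_mult) auto
    ultimately show ?thesis by (simp add: norm_mult mult_left_mono B_def)
  qed
  define J where "J = norm (C_J * FJ (1 - (seg_pt x w)\<^sup>2) * seg_pt x w)"
  have "norm (seg_integrand x w) = J * norm ((1 - (seg_pt x w)\<^sup>2) powr ((\<alpha> - 2) / 2)) * norm (((G_arg x (seg_pt x w))\<^sup>2 - 1) powr (\<beta> - 1 / 2))
      * norm (gegenbauer_C \<nu> \<beta> (G_arg x (seg_pt x w))) * norm (1 - x)"
    unfolding seg_integrand_def jacobi_integrand_def jacobi_P_eq J_def norm_mult by (simp only: mult_ac)
  also have "\<dots> \<le> J * ((Y * m3) powr Re ((\<alpha> - 2) / 2) * (1 - w) powr Re ((\<alpha> - 2) / 2) * exp (pi * \<bar>Im ((\<alpha> - 2) / 2)\<bar>)) *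
     ((m2\<^sup>2 / (4 * m3)) powr Re (\<beta> - 1 / 2) * (w powr (2 * Re (\<beta> - 1 / 2)) * (1 - w) powr (- Re (\<beta> - 1 / 2))) * exp (pi * \<bar>Im (\<beta> - 1 / 2)\<bar>)) *
     (norm C_G * (exp (pi * \<bar>Im \<nu>\<bar>) * ((1 - w) powr (- Re \<nu> / 2) * m3 powr (- Re \<nu> / 2)) * B * real_euler_kernel (Re \<nu>) (Re \<beta>) (1 - w))) * norm (1 - x)"
    using 1 2 3 real_euler_kernel_nonneg by (intro mult_mono) (auto simp: J_def B_def intro!: mult_nonneg_nonneg)
  also have "\<dots> = seg_const x w * (((1 - w) powr Re ((\<alpha> - 2) / 2) * (1 - w) powr (- Re (\<beta> - 1 / 2)) * (1 - w) powr (- Re \<nu> / 2)) *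
      w powr (2 * Re (\<beta> - 1 / 2)) * real_euler_kernel (Re \<nu>) (Re \<beta>) (1 - w))"
    unfolding seg_const_def J_def[symmetric] Y_def[symmetric] m3_def[symmetric] m2_def[symmetric] B_def[symmetric] by (simp only: mult_ac)
  \<comment> \<open>The contributions of \<open>\<alpha>\<close> cancel between the explicit power
    and the Gegenbauer function. What remains is the exponent of the Beta weight with first
    parameter \<open>- \<beta> - \<gamma>\<close>.\<close>
  also have "(1 - w) powr Re ((\<alpha> - 2) / 2) * (1 - w) powr (- Re (\<beta> - 1 / 2)) * (1 - w) powr (- Re \<nu> / 2) = (1 - w) powr (- Re (\<beta> + \<gamma>) - 1)"
  proof -
    have "Re ((\<alpha> - 2) / 2) + - Re (\<beta> - 1 / 2) + - Re \<nu> / 2 = - Re (\<beta> + \<gamma>) - 1"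
      by (simp add: field_simps)
    then show ?thesis by (simp only: powr_add[symmetric])
  qed
  also have "2 * Re (\<beta> - 1 / 2) = 2 * Re \<beta> - 1" by simp
  finally show ?thesis by (simp add: seg_weight_def)
qed

lemma seg_integrand_dominated:
  assumes "x \<in> slit_halfplane"
  shows "\<exists>e>0. \<exists>g. integrable unit_borel g \<and> cball x e \<subseteq> slit_halfplane \<and>
           (\<forall>x'\<in>cball x e. \<forall>w\<in>space unit_borel. norm (seg_integrand x' w) \<le> (g w :: real))"
proof -
  obtain e where e: "e > 0" "cball x e \<subseteq> slit_halfplane"
    using open_contains_cball[of slit_halfplane] open_slit_halfplane assms by blast
  have "compact (cball x e \<times> {0..1::real})" by (intro compact_Times) auto
  then have "bounded ((\<lambda>(x, w). seg_const x w) ` (cball x e \<times> {0..1}))"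
    by (intro compact_imp_bounded compact_continuous_image continuous_on_subset[OF seg_const_continuous]) (use e in auto)
  then obtain B where B: "\<And>x' w. x' \<in> cball x e \<Longrightarrow> w \<in> {0..1} \<Longrightarrow> norm (seg_const x' w) \<le> B"
    unfolding bounded_iff by fast
  show ?thesis
  proof (intro exI conjI ballI)
    show "integrable unit_borel (\<lambda>w. B * seg_weight w)" by (intro integrable_mult_right integrable_seg_weight)
    fix x' w assume x': "x' \<in> cball x e" "w \<in> space unit_borel"
    have "norm (seg_integrand x' w) \<le> seg_const x' w * seg_weight w"
      using x' e by (intro norm_seg_integrand_le) auto
    also have "\<dots> \<le> B * seg_weight w"
      using B[of x' w] x' seg_weight_nonneg by (intro mult_right_mono) auto
    finally show "norm (seg_integrand x' w) \<le> B * seg_weight w" .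
  qed (use e in auto)
qed

lemma integrable_seg_integrand: "x \<in> slit_halfplane \<Longrightarrow> integrable unit_borel (seg_integrand x)"
  by (rule integrable_parametric_integral[OF open_slit_halfplane _ _ seg_integrand_dominated])
     (simp_all add: seg_integrand_holomorphic measurable_unit_borel seg_integrand_continuous)

lemma seg_integral_holomorphic: "(\<lambda>x. integral\<^sup>L unit_borel (seg_integrand x)) holomorphic_on slit_halfplane"
  by (rule holomorphic_parametric_integral[OF open_slit_halfplane _ _ seg_integrand_dominated])
     (simp_all add: seg_integrand_holomorphic measurable_unit_borel seg_integrand_continuous)

end

lemma connected_slit_halfplane: "connected slit_halfplane"
proof (rule starlike_imp_connected)
  show "starlike slit_halfplane"
    unfolding starlike_def
  proof (intro bexI[of _ "1 / 2"] ballI subsetI)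
    fix x y :: complex assume x: "x \<in> slit_halfplane" and "y \<in> closed_segment (1 / 2) x"
    then obtain s where s: "0 \<le> s" "s \<le> 1" "y = (1 - s) *\<^sub>R (1 / 2) + s *\<^sub>R x"
      by (auto simp: closed_segment_def)
    have Re: "Re y = (1 - s) * (1 / 2) + s * Re x" and Im: "Im y = s * Im x" by (simp_all add: s(3))
    have "Re y > 0"
      unfolding Re using s x by (cases "s = 0") (auto simp: slit_halfplane_iff intro!: add_nonneg_pos)
    moreover have "Re y < 1" if "Im y = 0"
    proof (cases "s = 0")
      case False
      then have "s * Re x < s * 1" using that x s Im by (intro mult_strict_left_mono) (auto simp: slit_halfplane_iff)
      then have "Re y < (1 - s) * (1 / 2) + s * 1" unfolding Re by simp
      also have "\<dots> \<le> 1" using s by (simp add: field_simps)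
      finally show ?thesis .
    qed (simp add: Re)
    ultimately show "y \<in> slit_halfplane" by (simp add: slit_halfplane_iff)
  qed (simp add: slit_halfplane_iff)
qed

lemma of_real_powr_exp: "s > 0 \<Longrightarrow> complex_of_real s powr z = exp (z * of_real (ln s))"
  by (simp add: powr_def Ln_of_real)

text \<open>Reflection formula in a form whose value does not depend on \<open>z\<close>: the
  instances \<open>\<gamma>\<close> and \<open>\<beta> + \<gamma>\<close> will have quotient
  one.\<close>

lemma sin_Gamma_Gamma_minus:
  fixes z :: complex
  assumes "sin (of_real pi * z) \<noteq> 0"
  shows "sin (of_real pi * z) * Gamma (z + 1) * Gamma (- z) = - of_real pi"
proof -
  have "Gamma (- z) * Gamma (z + 1) = of_real pi / sin (of_real pi * (- z))"
    using Gamma_reflection_complex[of "- z"] by (simp add: add.commute)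
  then show ?thesis using assms by (simp add: field_simps)
qed

context jacobi_params
begin

lemma has_contour_integral_seg:
  assumes "x \<in> slit_halfplane"
  shows "(jacobi_integrand \<alpha> \<beta> \<gamma> x has_contour_integral integral\<^sup>L unit_borel (seg_integrand x)) (linepath x 1)"
proof -
  have i: "set_integrable lborel {0<..<1} (seg_integrand x)"
    using integrable_seg_integrand[OF assms] by (simp add: integrable_restrict_space set_integrable_def)
  have "(seg_integrand x has_integral integral {0<..<1} (seg_integrand x)) {0<..<1}"
    using set_borel_integral_eq_integral(1)[OF i] by (rule integrable_integral)
  also have "integral {0<..<1} (seg_integrand x) = integral\<^sup>L unit_borel (seg_integrand x)"
    using set_borel_integral_eq_integral(2)[OF i]
    by (simp add: integral_restrict_space set_lebesgue_integral_def)
  finally have "(seg_integrand x has_integral integral\<^sup>L unit_borel (seg_integrand x)) {0..1}"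
    by (simp add: has_integral_Icc_iff_Ioo)
  moreover have "seg_integrand x = (\<lambda>w. jacobi_integrand \<alpha> \<beta> \<gamma> x (linepath x 1 w) * (1 - x))"
    by (simp add: fun_eq_iff seg_integrand_def seg_pt_def linepath_def scaleR_conv_of_real)
  ultimately show ?thesis
    unfolding has_contour_integral_linepath by simp
qed

section \<open>The integral equation\<close>

definition u_integrand :: "real \<Rightarrow> real \<Rightarrow> complex" where
  "u_integrand y u = beta_weight (- \<beta> - \<gamma>) (2 * \<beta>) u * euler_kernel \<nu> \<beta> (of_real u) * FJ (of_real y * of_real u)"

text \<open>From \<open>t dt = - (y / 2) du\<close> one factor \<open>y\<close> completes the
  exponent \<open>(\<alpha> - 2) / 2\<close> to \<open>\<alpha> / 2\<close>, and the factor one half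
  completes \<open>4 powr (1 / 2 - \<beta>)\<close> to
  \<open>2 powr (- 2 * \<beta>)\<close>.\<close>

definition seg_factor :: "real \<Rightarrow> complex" where
  "seg_factor y = C_J * C_G * of_real y powr (\<alpha> / 2) * 2 powr (- 2 * \<beta>)"

text \<open>All bases are positive here, so every power is the exponential of a multiple of a real
  logarithm. The factor \<open>2 * ((1 - w) * r + w) / (1 + r)\<close> is the absolute value of the
  derivative of \<open>u\<close> with respect to \<open>w\<close>.\<close>

lemma seg_integrand_of_real:
  assumes r: "0 < r" "r < 1" and w: "0 < w" "w < 1"
  shows "seg_integrand (of_real r) w = seg_factor (1 - r\<^sup>2) *
     (of_real (2 * ((1 - w) * r + w) / (1 + r)) * u_integrand (1 - r\<^sup>2) ((1 - w) * (1 + (1 - r) / (1 + r) * w)))"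
proof -
  define x where "x = complex_of_real r"
  have x: "x \<in> slit_halfplane" using r by (simp add: x_def slit_halfplane_iff)
  define u where "u = (1 - w) * (1 + (1 - r) / (1 + r) * w)"
  define t where "t = (1 - w) * r + w"
  define y where "y = 1 - r\<^sup>2"
  have ratio: "seg_ratio x w = of_real u" by (simp add: seg_ratio_def u_def x_def cayley_def)
  have pt: "seg_pt x w = of_real t" by (simp add: seg_pt_def t_def x_def)
  have y: "y > 0" "y = (1 - r) * (1 + r)"
    using r by (simp add: y_def power_less_one_iff) (simp add: y_def power2_eq_square algebra_simps)
  have u: "0 < u" "u < 1"
    using Re_seg_ratio_pos[OF x w] norm_seg_ratio_less[OF x w] by (simp_all add: ratio)
  have t2: "1 - (seg_pt x w)\<^sup>2 = of_real (y * u)"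
  proof -
    have "Re x > 0" "1 - x\<^sup>2 = of_real y" using r by (simp_all add: x_def y_def)
    then show ?thesis using one_minus_seg_pt_square[of x w] by (simp add: ratio)
  qed
  have root: "seg_root x w = of_real (sqrt u)"
  proof -
    have "csqrt (of_real u) = seg_root x w"
      using seg_root_square[OF x w] Re_seg_root_pos[OF x w] by (intro csqrt_unique) (auto simp: ratio)
    then show ?thesis using u by (simp add: csqrt_of_real_nonneg)
  qed
  have G2: "(G_arg x (seg_pt x w))\<^sup>2 - 1 = of_real ((1 - u)\<^sup>2 / (4 * u))"
    using G_arg_square(2)[OF x w] by (simp add: ratio)
  have geg: "gegenbauer_C \<nu> \<beta> (G_arg x (seg_pt x w)) = C_G * (of_real (sqrt u) powr (- \<nu>) * euler_kernel \<nu> \<beta> (of_real u))"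
  proof -
    have "gegenbauer_C \<nu> \<beta> (G_arg x (seg_pt x w)) = C_G * laplace_integral \<nu> \<beta> (- Ln (seg_root x w))"
      unfolding G_arg_seg_pt[OF x w] C_G_def by (rule gegenbauer_C_cosh[OF Re_\<beta> minus_Ln_in_strip(1)[OF Re_seg_root_pos[OF x w]]])
    then show ?thesis unfolding root using u by (subst (asm) laplace_integral_of_real) auto
  qed
  define ly lu lv where "ly = complex_of_real (ln y)" and "lu = complex_of_real (ln u)" and "lv = complex_of_real (ln (1 - u))"
  define l2 where "l2 = complex_of_real (ln 2)"
  have p1: "of_real (y * u) powr z = exp (z * (ly + lu))" for z
    using y u by (subst of_real_powr_exp) (auto simp: ln_mult ly_def lu_def)
  have p2: "of_real ((1 - u)\<^sup>2 / (4 * u)) powr z = exp (z * (2 * lv - 2 * l2 - lu))" for z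
  proof -
    have "ln ((1 - u)\<^sup>2 / (4 * u)) = 2 * ln (1 - u) - (ln (2 ^ 2) + ln u)"
      using u by (simp add: ln_div ln_mult ln_realpow)
    also have "ln (2 ^ 2 :: real) = 2 * ln 2" by (subst ln_realpow) auto
    finally have "ln ((1 - u)\<^sup>2 / (4 * u)) = 2 * ln (1 - u) - 2 * ln 2 - ln u" by simp
    then show ?thesis using u by (subst of_real_powr_exp) (auto simp: lv_def l2_def lu_def)
  qed
  have p3: "of_real (sqrt u) powr z = exp (z * (lu / 2))" for z
    using u by (subst of_real_powr_exp) (auto simp: ln_sqrt lu_def)
  have p4: "beta_weight (- \<beta> - \<gamma>) (2 * \<beta>) u = exp ((- \<beta> - \<gamma> - 1) * lu + (2 * \<beta> - 1) * lv)"
    using u of_real_powr_exp[of u] of_real_powr_exp[of "1 - u"] by (simp add: beta_weight_def exp_add lu_def lv_def del: of_real_diff)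
  have p5: "of_real y powr z = exp (z * ly)" for z
    unfolding ly_def by (rule of_real_powr_exp[OF y(1)])
  have p6: "2 powr z = exp (z * l2)" for z :: complex using of_real_powr_exp[of 2 z] by (simp add: l2_def)
  have p7: "complex_of_real (2 * t / (1 + r)) = of_real t * (1 - x) * exp (l2 - ly)"
  proof -
    have "exp (l2 - ly) = of_real (2 / y)" using y by (simp add: l2_def ly_def exp_diff exp_of_real)
    moreover have "2 * t / (1 + r) = t * (1 - r) * (2 / y)"
      using r unfolding y(2) by (simp add: divide_simps)
    ultimately show ?thesis by (simp only: of_real_mult of_real_diff of_real_1 x_def)
  qed
  have "seg_integrand x w = C_J * FJ (of_real (y * u)) * of_real t * of_real (y * u) powr ((\<alpha> - 2) / 2) *
     of_real ((1 - u)\<^sup>2 / (4 * u)) powr (\<beta> - 1 / 2) * (C_G * (of_real (sqrt u) powr (- \<nu>) * euler_kernel \<nu> \<beta> (of_real u))) * (1 - x)"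
    unfolding seg_integrand_def jacobi_integrand_def jacobi_P_eq geg G2 t2 unfolding pt by (simp only: mult_ac)
  also have "\<dots> = C_J * C_G * euler_kernel \<nu> \<beta> (of_real u) * FJ (of_real (y * u)) * of_real t * (1 - x) *
      exp ((\<alpha> - 2) / 2 * (ly + lu) + (\<beta> - 1 / 2) * (2 * lv - 2 * l2 - lu) + (- \<nu>) * (lu / 2))"
    unfolding p1 p2 p3 exp_add by (simp only: mult_ac)
  \<comment> \<open>The term \<open>l2 - ly\<close> is kept apart because its exponential
    \<open>2 / y\<close> turns \<open>t * (1 - x)\<close> into the Jacobian.\<close>
  also have "(\<alpha> - 2) / 2 * (ly + lu) + (\<beta> - 1 / 2) * (2 * lv - 2 * l2 - lu) + (- \<nu>) * (lu / 2) =
      \<alpha> / 2 * ly + (- 2 * \<beta>) * l2 + (l2 - ly) + ((- \<beta> - \<gamma> - 1) * lu + (2 * \<beta> - 1) * lv)"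
    by (simp add: field_simps)
  also have "C_J * C_G * euler_kernel \<nu> \<beta> (of_real u) * FJ (of_real (y * u)) * of_real t * (1 - x) *
      exp (\<alpha> / 2 * ly + (- 2 * \<beta>) * l2 + (l2 - ly) + ((- \<beta> - \<gamma> - 1) * lu + (2 * \<beta> - 1) * lv)) =
      seg_factor y * (of_real (2 * t / (1 + r)) * u_integrand y u)"
    unfolding seg_factor_def u_integrand_def p4 p5 p6 p7 exp_add[of _ "_ + _"] exp_add[of _ "l2 - ly"] exp_add[of "\<alpha> / 2 * ly"]
    by (simp add: mult_ac)
  finally show ?thesis by (simp only: x_def y_def t_def u_def)
qed

lemma continuous_on_u_integrand:
  assumes y: "0 < y" "y < 1"
  shows "continuous_on {0<..<1} (u_integrand y)"
proof -
  have J: "continuous_on {0<..<1} (\<lambda>u. FJ (of_real y * of_real u))"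
  proof (rule continuous_on_compose2[OF holomorphic_on_imp_continuous_on[OF FJ_holomorphic]])
    show "(\<lambda>u. complex_of_real y * of_real u) ` {0<..<1} \<subseteq> cut_plane"
    proof (rule image_subsetI)
      fix u :: real assume "u \<in> {0<..<1}"
      then show "complex_of_real y * of_real u \<in> cut_plane"
        using y cut_plane_mult[of "of_real y" u] by (simp add: of_real_image_atLeast_1_iff complex_nonpos_Reals_iff mult.commute)
    qed
  qed (intro continuous_intros)
  have E: "continuous_on {0<..<1} (\<lambda>u. euler_kernel \<nu> \<beta> (complex_of_real u))"
  proof -
    have slit: "1 - (1 - z) * of_real t \<notin> \<real>\<^sub>\<le>\<^sub>0" if "Re z > 0" "t \<in> {0..1}" for z t
    proof -
      have "Re (1 - (1 - z) * of_real t) > 0" using one_minus_mult_pos[of "Re z" t] that by simp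
      then show ?thesis by (auto simp: complex_nonpos_Reals_iff)
    qed
    have "(euler_kernel \<nu> \<beta> has_field_derivative
        integral\<^sup>L unit_borel (\<lambda>t. beta_weight \<beta> \<beta> t * (\<nu> * of_real t * (1 - (1 - z) * of_real t) powr (\<nu> - 1)))) (at z)"
      if "z \<in> {z. Re z > 0}" for z
      unfolding euler_kernel_def
    proof (rule beta_weight_parametric_derivative[OF Re_\<beta> Re_\<beta> open_halfspace_Re_gt _ _ that])
      show "continuous_on ({z. Re z > 0} \<times> {0..1}) (\<lambda>(z, t). (1 - (1 - z) * complex_of_real t) powr \<nu>)"
        unfolding case_prod_unfold by (intro continuous_on_powr_slit continuous_intros slit) auto
      show "((\<lambda>z. (1 - (1 - z) * of_real t) powr \<nu>) has_field_derivative \<nu> * of_real t * (1 - (1 - z) * of_real t) powr (\<nu> - 1)) (at z)"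
        if "z \<in> {z. Re z > 0}" "t \<in> {0<..<1}" for z t
        using slit[of z t] that by (auto intro!: derivative_eq_intros)
    qed
    then have "continuous_on {z. Re z > 0} (euler_kernel \<nu> \<beta>)"
      by (intro continuous_at_imp_continuous_on) (auto intro: DERIV_isCont)
    then show ?thesis by (rule continuous_on_compose2) (auto intro!: continuous_intros)
  qed
  show ?thesis
    unfolding u_integrand_def[abs_def] by (intro continuous_on_mult continuous_on_beta_weight J E)
qed

lemma integrable_u_integrand:
  assumes y: "0 < y" "y < 1"
  shows "integrable unit_borel (u_integrand y)"
proof -
  have "continuous_on {0..1} (\<lambda>u. FJ (of_real y * of_real u))"
  proof (rule continuous_on_compose2[OF holomorphic_on_imp_continuous_on[OF FJ_holomorphic]])
    show "(\<lambda>u. complex_of_real y * of_real u) ` {0..1} \<subseteq> cut_plane"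
    proof (rule image_subsetI)
      fix u :: real assume "u \<in> {0..1}"
      then show "complex_of_real y * of_real u \<in> cut_plane"
        using y cut_plane_mult[of "of_real y" u] by (simp add: of_real_image_atLeast_1_iff complex_nonpos_Reals_iff mult.commute)
    qed
  qed (intro continuous_intros)
  then have "bounded ((\<lambda>u. FJ (of_real y * of_real u)) ` {0..1})"
    by (intro compact_imp_bounded compact_continuous_image) auto
  then obtain B where B: "\<And>u. u \<in> {0..1} \<Longrightarrow> norm (FJ (of_real y * of_real u)) \<le> B"
    unfolding bounded_iff by fast
  have "integrable unit_borel (\<lambda>u. beta_weight (- \<beta> - \<gamma>) (2 * \<beta>) u * euler_kernel \<nu> \<beta> (of_real u))"
    using Re_\<beta> Re_\<beta>\<gamma> Re_\<alpha>\<gamma> by (intro euler_kernel_integral(1)) auto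
  then have i: "integrable unit_borel (\<lambda>u. norm (beta_weight (- \<beta> - \<gamma>) (2 * \<beta>) u * euler_kernel \<nu> \<beta> (of_real u)) * B)"
    by (intro integrable_mult_left integrable_norm)
  show ?thesis
  proof (rule Bochner_Integration.integrable_bound[OF i])
    show "u_integrand y \<in> borel_measurable unit_borel"
      by (intro measurable_unit_borel continuous_on_u_integrand y)
    show "AE u in unit_borel. norm (u_integrand y u) \<le> norm (norm (beta_weight (- \<beta> - \<gamma>) (2 * \<beta>) u * euler_kernel \<nu> \<beta> (of_real u)) * B)"
    proof (rule AE_I2)
      fix u assume "u \<in> space unit_borel"
      then have "norm (FJ (of_real y * of_real u)) \<le> \<bar>B\<bar>" using B[of u] by auto
      then show "norm (u_integrand y u) \<le> norm (norm (beta_weight (- \<beta> - \<gamma>) (2 * \<beta>) u * euler_kernel \<nu> \<beta> (of_real u)) * B)"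
        by (auto simp: u_integrand_def norm_mult abs_mult intro!: mult_left_mono)
    qed
  qed
qed

lemma unit_borel_integral_eq_LBINT:
  "integral\<^sup>L unit_borel (f :: real \<Rightarrow> complex) = (LBINT x=ereal 0..ereal 1. f x)"
  by (simp add: interval_lebesgue_integral_def set_lebesgue_integral_def integral_restrict_space)

text \<open>The reflection \<open>s = 1 - w\<close> makes the substitution increasing:
  \<open>g' s\<close> is at least \<open>1 - k > 0\<close>. Integrability of the transformed
  integrand is inherited from \<open>seg_integrand\<close> by dividing by \<open>seg_factor\<close>,
  which is the purpose of \<open>nz\<close>.\<close>

lemma seg_integral_of_real:
  assumes r: "0 < r" "r < 1" and nz: "seg_factor (1 - r\<^sup>2) \<noteq> 0"
  shows "integral\<^sup>L unit_borel (seg_integrand (of_real r)) = seg_factor (1 - r\<^sup>2) * integral\<^sup>L unit_borel (u_integrand (1 - r\<^sup>2))"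
proof -
  define y where "y = 1 - r\<^sup>2"
  have y: "0 < y" "y < 1" using r by (auto simp: y_def power_less_one_iff abs_square_less_1)
  define k where "k = (1 - r) / (1 + r)"
  have k: "0 < k" "k < 1" using r by (auto simp: k_def)
  define g where "g s = s * (1 + k * (1 - s))" for s :: real
  define g' where "g' s = 1 + k - 2 * k * s" for s :: real
  have eq: "seg_integrand (of_real r) (1 - s) = seg_factor y * (g' s *\<^sub>R u_integrand y (g s))" if s: "0 < s" "s < 1" for s
  proof -
    have "2 * ((1 - (1 - s)) * r + (1 - s)) / (1 + r) = g' s"
      using r by (simp add: g'_def k_def divide_simps) (simp add: algebra_simps)
    moreover have "(1 - (1 - s)) * (1 + k * (1 - s)) = g s" by (simp add: g_def)
    ultimately show ?thesis
      using seg_integrand_of_real[OF r, of "1 - s"] s by (simp add: y_def k_def scaleR_conv_of_real)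
  qed
  have gpos: "0 < g s \<and> g s < 1" if "0 < s" "s < 1" for s
  proof -
    have "1 - g s = (1 - s) * (1 - k * s)" by (simp add: g_def algebra_simps)
    moreover have "k * s < 1" using k that by (meson less_trans mult_less_cancel_left2 mult_strict_left_mono less_le_trans mult_left_le less_imp_le le_less_trans)
    ultimately have "1 - g s > 0" using that by simp
    moreover have "g s > 0" using that k by (simp add: g_def add_pos_nonneg)
    ultimately show ?thesis by simp
  qed
  have "integral\<^sup>L unit_borel (seg_integrand (of_real r)) = integral\<^sup>L unit_borel (\<lambda>s. seg_integrand (of_real r) (1 - s))"
    by (rule unit_borel_reflect_integral[symmetric])
  also have "\<dots> = integral\<^sup>L unit_borel (\<lambda>s. seg_factor y * (g' s *\<^sub>R u_integrand y (g s)))"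
    by (intro Bochner_Integration.integral_cong refl) (simp add: eq)
  also have "\<dots> = seg_factor y * integral\<^sup>L unit_borel (\<lambda>s. g' s *\<^sub>R u_integrand y (g s))"
    by (rule integral_mult_right_zero)
  also have "integral\<^sup>L unit_borel (\<lambda>s. g' s *\<^sub>R u_integrand y (g s)) = integral\<^sup>L unit_borel (u_integrand y)"
    unfolding unit_borel_integral_eq_LBINT
  proof (rule interval_integral_substitution_integrable[symmetric, where A = "ereal 0" and B = "ereal 1"])
    have "integrable unit_borel (\<lambda>s. seg_integrand (of_real r) (1 - s))"
      using r by (intro integrable_unit_borel_reflect integrable_seg_integrand) (simp add: slit_halfplane_iff)
    also have "?this \<longleftrightarrow> integrable unit_borel (\<lambda>s. seg_factor y * (g' s *\<^sub>R u_integrand y (g s)))"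
      by (intro Bochner_Integration.integrable_cong refl) (simp add: eq)
    finally have "integrable unit_borel (\<lambda>s. inverse (seg_factor y) * (seg_factor y * (g' s *\<^sub>R u_integrand y (g s))))"
      by (rule integrable_mult_right)
    then have "integrable unit_borel (\<lambda>s. g' s *\<^sub>R u_integrand y (g s))"
      using nz by (simp add: y_def mult.assoc[symmetric])
    then show "set_integrable lborel (einterval (ereal 0) (ereal 1)) (\<lambda>s. g' s *\<^sub>R u_integrand y (g s))"
      by (simp add: integrable_restrict_space set_integrable_def)
    show "set_integrable lborel (einterval (ereal 0) (ereal 1)) (u_integrand y)"
      using integrable_u_integrand[OF y] by (simp add: integrable_restrict_space set_integrable_def)
    show "(g has_real_derivative g' s) (at s)" for s
      unfolding g_def g'_def by (auto intro!: derivative_eq_intros simp: algebra_simps)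
    show "isCont (u_integrand y) (g s)" if "ereal 0 < ereal s" "ereal s < ereal 1" for s
      using continuous_on_u_integrand[OF y] gpos[of s] that by (auto simp: continuous_on_eq_continuous_at)
    show "isCont g' s" for s unfolding g'_def by (intro continuous_intros)
    show "0 \<le> g' s" if "ereal 0 \<le> ereal s" "ereal s \<le> ereal 1" for s
    proof -
      have "k * s \<le> k" using that k by (simp add: mult_left_le)
      moreover have "2 * k * s = 2 * (k * s)" by simp
      ultimately show ?thesis unfolding g'_def using k by linarith
    qed
    have "g 0 = 0" "g 1 = 1" by (simp_all add: g_def)
    have "isCont g z" for z unfolding g_def by (intro continuous_intros)
    then have "(g \<longlongrightarrow> g 0) (at_right 0)" "(g \<longlongrightarrow> g 1) (at_left 1)"
      by (auto intro: tendsto_mono[OF at_le isContD])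
    then show "((ereal \<circ> g \<circ> real_of_ereal) \<longlongrightarrow> ereal 0) (at_right (ereal 0))"
      "((ereal \<circ> g \<circ> real_of_ereal) \<longlongrightarrow> ereal 1) (at_left (ereal 1))"
      unfolding ereal_tendsto_simps1 using \<open>g 0 = 0\<close> \<open>g 1 = 1\<close> by (simp_all add: o_def)
  qed simp
  finally show ?thesis by (simp add: y_def)
qed

lemma u_integral:
  assumes r: "0 < r" "r < 1"
  shows "integral\<^sup>L unit_borel (u_integrand (1 - r\<^sup>2)) =
     (Gamma \<beta>)\<^sup>2 * Gamma (\<alpha> + \<gamma> + 1) * Gamma (- (\<beta> + \<gamma>)) * rGamma (\<alpha> + \<beta> + \<gamma> + 1) * rGamma (- \<gamma>) *
       of_real r powr (2 * \<beta>) * FJ (1 - (of_real r)\<^sup>2)"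
proof -
  have "0 < r\<^sup>2" "r\<^sup>2 < 1" using r by (simp_all add: power_less_one_iff)
  then have y: "norm (complex_of_real (1 - r\<^sup>2)) < 1" unfolding norm_of_real by simp
  have e: "(- \<beta> - \<gamma>) + \<beta> = - \<gamma>" "(\<alpha> + \<gamma> + 1) + \<beta> = \<alpha> + \<beta> + \<gamma> + 1"
    "- \<beta> - \<gamma> = - (\<beta> + \<gamma>)" by simp_all
  \<comment> \<open>The general formula is applied with \<open>a = \<alpha> + \<gamma> + 1\<close>,
    \<open>b = - \<beta> - \<gamma>\<close> and \<open>c = \<alpha> + 1\<close>. The relation
    between \<open>a\<close> and \<open>b\<close> forces the Gegenbauer degree to be
    \<open>\<alpha> + 2 * \<gamma> + 1\<close>.\<close>
  have a: "Re (\<alpha> + \<gamma> + 1) > 0" and b: "Re (- \<beta> - \<gamma>) > 0" using Re_\<alpha>\<gamma> Re_\<beta>\<gamma> by simp_all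
  have c: "\<alpha> + \<gamma> + 1 = - \<beta> - \<gamma> + \<nu> + \<beta>" "\<alpha> + 1 = \<alpha> + \<gamma> + 1 + (- \<beta> - \<gamma>) + \<beta>" by simp_all
  have "(1 - complex_of_real (1 - r\<^sup>2)) powr \<beta> = of_real r powr (2 * \<beta>)"
  proof -
    have "1 - complex_of_real (1 - r\<^sup>2) = of_real (r * r)" by (simp add: power2_eq_square)
    moreover have "complex_of_real (r * r) powr \<beta> = of_real r powr \<beta> * of_real r powr \<beta>"
      using r by (intro of_real_mult_powr) auto
    ultimately show ?thesis by (simp only: mult_2 powr_add)
  qed
  moreover have "complex_of_real (1 - r\<^sup>2) = 1 - (of_real r)\<^sup>2" by simp
  ultimately show ?thesis
    using kernel_integral_hyp2F1[OF a b Re_\<beta> y c]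
    unfolding u_integrand_def[abs_def] e by simp
qed

end

section \<open>Comparison of the constants and continuation in x\<close>

locale jacobi_regular = jacobi_params +
  assumes sin_\<gamma>: "sin (of_real pi * \<gamma>) \<noteq> 0"
    and regular: "\<gamma> + 1 \<notin> \<int>\<^sub>\<le>\<^sub>0" "\<alpha> + \<gamma> + 1 \<notin> \<int>\<^sub>\<le>\<^sub>0" "\<alpha> + 2 * \<gamma> + 2 \<notin> \<int>\<^sub>\<le>\<^sub>0"
      "\<beta> + \<gamma> + 1 \<notin> \<int>\<^sub>\<le>\<^sub>0" "\<alpha> + \<beta> + \<gamma> + 1 \<notin> \<int>\<^sub>\<le>\<^sub>0" "\<alpha> + 2 * \<beta> + 2 * \<gamma> + 1 \<notin> \<int>\<^sub>\<le>\<^sub>0"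
begin

text \<open>A zero would make \<open>\<beta> + \<gamma>\<close> an integer, negative by the bound on
  its real part; then \<open>\<beta> + \<gamma> + 1\<close> would be a pole of
  \<open>Gamma\<close>.\<close>

lemma sin_\<beta>\<gamma>: "sin (of_real pi * (\<beta> + \<gamma>)) \<noteq> 0"
proof
  assume "sin (of_real pi * (\<beta> + \<gamma>)) = 0"
  then obtain n :: int where "of_real pi * (\<beta> + \<gamma>) = of_real (of_int n * pi)"
    by (auto simp: sin_eq_0)
  then have n: "\<beta> + \<gamma> = of_int n" by (simp add: mult.commute[of _ "complex_of_real pi"])
  then have "n \<le> - 1" using Re_\<beta>\<gamma> by simp
  then have "of_int (n + 1) \<in> (\<int>\<^sub>\<le>\<^sub>0 :: complex set)" by (intro nonpos_Ints_of_int) simp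
  with regular(4) n show False by simp
qed

lemma jacobi_lhs_eq: "jacobi_lhs \<alpha> \<beta> \<gamma> x = C_J * FJ (1 - x\<^sup>2)"
  by (simp add: jacobi_lhs_def jacobi_P_eq)

definition prefactor :: "complex \<Rightarrow> complex" where
  "prefactor x = 2 powr (2 * \<beta>) * sin (of_real pi * (\<beta> + \<gamma>)) * Gamma (\<alpha> + 2 * \<gamma> + 2) *
       Gamma (\<beta> + \<gamma> + 1) * Gamma (\<alpha> + \<beta> + \<gamma> + 1) /
     (sin (of_real pi * \<gamma>) * Gamma (\<gamma> + 1) * Gamma (\<alpha> + \<gamma> + 1) *
       Gamma (\<alpha> + 2 * \<beta> + 2 * \<gamma> + 1) * x powr (2 * \<beta>) * (1 - x\<^sup>2) powr (\<alpha> / 2))"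

lemma jacobi_rhs_eq:
  assumes "x \<in> slit_halfplane"
  shows "jacobi_rhs \<alpha> \<beta> \<gamma> x = prefactor x * integral\<^sup>L unit_borel (seg_integrand x)"
  using contour_integral_unique[OF has_contour_integral_seg[OF assms]]
  by (simp add: jacobi_rhs_def prefactor_def)

lemma Gamma_nonzero: "Gamma (\<gamma> + 1) \<noteq> 0" "Gamma (\<alpha> + \<gamma> + 1) \<noteq> 0" "Gamma (\<alpha> + 2 * \<gamma> + 2) \<noteq> 0"
  "Gamma (\<beta> + \<gamma> + 1) \<noteq> 0" "Gamma (\<alpha> + \<beta> + \<gamma> + 1) \<noteq> 0" "Gamma (\<alpha> + 2 * \<beta> + 2 * \<gamma> + 1) \<noteq> 0" "Gamma \<beta> \<noteq> 0"
  using regular Re_pos_not_nonpos_Int[OF Re_\<beta>] by (simp_all add: Gamma_eq_zero_iff)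

lemma slit_halfplane_nonzero: "x \<in> slit_halfplane \<Longrightarrow> x \<noteq> 0" "x \<in> slit_halfplane \<Longrightarrow> 1 - x\<^sup>2 \<noteq> 0"
  using one_minus_square_slit[of x] by (auto simp: slit_halfplane_iff)

lemma prefactor_holomorphic: "prefactor holomorphic_on slit_halfplane"
proof -
  have "x \<notin> \<real>\<^sub>\<le>\<^sub>0" if "x \<in> slit_halfplane" for x using that by (auto simp: slit_halfplane_iff complex_nonpos_Reals_iff)
  then show ?thesis
    unfolding prefactor_def[abs_def] using one_minus_square_slit slit_halfplane_nonzero Gamma_nonzero sin_\<gamma>
    by (intro holomorphic_intros) auto
qed

lemma jacobi_lhs_eq_rhs_of_real:
  assumes r: "0 < r" "r < 1"
  shows "jacobi_lhs \<alpha> \<beta> \<gamma> (of_real r) = jacobi_rhs \<alpha> \<beta> \<gamma> (of_real r)"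
proof -
  define x where "x = complex_of_real r"
  have x: "x \<in> slit_halfplane" using r by (simp add: x_def slit_halfplane_iff)
  have y: "of_real (1 - r\<^sup>2) = 1 - x\<^sup>2" by (simp add: x_def)
  define py where "py = (1 - x\<^sup>2) powr (\<alpha> / 2)"
  define px where "px = x powr (2 * \<beta>)"
  define p2 where "p2 = (2 :: complex) powr (2 * \<beta>)"
  have p: "py \<noteq> 0" "px \<noteq> 0" "p2 \<noteq> 0" using slit_halfplane_nonzero[OF x] by (auto simp: py_def px_def p2_def)
  have sf: "seg_factor (1 - r\<^sup>2) = C_J * C_G * py / p2"
  proof -
    have "(2 :: complex) powr (- 2 * \<beta>) = inverse p2"
      unfolding p2_def powr_minus[symmetric] by simp
    then show ?thesis unfolding seg_factor_def y py_def by (simp only: divide_inverse)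
  qed
  have C_G: "C_G = Gamma (\<alpha> + 2 * \<beta> + 2 * \<gamma> + 1) / (Gamma \<beta> ^ 2 * Gamma (\<alpha> + 2 * \<gamma> + 2))"
  proof -
    have "2 * \<beta> + \<nu> = \<alpha> + 2 * \<beta> + 2 * \<gamma> + 1" "\<nu> + 1 = \<alpha> + 2 * \<gamma> + 2" by simp_all
    then show ?thesis by (simp only: C_G_def)
  qed
  have nz: "seg_factor (1 - r\<^sup>2) \<noteq> 0"
    unfolding sf C_G C_J_def using p Gamma_nonzero by simp
  define S1 S2 where "S1 = sin (of_real pi * (\<beta> + \<gamma>))" and "S2 = sin (of_real pi * \<gamma>)"
  define g1 g2 where "g1 = Gamma (- (\<beta> + \<gamma>))" and "g2 = Gamma (- \<gamma>)"
  \<comment> \<open>These are the only sine and Gamma factors left once the prefactor has met the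
    value of the integral; as both products equal \<open>- pi\<close>, their quotient is
    one.\<close>
  have S: "S1 * Gamma (\<beta> + \<gamma> + 1) * g1 = - of_real pi" "S2 * Gamma (\<gamma> + 1) * g2 = - of_real pi"
    unfolding S1_def S2_def g1_def g2_def by (intro sin_Gamma_Gamma_minus sin_\<beta>\<gamma> sin_\<gamma>)+
  then have "S2 \<noteq> 0" "g2 \<noteq> 0" by auto
  define K where "K = C_J * FJ (1 - x\<^sup>2)"
  have "integral\<^sup>L unit_borel (seg_integrand x) = C_J * C_G * py / p2 * (Gamma \<beta> ^ 2 * Gamma (\<alpha> + \<gamma> + 1) * g1 / Gamma (\<alpha> + \<beta> + \<gamma> + 1) / g2 *
       px * FJ (1 - x\<^sup>2))"
    unfolding x_def seg_integral_of_real[OF r nz] sf u_integral[OF r]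
    by (simp add: g1_def g2_def px_def x_def rGamma_inverse_Gamma divide_inverse mult_ac)
  also have "\<dots> = K * (Gamma (\<alpha> + 2 * \<beta> + 2 * \<gamma> + 1) / Gamma (\<alpha> + 2 * \<gamma> + 2) * py / p2 * Gamma (\<alpha> + \<gamma> + 1) * g1 / Gamma (\<alpha> + \<beta> + \<gamma> + 1) / g2 * px)"
    unfolding C_G K_def using Gamma_nonzero(7) by (simp add: field_simps)
  finally have I: "integral\<^sup>L unit_borel (seg_integrand x) = K * (Gamma (\<alpha> + 2 * \<beta> + 2 * \<gamma> + 1) / Gamma (\<alpha> + 2 * \<gamma> + 2) * py / p2 * Gamma (\<alpha> + \<gamma> + 1) * g1 / Gamma (\<alpha> + \<beta> + \<gamma> + 1) / g2 * px)" .
  have "jacobi_rhs \<alpha> \<beta> \<gamma> x = K * ((S1 * Gamma (\<beta> + \<gamma> + 1) * g1) / (S2 * Gamma (\<gamma> + 1) * g2))"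
    unfolding jacobi_rhs_eq[OF x] I prefactor_def p2_def[symmetric] px_def[symmetric] py_def[symmetric] S1_def[symmetric] S2_def[symmetric]
    using p Gamma_nonzero \<open>S2 \<noteq> 0\<close> \<open>g2 \<noteq> 0\<close> by (simp add: divide_simps)
  also have "\<dots> = K" unfolding S by simp
  finally show ?thesis by (simp add: jacobi_lhs_eq K_def x_def)
qed

lemma jacobi_lhs_eq_rhs:
  assumes x: "x \<in> slit_halfplane"
  shows "jacobi_lhs \<alpha> \<beta> \<gamma> x = jacobi_rhs \<alpha> \<beta> \<gamma> x"
proof -
  \<comment> \<open>The identity theorem is applied to the integral over the fixed interval, whose
    holomorphy is known, and the contour integral is put back afterwards.\<close>
  have "jacobi_lhs \<alpha> \<beta> \<gamma> x = prefactor x * integral\<^sup>L unit_borel (seg_integrand x)"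
  proof (rule holomorphic_eq_from_real_interval[where U = slit_halfplane and a = 0 and b = 1
          and f = "jacobi_lhs \<alpha> \<beta> \<gamma>" and g = "\<lambda>x. prefactor x * integral\<^sup>L unit_borel (seg_integrand x)"])
    have "(\<lambda>x. FJ (1 - x\<^sup>2)) holomorphic_on slit_halfplane"
      by (rule holomorphic_on_compose_gen[OF _ FJ_holomorphic, unfolded o_def])
         (intro holomorphic_intros, intro image_subsetI one_minus_square_cut_plane, simp add: slit_halfplane_iff)
    then show "jacobi_lhs \<alpha> \<beta> \<gamma> holomorphic_on slit_halfplane"
      unfolding jacobi_lhs_eq[abs_def] by (intro holomorphic_intros)
    show "(\<lambda>x. prefactor x * integral\<^sup>L unit_borel (seg_integrand x)) holomorphic_on slit_halfplane"
      by (intro holomorphic_intros prefactor_holomorphic seg_integral_holomorphic)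
    show real: "of_real ` {0<..<1} \<subseteq> slit_halfplane" by (auto simp: slit_halfplane_iff)
    show "jacobi_lhs \<alpha> \<beta> \<gamma> (of_real r) = prefactor (of_real r) * integral\<^sup>L unit_borel (seg_integrand (of_real r))"
      if "r \<in> {0<..<1}" for r
      using jacobi_lhs_eq_rhs_of_real[of r] jacobi_rhs_eq[of "of_real r"] that by (simp add: slit_halfplane_iff)
  qed (use x in \<open>auto simp: open_slit_halfplane connected_slit_halfplane\<close>)
  then show ?thesis by (simp add: jacobi_rhs_eq[OF x])
qed

end

text \<open>In the right half-plane the principal-branch formula itself is asserted. The second
  conjunct compares arbitrary continuations on a common domain and so also covers points outside
  that half-plane.\<close>

theorem theorem50:
  fixes \<alpha> \<beta> \<gamma> x :: complex
  assumes "\<alpha> \<noteq> 0" and "\<beta> \<noteq> 0" and "\<gamma> \<noteq> 0"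
    and "x \<notin> of_real ` ({..-1} \<union> {1..})"
    and "Re \<beta> > 0" and "Re (\<beta> + \<gamma>) < 0" and "Re (\<alpha> + \<gamma>) > -1"
    and "sin (of_real pi * \<gamma>) \<noteq> 0"
    and "\<gamma> + 1 \<notin> \<int>\<^sub>\<le>\<^sub>0" and "\<alpha> + \<gamma> + 1 \<notin> \<int>\<^sub>\<le>\<^sub>0"
    and "\<alpha> + 2 * \<gamma> + 2 \<notin> \<int>\<^sub>\<le>\<^sub>0" and "\<beta> + \<gamma> + 1 \<notin> \<int>\<^sub>\<le>\<^sub>0"
    and "\<alpha> + \<beta> + \<gamma> + 1 \<notin> \<int>\<^sub>\<le>\<^sub>0" and "\<alpha> + 2 * \<beta> + 2 * \<gamma> + 1 \<notin> \<int>\<^sub>\<le>\<^sub>0"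
  shows "(Re x > 0 \<longrightarrow>
            jacobi_integrand \<alpha> \<beta> \<gamma> x contour_integrable_on linepath x 1 \<and>
            jacobi_lhs \<alpha> \<beta> \<gamma> x = jacobi_rhs \<alpha> \<beta> \<gamma> x) \<and>
         (\<forall>a b U f g.
            U \<subseteq> - (of_real ` ({..-1} \<union> {1..})) \<and> x \<in> U \<and>
            continues_from a b U (jacobi_lhs \<alpha> \<beta> \<gamma>) f \<and>
            continues_from a b U (jacobi_rhs \<alpha> \<beta> \<gamma>) g \<longrightarrow> f x = g x)"
proof -
  interpret jacobi_regular \<alpha> \<beta> \<gamma>
    using assms by unfold_locales
  show ?thesis
  proof (intro conjI impI allI)
    assume "Re x > 0"
    moreover have "x \<in> cut_plane" using assms(4) by auto
    ultimately have x: "x \<in> slit_halfplane" by (simp add: slit_halfplane_def)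
    show "jacobi_integrand \<alpha> \<beta> \<gamma> x contour_integrable_on linepath x 1"
      using has_contour_integral_seg[OF x] by (rule has_contour_integral_integrable)
    show "jacobi_lhs \<alpha> \<beta> \<gamma> x = jacobi_rhs \<alpha> \<beta> \<gamma> x" by (rule jacobi_lhs_eq_rhs[OF x])
  next
    fix a b U f g
    assume "U \<subseteq> - (of_real ` ({..-1} \<union> {1..})) \<and> x \<in> U \<and>
            continues_from a b U (jacobi_lhs \<alpha> \<beta> \<gamma>) f \<and>
            continues_from a b U (jacobi_rhs \<alpha> \<beta> \<gamma>) g"
    then have U: "x \<in> U" "open U" "connected U" "of_real ` {a<..<b} \<subseteq> U" "0 \<le> a" "a < b" "b \<le> 1"
      "f holomorphic_on U" "g holomorphic_on U"
      and fg: "\<And>r. r \<in> {a<..<b} \<Longrightarrow> f (of_real r) = jacobi_lhs \<alpha> \<beta> \<gamma> (of_real r)"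
        "\<And>r. r \<in> {a<..<b} \<Longrightarrow> g (of_real r) = jacobi_rhs \<alpha> \<beta> \<gamma> (of_real r)"
      by (auto simp: continues_from_def)
    show "f x = g x"
    \<comment> \<open>\<open>U\<close> may wind around the branch point \<open>0\<close>, so
      \<open>f\<close> and \<open>g\<close> are compared through the real subinterval alone, where
      both are given by the principal formulas.\<close>
    proof (rule holomorphic_eq_from_real_interval[OF U(8,9,2,3,6,4) _ U(1)])
      show "f (of_real r) = g (of_real r)" if "r \<in> {a<..<b}" for r
        using fg[OF that] jacobi_lhs_eq_rhs_of_real[of r] that U by simp
    qed
  qed
qed

end
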